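(* There exists a vertex-minimal triangulation $T$ of the Klein bottle such that $|V(T)| = 8$ and $\xi(T) = 9$. That is, the following assertion (the first Chen--Lawrencenko conjecture) is false: for every closed, connected 2-manifold $M$ that is not the projective plane and every triangulation $T$ of $M$ with $|V(T)| = V_{\min}(M)$, one has $\xi(T) = |V(T)| = V_{\min}(M)$.
   Context: A closed 2-manifold is a compact 2-manifold without boundary. A finite abstract simplicial complex $T$ consists of a finite vertex set $V(T)$ and a collection $\mathcal{S}(T)$ of subsets of $V(T)$ (simplices), closed under taking subsets and containing every singleton $\{v\}$ with $v \in V(T)$. The face set $F(T)$ is the set of simplices of cardinality 3. A triangulation $T$ of a closed, connected 2-manifold $M$ is a finite abstract simplicial complex whose geometric realization $|T|$ is homeomorphic to $M$ (generalized or ideal triangulations are not allowed). $V_{\min}(M)$ denotes the minimum of $|V(T)|$ over all triangulations $T$ of $M$. A triangulation $T$ of $M$ is vertex-minimal if $|V(T)| = V_{\min}(M)$. A cyclic coloration of a triangulation $T$ is a coloring of the faces (elements of $F(T)$) such that, for each $v \in V(T)$, the faces containing $v$ have pairwise distinct colors; equivalently, any two distinct faces sharing a vertex have different colors. The cyclic chromatic number $\xi(T)$ is the least $k$ such that $T$ admits a cyclic coloration with $k$ colors. The Klein bottle is the quotient of $[0,1]^2$ by the identifications $(x,0) \sim (x,1)$ and $(0,y) \sim (1,1-y)$ for $x,y \in [0,1]$. *)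

theory Defs
  imports "HOL-Analysis.Analysis"
begin

section \<open>Quotient spaces\<close>

definition quotient_topology :: "'a topology \<Rightarrow> ('a \<Rightarrow> 'b) \<Rightarrow> 'b topology" where
  "quotient_topology X f =
     topology (\<lambda>U. U \<subseteq> f ` topspace X \<and> openin X {x \<in> topspace X. f x \<in> U})"

lemma openin_quotient_topology:
  "openin (quotient_topology X f) U \<longleftrightarrow>
     U \<subseteq> f ` topspace X \<and> openin X {x \<in> topspace X. f x \<in> U}"
proof -
  let ?P = "\<lambda>U. U \<subseteq> f ` topspace X \<and> openin X {x \<in> topspace X. f x \<in> U}"
  have "?P (S \<inter> T)" if "?P S" "?P T" for S T
  proof -
    have "{x \<in> topspace X. f x \<in> S \<inter> T} =
        {x \<in> topspace X. f x \<in> S} \<inter> {x \<in> topspace X. f x \<in> T}"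
      by auto
    with that show ?thesis
      by (metis (no_types, lifting) le_infI1 openin_Int)
  qed
  moreover have "?P (\<Union>\<K>)" if "\<forall>K\<in>\<K>. ?P K" for \<K>
  proof
    show "\<Union>\<K> \<subseteq> f ` topspace X"
      using that by (simp add: Sup_least)
    have "{x \<in> topspace X. f x \<in> \<Union>\<K>} = \<Union>((\<lambda>K. {x \<in> topspace X. f x \<in> K}) ` \<K>)"
      by auto
    also have "openin X \<dots>"
      using that by (intro openin_Union) blast
    finally show "openin X {x \<in> topspace X. f x \<in> \<Union>\<K>}" .
  qed
  ultimately have "istopology ?P"
    unfolding istopology_def by simp
  then show ?thesis
    by (simp add: quotient_topology_def)
qed

lemma topspace_quotient_topology: "topspace (quotient_topology X f) = f ` topspace X"
proof
  show "topspace (quotient_topology X f) \<subseteq> f ` topspace X"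
    by (metis openin_quotient_topology openin_topspace)
  have "{x \<in> topspace X. f x \<in> f ` topspace X} = topspace X"
    by auto
  then have "openin (quotient_topology X f) (f ` topspace X)"
    by (simp add: openin_quotient_topology)
  then show "f ` topspace X \<subseteq> topspace (quotient_topology X f)"
    by (rule openin_subset)
qed

lemma quotient_map_quotient_topology: "quotient_map X (quotient_topology X f) f"
  by (simp add: quotient_map_def topspace_quotient_topology openin_quotient_topology)

definition unit_square :: "(real \<times> real) set" where
  "unit_square = {0..1} \<times> {0..1}"

text \<open>The square modulo the least equivalence relation containing \<open>r\<close>; points are
  equivalence classes.  If \<open>r\<close> relates only points of the square, the class of a point of
  the square stays inside the square.\<close>

definition glued_square ::
    "(real \<times> real \<Rightarrow> real \<times> real \<Rightarrow> bool) \<Rightarrow> (real \<times> real) set topology" where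
  "glued_square r = quotient_topology (top_of_set unit_square) (\<lambda>p. {q. equivclp r p q})"

definition klein_glue :: "real \<times> real \<Rightarrow> real \<times> real \<Rightarrow> bool" where
  "klein_glue p q \<longleftrightarrow>
     (\<exists>x\<in>{0..1}. p = (x, 0) \<and> q = (x, 1)) \<or> (\<exists>y\<in>{0..1}. p = (0, y) \<and> q = (1, 1 - y))"

definition projective_glue :: "real \<times> real \<Rightarrow> real \<times> real \<Rightarrow> bool" where
  "projective_glue p q \<longleftrightarrow>
     (\<exists>x\<in>{0..1}. p = (x, 0) \<and> q = (1 - x, 1)) \<or> (\<exists>y\<in>{0..1}. p = (0, y) \<and> q = (1, 1 - y))"

definition klein_bottle :: "(real \<times> real) set topology" where
  "klein_bottle = glued_square klein_glue"

definition projective_plane :: "(real \<times> real) set topology" where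
  "projective_plane = glued_square projective_glue"


section \<open>Closed connected 2-manifolds\<close>

definition two_manifold :: "'a topology \<Rightarrow> bool" where
  "two_manifold M \<longleftrightarrow>
     Hausdorff_space M \<and> second_countable M \<and>
     (\<forall>x\<in>topspace M. \<exists>U W. openin M U \<and> x \<in> U \<and> open (W :: (real \<times> real) set) \<and>
        subtopology M U homeomorphic_space top_of_set W)"

definition closed_connected_two_manifold :: "'a topology \<Rightarrow> bool" where
  "closed_connected_two_manifold M \<longleftrightarrow>
     two_manifold M \<and> compact_space M \<and> connected_space M \<and> topspace M \<noteq> {}"


section \<open>Triangulations\<close>

record 'v abstract_complex =
  verts :: "'v set"
  simplices :: "'v set set"

definition finite_abstract_complex :: "'v abstract_complex \<Rightarrow> bool" where
  "finite_abstract_complex T \<longleftrightarrow>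
     finite (verts T) \<and> simplices T \<subseteq> Pow (verts T) \<and>
     (\<forall>s\<in>simplices T. \<forall>t. t \<subseteq> s \<longrightarrow> t \<in> simplices T) \<and>
     (\<forall>v\<in>verts T. {v} \<in> simplices T)"

definition faces :: "'v abstract_complex \<Rightarrow> 'v set set" where
  "faces T = {s \<in> simplices T. card s = 3}"

text \<open>Points of the realization are barycentric coordinate functions (extended by \<open>0\<close> outside
  the vertex set) whose support is a simplex.\<close>

definition realization :: "'v abstract_complex \<Rightarrow> ('v \<Rightarrow> real) topology" where
  "realization T = subtopology (powertop_real UNIV)
     {x. (\<forall>v. 0 \<le> x v) \<and> {v. x v \<noteq> 0} \<in> simplices T \<and> (\<Sum>v\<in>verts T. x v) = 1}"

definition triangulation_of :: "'v abstract_complex \<Rightarrow> 'a topology \<Rightarrow> bool" where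
  "triangulation_of T M \<longleftrightarrow> finite_abstract_complex T \<and> realization T homeomorphic_space M"

text \<open>Vertex sets are finite, so complexes with vertices in \<^typ>\<open>nat\<close> suffice.  The value is
  meaningful only if \<open>M\<close> has a triangulation.\<close>

definition V_min :: "'a topology \<Rightarrow> nat" where
  "V_min M = (LEAST n. \<exists>T :: nat abstract_complex. triangulation_of T M \<and> card (verts T) = n)"

definition vertex_minimal_triangulation :: "'v abstract_complex \<Rightarrow> 'a topology \<Rightarrow> bool" where
  "vertex_minimal_triangulation T M \<longleftrightarrow> triangulation_of T M \<and> card (verts T) = V_min M"


section \<open>Cyclic colorations\<close>

definition cyclic_coloration :: "'v abstract_complex \<Rightarrow> ('v set \<Rightarrow> 'c) \<Rightarrow> bool" where
  "cyclic_coloration T c \<longleftrightarrow> (\<forall>v\<in>verts T. inj_on c {f \<in> faces T. v \<in> f})"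

definition cyclic_chromatic_number :: "'v abstract_complex \<Rightarrow> nat" where
  "cyclic_chromatic_number T =
     (LEAST k. \<exists>c :: 'v set \<Rightarrow> nat. cyclic_coloration T c \<and> c ` faces T \<subseteq> {..<k})"


section \<open>The first Chen--Lawrencenko conjecture\<close>

text \<open>Every closed 2-manifold has at most continuum many points, hence is homeomorphic to a space
  whose points lie in any given type of that cardinality or larger, such as the one chosen
  here.\<close>

definition chen_lawrencenko_conjecture_1 :: bool where
  "chen_lawrencenko_conjecture_1 \<longleftrightarrow>
     (\<forall>(M :: (real \<times> real) set topology) (T :: nat abstract_complex).
        closed_connected_two_manifold M \<and> \<not> M homeomorphic_space projective_plane \<and>
        triangulation_of T M \<and> card (verts T) = V_min M \<longrightarrow>
        cyclic_chromatic_number T = card (verts T) \<and> card (verts T) = V_min M)"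

end

theory Submission
  imports Defs "HOL-Library.Z2"
begin

text \<open>
  The witness is the triangulation \<open>klein8\<close> with 8 vertices and 16 faces. Its face
  \<open>{0, 2, 5}\<close> meets every other face, and three disjoint faces would need 9 vertices, so
  8 colours allow at most \<open>1 + 2 * 7 = 15\<close> faces; a pairing of the remaining 15 faces shows that
  9 colours suffice.

  That 8 vertices are necessary is a matter of first cohomology, which the realization determines:
  simplicial cocycles correspond to functions on pairs of nearby points that satisfy the cocycle
  identity locally. Modulo 2 the Klein bottle has two independent classes, and counting cochains
  yields \<open>V + F \<le> E\<close> for every triangulation; with \<open>3 F = 2 E\<close> this gives
  \<open>V \<ge> 7\<close>, and every pair of vertices spans an edge if \<open>V = 7\<close>. Such a complex is the
  Moebius torus, which has two independent integral classes, whereas \<open>klein8\<close> has only one.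

  The Klein bottle is not the projective plane because it carries a nontrivial integral class, while
  on the projective plane every integral local cocycle has a potential.
\<close>

section \<open>Alexander--Spanier and simplicial cohomology in degree one\<close>

text \<open>Two triangulations of one space share no vertices, so their cocycles are compared
  through functions on pairs of nearby points. These need not be continuous and pull back along
  every continuous map; on a realization it is enough to replace each point by a vertex at which its
  coordinate is largest. Degree one and an injective linear comparison are all that the argument
  asks for. The two coefficient rings do different work. Over the integers the Klein bottle has a
  single independent class, too few for the count of edges. Modulo 2 there are two, signs disappear,
  cochains are sets of edges, and ranks become cardinalities of finite sets. The torus and the Klein
  bottle, however, look alike modulo 2, so the count cannot exclude seven vertices, and that case
  has to be decided over the integers. Torsion is also what separates the projective plane: it has a
  class modulo 2 but none over the integers. The obstacle on the topological side is to obtain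
  purity, two faces at every edge and connected links from the definition of a manifold by charts;
  this is where invariance of domain enters.\<close>

text \<open>Alexander--Spanier cochains of degree one: functions of pairs of points, of which only the
  values near the diagonal matter. \<open>potential_on S \<phi> g\<close> says that \<open>\<phi>\<close> is
  the coboundary of \<open>g\<close>.\<close>

definition local_cocycle :: "'a::topological_space set \<Rightarrow> ('a \<Rightarrow> 'a \<Rightarrow> 'b::ab_group_add) \<Rightarrow> bool" where
  "local_cocycle S \<phi> \<longleftrightarrow>
     (\<forall>p\<in>S. \<exists>U. open U \<and> p \<in> U \<and> (\<forall>x\<in>S \<inter> U. \<forall>y\<in>S \<inter> U. \<forall>z\<in>S \<inter> U. \<phi> x y + \<phi> y z = \<phi> x z))"

definition potential_on :: "'a::topological_space set \<Rightarrow> ('a \<Rightarrow> 'a \<Rightarrow> 'b::ab_group_add) \<Rightarrow> ('a \<Rightarrow> 'b) \<Rightarrow> bool" where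
  "potential_on S \<phi> g \<longleftrightarrow>
     (\<forall>p\<in>S. \<exists>U. open U \<and> p \<in> U \<and> (\<forall>x\<in>S \<inter> U. \<forall>y\<in>S \<inter> U. \<phi> x y = g y - g x))"

lemma local_cocycleE:
  assumes "local_cocycle S \<phi>" "p \<in> S"
  obtains U where "open U" "p \<in> U"
    "\<And>x y z. x \<in> S \<inter> U \<Longrightarrow> y \<in> S \<inter> U \<Longrightarrow> z \<in> S \<inter> U \<Longrightarrow> \<phi> x y + \<phi> y z = \<phi> x z"
proof -
  from bspec[OF assms(1)[unfolded local_cocycle_def] assms(2)] obtain U where U: "open U" "p \<in> U"
    "\<forall>x\<in>S \<inter> U. \<forall>y\<in>S \<inter> U. \<forall>z\<in>S \<inter> U. \<phi> x y + \<phi> y z = \<phi> x z" by (elim exE conjE)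
  show ?thesis by (rule that[OF U(1,2) U(3)[rule_format]])
qed

lemma potential_onE:
  assumes "potential_on S \<phi> g" "p \<in> S"
  obtains U where "open U" "p \<in> U" "\<And>x y. x \<in> S \<inter> U \<Longrightarrow> y \<in> S \<inter> U \<Longrightarrow> \<phi> x y = g y - g x"
proof -
  from bspec[OF assms(1)[unfolded potential_on_def] assms(2)] obtain U where U: "open U" "p \<in> U"
    "\<forall>x\<in>S \<inter> U. \<forall>y\<in>S \<inter> U. \<phi> x y = g y - g x" by (elim exE conjE)
  show ?thesis by (rule that[OF U(1,2) U(3)[rule_format]])
qed

lemma local_cocycle_subset:
  assumes "local_cocycle S \<phi>" "T \<subseteq> S" shows "local_cocycle T \<phi>"
  unfolding local_cocycle_def
proof
  fix p assume "p \<in> T"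
  then have "p \<in> S" using assms(2) by blast
  then obtain U where U: "open U" "p \<in> U"
      "\<And>x y z. x \<in> S \<inter> U \<Longrightarrow> y \<in> S \<inter> U \<Longrightarrow> z \<in> S \<inter> U \<Longrightarrow> \<phi> x y + \<phi> y z = \<phi> x z"
    using local_cocycleE[OF assms(1)] by metis
  then show "\<exists>U. open U \<and> p \<in> U \<and> (\<forall>x\<in>T \<inter> U. \<forall>y\<in>T \<inter> U. \<forall>z\<in>T \<inter> U. \<phi> x y + \<phi> y z = \<phi> x z)"
    using assms(2) by (intro exI[of _ U]) blast
qed

lemma potential_on_subset:
  assumes "potential_on S \<phi> g" "T \<subseteq> S" shows "potential_on T \<phi> g"
  unfolding potential_on_def
proof
  fix p assume "p \<in> T"
  then have "p \<in> S" using assms(2) by blast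
  then obtain U where U: "open U" "p \<in> U" "\<And>x y. x \<in> S \<inter> U \<Longrightarrow> y \<in> S \<inter> U \<Longrightarrow> \<phi> x y = g y - g x"
    using potential_onE[OF assms(1)] by metis
  then show "\<exists>U. open U \<and> p \<in> U \<and> (\<forall>x\<in>T \<inter> U. \<forall>y\<in>T \<inter> U. \<phi> x y = g y - g x)"
    using assms(2) by (intro exI[of _ U]) blast
qed

lemma potential_on_shift: "potential_on S \<phi> g \<Longrightarrow> potential_on S \<phi> (\<lambda>x. g x + c)"
  unfolding potential_on_def by simp

lemma continuous_on_open_nbhd:
  assumes "continuous_on S f" "open V" "p \<in> S" "f p \<in> V"
  obtains U where "open U" "p \<in> U" "\<And>x. x \<in> S \<inter> U \<Longrightarrow> f x \<in> V"
proof -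
  have "\<exists>U. open U \<and> p \<in> U \<and> (\<forall>x\<in>S. x \<in> U \<longrightarrow> f x \<in> V)"
    using assms unfolding continuous_on_topological by meson
  then show ?thesis using that by blast
qed

lemma local_cocycle_pullback:
  assumes "local_cocycle T \<phi>" "continuous_on S f" "f ` S \<subseteq> T"
  shows "local_cocycle S (\<lambda>x y. \<phi> (f x) (f y))"
  unfolding local_cocycle_def
proof
  fix p assume p: "p \<in> S"
  then have "f p \<in> T" using assms(3) by blast
  then obtain V where V: "open V" "f p \<in> V"
      "\<And>x y z. x \<in> T \<inter> V \<Longrightarrow> y \<in> T \<inter> V \<Longrightarrow> z \<in> T \<inter> V \<Longrightarrow> \<phi> x y + \<phi> y z = \<phi> x z"
    using local_cocycleE[OF assms(1)] by metis
  from continuous_on_open_nbhd[OF assms(2) V(1) p V(2)] obtain U where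
    U: "open U" "p \<in> U" "\<And>x. x \<in> S \<inter> U \<Longrightarrow> f x \<in> V" by metis
  have "f x \<in> T \<inter> V" if "x \<in> S \<inter> U" for x
    using that U(3) assms(3) by blast
  with V(3) U show "\<exists>U. open U \<and> p \<in> U \<and> (\<forall>x\<in>S \<inter> U. \<forall>y\<in>S \<inter> U. \<forall>z\<in>S \<inter> U.
      \<phi> (f x) (f y) + \<phi> (f y) (f z) = \<phi> (f x) (f z))"
    by (intro exI[of _ U]) blast
qed

lemma potential_on_pullback:
  assumes "potential_on T \<phi> g" "continuous_on S f" "f ` S \<subseteq> T"
  shows "potential_on S (\<lambda>x y. \<phi> (f x) (f y)) (\<lambda>x. g (f x))"
  unfolding potential_on_def
proof
  fix p assume p: "p \<in> S"
  then have "f p \<in> T" using assms(3) by blast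
  then obtain V where V: "open V" "f p \<in> V" "\<And>x y. x \<in> T \<inter> V \<Longrightarrow> y \<in> T \<inter> V \<Longrightarrow> \<phi> x y = g y - g x"
    using potential_onE[OF assms(1)] by metis
  from continuous_on_open_nbhd[OF assms(2) V(1) p V(2)] obtain U where
    U: "open U" "p \<in> U" "\<And>x. x \<in> S \<inter> U \<Longrightarrow> f x \<in> V" by metis
  have "f x \<in> T \<inter> V" if "x \<in> S \<inter> U" for x
    using that U(3) assms(3) by blast
  with V(3) U show "\<exists>U. open U \<and> p \<in> U \<and> (\<forall>x\<in>S \<inter> U. \<forall>y\<in>S \<inter> U. \<phi> (f x) (f y) = g (f y) - g (f x))"
    by (intro exI[of _ U]) blast
qed

lemma connected_locally_constant:
  assumes S: "connected S" "a \<in> S" "b \<in> S"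
    and loc: "\<And>p. p \<in> S \<Longrightarrow> \<exists>U. open U \<and> p \<in> U \<and> (\<forall>x\<in>S \<inter> U. f x = f p)"
  shows "f a = f b"
proof (rule connected_local_const[OF S], intro ballI)
  fix p assume "p \<in> S"
  from loc[OF this] obtain U where "open U" "p \<in> U" "\<forall>x\<in>S \<inter> U. f x = f p" by blast
  then show "\<forall>\<^sub>F x in at p within S. f p = f x"
    unfolding eventually_at_topological by (intro exI[of _ U]) auto
qed

text \<open>The difference of two potentials of the same cochain is locally constant, hence constant
  on a connected set.\<close>

lemma potential_on_unique:
  assumes "connected S" "potential_on S \<phi> g" "potential_on S \<phi> h" "a \<in> S" "b \<in> S"
  shows "g b - g a = h b - h a"
proof -
  have "g a - h a = g b - h b"
  proof (rule connected_locally_constant[OF assms(1,4,5)])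
    fix p assume p: "p \<in> S"
    obtain U where U: "open U" "p \<in> U" "\<And>x y. x \<in> S \<inter> U \<Longrightarrow> y \<in> S \<inter> U \<Longrightarrow> \<phi> x y = g y - g x"
      using potential_onE[OF assms(2) p] by metis
    obtain V where V: "open V" "p \<in> V" "\<And>x y. x \<in> S \<inter> V \<Longrightarrow> y \<in> S \<inter> V \<Longrightarrow> \<phi> x y = h y - h x"
      using potential_onE[OF assms(3) p] by metis
    have "g x - h x = g p - h p" if "x \<in> S \<inter> (U \<inter> V)" for x
    proof -
      have "\<phi> p x = g x - g p" "\<phi> p x = h x - h p" using that U(2,3) V(2,3) p by blast+
      then have "g x - g p = h x - h p" by simp
      then show ?thesis by (simp add: algebra_simps)
    qed
    with U V show "\<exists>W. open W \<and> p \<in> W \<and> (\<forall>x\<in>S \<inter> W. g x - h x = g p - h p)"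
      by (intro exI[of _ "U \<inter> V"]) auto
  qed
  then show ?thesis by (simp add: algebra_simps)
qed

text \<open>The potential of \<open>x\<close> adds up \<open>\<phi>\<close> along the path traced by \<open>x\<close> under a contraction,
  subdivided so finely that neighbouring paths form a ladder with additive rungs.\<close>

lemma potential_exists_contractible:
  fixes S :: "'a::metric_space set" and \<phi> :: "'a \<Rightarrow> 'a \<Rightarrow> 'b::ab_group_add"
  assumes S: "compact S" and H: "continuous_on ({0..1::real} \<times> S) (\<lambda>(t, x). H t x)"
    and HS: "\<And>t x. t \<in> {0..1} \<Longrightarrow> x \<in> S \<Longrightarrow> H t x \<in> S"
    and H01: "\<And>x. x \<in> S \<Longrightarrow> H 0 x = p" "\<And>x. x \<in> S \<Longrightarrow> H 1 x = x"
    and \<phi>: "local_cocycle S \<phi>"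
  shows "\<exists>g. potential_on S \<phi> g"
proof -
  define \<G> where "\<G> = {U. open U \<and> (\<forall>x\<in>S \<inter> U. \<forall>y\<in>S \<inter> U. \<forall>z\<in>S \<inter> U. \<phi> x y + \<phi> y z = \<phi> x z)}"
  have "S \<subseteq> \<Union>\<G>"
  proof
    fix x assume "x \<in> S"
    from bspec[OF \<phi>[unfolded local_cocycle_def] this] show "x \<in> \<Union>\<G>" unfolding \<G>_def by blast
  qed
  \<comment> \<open>A Lebesgue number of the cover: the cocycle identity holds among points of
    \<open>S\<close> in any ball of radius \<open>e\<close> about a point of
    \<open>S\<close>.\<close>
  then obtain e where e: "0 < e" "\<And>x. x \<in> S \<Longrightarrow> \<exists>G\<in>\<G>. ball x e \<subseteq> G"
    using Heine_Borel_lemma[OF S, of \<G>] unfolding \<G>_def by blast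
  have add: "\<phi> x y + \<phi> y z = \<phi> x z"
    if "c \<in> S" "x \<in> S" "y \<in> S" "z \<in> S" "dist c x < e" "dist c y < e" "dist c z < e" for c x y z
    using e(2)[OF that(1)] that unfolding \<G>_def by (auto simp: subset_iff)
  have "uniformly_continuous_on ({0..1} \<times> S) (\<lambda>(t, x). H t x)"
    by (intro compact_uniformly_continuous H compact_Times compact_Icc S)
  then obtain d where d: "0 < d" "\<And>u v. u \<in> {0..1} \<times> S \<Longrightarrow> v \<in> {0..1} \<times> S \<Longrightarrow> dist v u < d \<Longrightarrow>
      dist ((\<lambda>(t, x). H t x) v) ((\<lambda>(t, x). H t x) u) < e"
    unfolding uniformly_continuous_on_def using e(1) by meson
  have close: "dist (H s x) (H t y) < e"
    if "s \<in> {0..1}" "t \<in> {0..1}" "x \<in> S" "y \<in> S" "\<bar>s - t\<bar> < d/2" "dist x y < d/2" for s t x y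
  proof -
    have "dist (s, x) (t, y) \<le> \<bar>s - t\<bar> + dist x y"
      unfolding dist_Pair_Pair dist_real_def using sqrt_sum_squares_le_sum[of "\<bar>s - t\<bar>" "dist x y"] by simp
    then have "dist (s, x) (t, y) < d" using that by linarith
    then show ?thesis using d(2)[of "(t, y)" "(s, x)"] that by simp
  qed
  \<comment> \<open>Half of \<open>d\<close> is reserved for one step of time and the other half for
    the distance between the two starting points.\<close>
  obtain N :: nat where N: "N > 0" "1 / real N < d/2"
    using reals_Archimedean[of "d/2"] d(1) by (metis half_gt_zero inverse_eq_divide zero_less_Suc)
  define q where "q i x = H (real i / real N) x" for i x
  define g where "g x = (\<Sum>i<N. \<phi> (q i x) (q (Suc i) x))" for x
  have in01: "real i / real N \<in> {0..1}" if "i \<le> N" for i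
    using that N(1) by (auto simp: field_simps)
  have q0: "q 0 x = p" "q N x = x" if "x \<in> S" for x
    using that N(1) H01 unfolding q_def by auto
  have qS: "q i x \<in> S" if "i \<le> N" "x \<in> S" for i x
    unfolding q_def using HS in01 that by blast
  have ladder_step: "s + b + c = s' + d" if "b + c = f" "a + d = f" "s + a = s'" for a b c d f s s' :: 'b
    using that by (metis add.assoc)
  have g: "\<phi> x y = g y - g x" if xy: "x \<in> S" "y \<in> S" "dist x y < d/2" for x y
  proof -
    \<comment> \<open>Both ways around a square of the ladder give the value on its diagonal, since
      all corners lie within \<open>e\<close> of \<open>q n x\<close>. The lowest rung is
      \<open>\<phi> p p = 0\<close>.\<close>
    have ladder: "(\<Sum>i<n. \<phi> (q i x) (q (Suc i) x)) + \<phi> (q n x) (q n y) = (\<Sum>i<n. \<phi> (q i y) (q (Suc i) y))"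
      if "n \<le> N" for n
      using that
    proof (induction n)
      case 0
      have "p \<in> S" using qS[of 0 x] q0 xy by simp
      then have "\<phi> p p + \<phi> p p = \<phi> p p" using add[of p p p p] e(1) by simp
      then show ?case using q0 xy by simp
    next
      case (Suc n)
      have st: "\<bar>real n / real N - real (Suc n) / real N\<bar> < d/2"
        using N by (simp add: field_simps)
      have d2: "0 < d/2" using d(1) by simp
      have m: "q n x \<in> S" "q n y \<in> S" "q (Suc n) x \<in> S" "q (Suc n) y \<in> S"
        using qS Suc.prems xy by auto
      have dd: "dist (q n x) (q n x) < e" "dist (q n x) (q n y) < e"
          "dist (q n x) (q (Suc n) x) < e" "dist (q n x) (q (Suc n) y) < e"
        unfolding q_def using close in01 Suc.prems xy st d2 e(1) by auto
      have "\<phi> (q n x) (q (Suc n) x) + \<phi> (q (Suc n) x) (q (Suc n) y) = \<phi> (q n x) (q (Suc n) y)"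
           "\<phi> (q n x) (q n y) + \<phi> (q n y) (q (Suc n) y) = \<phi> (q n x) (q (Suc n) y)"
        using add[OF m(1)] m dd by blast+
      moreover have "(\<Sum>i<n. \<phi> (q i x) (q (Suc i) x)) + \<phi> (q n x) (q n y) = (\<Sum>i<n. \<phi> (q i y) (q (Suc i) y))"
        using Suc by simp
      ultimately show ?case
        unfolding sum.lessThan_Suc by (rule ladder_step)
    qed
    from ladder[of N] q0 xy show ?thesis unfolding g_def by (simp add: algebra_simps)
  qed
  have "potential_on S \<phi> g"
    unfolding potential_on_def
  proof
    fix x assume "x \<in> S"
    have "\<phi> y z = g z - g y" if "y \<in> S \<inter> ball x (d/4)" "z \<in> S \<inter> ball x (d/4)" for y z
    proof (rule g)
      show "dist y z < d/2" using that dist_triangle_half_r[of x y "d/2" z] by auto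
    qed (use that in auto)
    then show "\<exists>U. open U \<and> x \<in> U \<and> (\<forall>y\<in>S \<inter> U. \<forall>z\<in>S \<inter> U. \<phi> y z = g z - g y)"
      using d(1) by (intro exI[of _ "ball x (d/4)"]) auto
  qed
  then show ?thesis by blast
qed

section \<open>Geometric realizations and their closed cells\<close>

definition geom :: "'v abstract_complex \<Rightarrow> ('v \<Rightarrow> real) set" where
  "geom T = {x. (\<forall>v. 0 \<le> x v) \<and> {v. x v \<noteq> 0} \<in> simplices T \<and> (\<Sum>v\<in>verts T. x v) = 1}"

definition cell :: "'v set \<Rightarrow> ('v \<Rightarrow> real) set" where
  "cell s = {x. (\<forall>v. 0 \<le> x v) \<and> {v. x v \<noteq> 0} \<subseteq> s \<and> (\<Sum>v\<in>s. x v) = 1}"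

definition vertex_point :: "'v \<Rightarrow> 'v \<Rightarrow> real" where
  "vertex_point v = (\<lambda>w. if w = v then 1 else 0)"

lemma realization_geom: "realization T = top_of_set (geom T)"
  unfolding realization_def geom_def by (simp add: euclidean_product_topology)

lemma continuous_on_coordinate [continuous_intros]: "continuous_on S (\<lambda>x. (x :: 'v \<Rightarrow> real) v)"
  by (rule continuous_on_subset[OF continuous_on_product_coordinates]) simp

lemma complex_finite_simplex:
  "finite_abstract_complex T \<Longrightarrow> s \<in> simplices T \<Longrightarrow> finite s \<and> s \<subseteq> verts T"
  unfolding finite_abstract_complex_def by (meson PowD rev_finite_subset subsetD)

lemma complex_subset:
  "finite_abstract_complex T \<Longrightarrow> s \<in> simplices T \<Longrightarrow> t \<subseteq> s \<Longrightarrow> t \<in> simplices T"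
  unfolding finite_abstract_complex_def by blast

lemma vertex_point_cell: "finite s \<Longrightarrow> v \<in> s \<Longrightarrow> vertex_point v \<in> cell s"
  unfolding cell_def vertex_point_def by auto

lemma cell_mono:
  assumes "finite t" "s \<subseteq> t" shows "cell s \<subseteq> cell t"
proof
  fix x assume x: "x \<in> cell s"
  have "sum x t = sum x s"
    by (rule sum.mono_neutral_right) (use assms x in \<open>auto simp: cell_def\<close>)
  with x assms show "x \<in> cell t" unfolding cell_def by auto
qed

lemma cell_subset_geom:
  assumes "finite_abstract_complex T" "s \<in> simplices T"
  shows "cell s \<subseteq> geom T"
proof
  fix x assume x: "x \<in> cell s"
  have s: "finite (verts T)" "s \<subseteq> verts T"
    using assms complex_finite_simplex unfolding finite_abstract_complex_def by auto
  have "x \<in> cell (verts T)" using cell_mono[OF s] x by blast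
  with x show "x \<in> geom T"
    unfolding cell_def geom_def using complex_subset[OF assms] by simp
qed

lemma geom_support_cell:
  assumes "finite_abstract_complex T" "x \<in> geom T"
  shows "{v. x v \<noteq> 0} \<in> simplices T" "x \<in> cell {v. x v \<noteq> 0}"
proof -
  show s: "{v. x v \<noteq> 0} \<in> simplices T" using assms unfolding geom_def by blast
  have fin: "finite (verts T)" "{v. x v \<noteq> 0} \<subseteq> verts T"
    using complex_finite_simplex[OF assms(1) s] assms(1) unfolding finite_abstract_complex_def by auto
  have "sum x (verts T) = sum x {v. x v \<noteq> 0}"
    by (rule sum.mono_neutral_right) (use fin in auto)
  with assms(2) show "x \<in> cell {v. x v \<noteq> 0}" unfolding geom_def cell_def by auto
qed

lemma cell_closed: "closed (cell (s :: 'v set))"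
proof -
  have "cell s = (\<Inter>v. {x. 0 \<le> x v}) \<inter> (\<Inter>v\<in>-s. {x. x v = 0}) \<inter> {x. (\<Sum>v\<in>s. x v) = 1}"
    unfolding cell_def by auto
  then show ?thesis
    by (simp only:) (intro closed_Int closed_INT ballI closed_Collect_le closed_Collect_eq continuous_intros)
qed

text \<open>By Tychonoff's theorem, as a closed subset of a product of unit intervals.\<close>

lemma cell_compact: "finite s \<Longrightarrow> compact (cell (s :: 'v set))"
proof -
  assume fin: "finite s"
  let ?B = "PiE (UNIV :: 'v set) (\<lambda>_. {0..1::real})"
  have "compactin (product_topology (\<lambda>i. euclidean) UNIV) ?B"
    unfolding compactin_PiE by simp
  then have B: "compact ?B" by (simp add: euclidean_product_topology)
  have "x v \<le> 1" if x: "x \<in> cell s" for x v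
  proof (cases "v \<in> s")
    case True
    then have "x v \<le> sum x s" using x fin by (intro member_le_sum) (auto simp: cell_def)
    then show ?thesis using x by (simp add: cell_def)
  qed (use x in \<open>force simp: cell_def\<close>)
  then have "cell s \<subseteq> ?B" by (auto simp: cell_def)
  then show ?thesis
    using compact_Int_closed[OF B cell_closed, of s] by (simp add: inf.absorb2)
qed

lemma cell_straight_line:
  assumes "t \<in> {0..1}" "x \<in> cell s" "y \<in> cell s"
  shows "(\<lambda>v. (1 - t) * x v + t * y v) \<in> cell s"
proof -
  have "(1 - t) * x v + t * y v = 0" if "v \<notin> s" for v
    using that assms unfolding cell_def by (simp add: subset_iff) (metis mult_zero_right add_0)
  then show ?thesis
    using assms unfolding cell_def by (auto simp: sum.distrib sum_distrib_left[symmetric])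
qed

lemma cell_connected: "connected (cell (s :: 'v set))"
proof (cases "cell s = {}")
  case False
  then obtain a where a: "a \<in> cell s" by blast
  define L where "L y = (\<lambda>t v. (1 - t) * a v + t * y v) ` {0..1::real}" for y
  have "connected (L y)" for y
    unfolding L_def by (intro connected_continuous_image continuous_intros) auto
  moreover have "a \<in> L y" for y
    unfolding L_def by (rule image_eqI[of _ _ 0]) auto
  ultimately have "connected (\<Union>(L ` cell s))"
    by (intro connected_Union) blast+
  moreover have "\<Union>(L ` cell s) = cell s"
  proof
    show "\<Union>(L ` cell s) \<subseteq> cell s"
      unfolding L_def using cell_straight_line[OF _ a] by auto
    have "y \<in> L y" for y unfolding L_def by (rule image_eqI[of _ _ 1]) auto
    then show "cell s \<subseteq> \<Union>(L ` cell s)" by blast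
  qed
  ultimately show ?thesis by simp
qed simp

text \<open>A cell contracts along straight lines to any of its points. The vertex type is countable
  because the function space carries its metric only then.\<close>

lemma cell_potential_exists:
  fixes s :: "'v::countable set"
  assumes "finite s" "local_cocycle (cell s) \<phi>"
  shows "\<exists>g. potential_on (cell s) \<phi> g"
proof (cases "cell s = {}")
  case True
  then show ?thesis by (simp add: potential_on_def)
next
  case False
  then obtain a where a: "a \<in> cell s" by blast
  show ?thesis
  proof (rule potential_exists_contractible[where H = "\<lambda>t y v. (1 - t) * a v + t * y v" and p = a])
    show "continuous_on ({0..1} \<times> cell s) (\<lambda>(t, x). \<lambda>v. (1 - t) * a v + t * x v)"
      unfolding case_prod_beta
      by (intro continuous_intros continuous_on_product_then_coordinatewise[OF continuous_on_snd])
  qed (use assms cell_compact cell_straight_line[OF _ a] in auto)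
qed

text \<open>Simplicial 1-cochains are functions of ordered vertex pairs; only their values on pairs
  spanning a simplex matter.\<close>

definition simplicial_cocycle :: "'v abstract_complex \<Rightarrow> ('v \<Rightarrow> 'v \<Rightarrow> 'b::ab_group_add) \<Rightarrow> bool" where
  "simplicial_cocycle T c \<longleftrightarrow> (\<forall>u v w. {u, v, w} \<in> simplices T \<longrightarrow> c u v + c v w = c u w)"

definition simplicial_coboundary :: "'v abstract_complex \<Rightarrow> ('v \<Rightarrow> 'v \<Rightarrow> 'b::ab_group_add) \<Rightarrow> bool" where
  "simplicial_coboundary T c \<longleftrightarrow> (\<exists>b. \<forall>u v. {u, v} \<in> simplices T \<longrightarrow> c u v = b v - b u)"

section \<open>Passing between simplicial and local cocycles\<close>

definition main_vertex :: "('v \<Rightarrow> real) \<Rightarrow> 'v" where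
  "main_vertex x = (SOME v. x v \<noteq> 0 \<and> (\<forall>w. x w \<le> x v))"

lemma main_vertex:
  assumes "finite_abstract_complex T" "x \<in> geom T"
  shows "x (main_vertex x) \<noteq> 0" "x w \<le> x (main_vertex x)"
proof -
  let ?s = "{v. x v \<noteq> 0}"
  have c: "x \<in> cell ?s" "finite ?s"
    using geom_support_cell[OF assms] complex_finite_simplex[OF assms(1)] by auto
  then have "sum x ?s = 1" unfolding cell_def by blast
  then have "?s \<noteq> {}" by (metis sum.empty zero_neq_one)
  then have "Max (x ` ?s) \<in> x ` ?s" using c by (intro Max_in) auto
  then obtain v where v: "v \<in> ?s" "x v = Max (x ` ?s)" by auto
  have "x w \<le> x v" for w
  proof (cases "w \<in> ?s")
    case True then show ?thesis using v c by simp
  next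
    case False
    then show ?thesis using c(1) by (simp add: cell_def)
  qed
  then have "\<exists>v. x v \<noteq> 0 \<and> (\<forall>w. x w \<le> x v)" using v by blast
  from someI_ex[OF this] show "x (main_vertex x) \<noteq> 0" "x w \<le> x (main_vertex x)"
    unfolding main_vertex_def by auto
qed

text \<open>Near \<open>p\<close> the coordinate at \<open>main_vertex p\<close> stays above half
  its value, while the finitely many coordinates outside the support of \<open>p\<close> stay below.
  This is why \<open>main_vertex\<close> picks a largest coordinate and not just a nonzero
  one.\<close>

lemma main_vertex_nearby:
  assumes T: "finite_abstract_complex T" and p: "p \<in> geom T"
  obtains U where "open U" "p \<in> U" "\<And>x. x \<in> geom T \<inter> U \<Longrightarrow> p (main_vertex x) \<noteq> 0"
proof -
  let ?s = "{v. p v \<noteq> 0}"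
  define m where "m = main_vertex p"
  have m: "p m \<noteq> 0" unfolding m_def using main_vertex[OF T p] by blast
  then have pos: "p m > 0" using p by (simp add: geom_def order_less_le)
  define U where "U = {x. x m > p m / 2} \<inter> (\<Inter>w\<in>verts T - ?s. {x. x w < p m / 2})"
  have "finite (verts T)" using T unfolding finite_abstract_complex_def by blast
  then have "open U" unfolding U_def
    by (intro open_Int open_INT ballI open_Collect_less continuous_intros) auto
  moreover have "p \<in> U" unfolding U_def using pos by auto
  moreover have "p (main_vertex x) \<noteq> 0" if x: "x \<in> geom T \<inter> U" for x
  proof
    assume *: "p (main_vertex x) = 0"
    have "main_vertex x \<in> verts T"
      using main_vertex(1)[OF T, of x] geom_support_cell(1)[OF T, of x] complex_finite_simplex[OF T] x by blast
    then have "x (main_vertex x) < p m / 2" using x * unfolding U_def by auto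
    moreover have "x m \<le> x (main_vertex x)" using main_vertex(2)[OF T] x by blast
    moreover have "x m > p m / 2" using x unfolding U_def by auto
    ultimately show False by linarith
  qed
  ultimately show ?thesis using that by blast
qed

text \<open>The main vertices of all points near \<open>p\<close> lie in the support of
  \<open>p\<close>, which is a simplex, and there the simplicial identity applies.\<close>

lemma simplicial_cocycle_local_cocycle:
  assumes T: "finite_abstract_complex T" and c: "simplicial_cocycle T c"
  shows "local_cocycle (geom T) (\<lambda>x y. c (main_vertex x) (main_vertex y))"
  unfolding local_cocycle_def
proof
  fix p assume p: "p \<in> geom T"
  obtain U where U: "open U" "p \<in> U" "\<And>x. x \<in> geom T \<inter> U \<Longrightarrow> p (main_vertex x) \<noteq> 0"
    using main_vertex_nearby[OF T p] by metis
  have "{main_vertex x, main_vertex y, main_vertex z} \<in> simplices T"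
    if "x \<in> geom T \<inter> U" "y \<in> geom T \<inter> U" "z \<in> geom T \<inter> U" for x y z
    using U(3) that by (intro complex_subset[OF T geom_support_cell(1)[OF T p]]) auto
  then show "\<exists>U. open U \<and> p \<in> U \<and> (\<forall>x\<in>geom T \<inter> U. \<forall>y\<in>geom T \<inter> U. \<forall>z\<in>geom T \<inter> U.
      c (main_vertex x) (main_vertex y) + c (main_vertex y) (main_vertex z) = c (main_vertex x) (main_vertex z))"
    using U c unfolding simplicial_cocycle_def by (intro exI[of _ U]) blast
qed

lemma main_vertex_vertex_point:
  assumes "finite_abstract_complex T" "{v} \<in> simplices T"
  shows "main_vertex (vertex_point v) = v"
proof -
  have "vertex_point v \<in> geom T"
    using vertex_point_cell[of "{v}" v] cell_subset_geom[OF assms] by auto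
  from main_vertex(1)[OF assms(1) this] show ?thesis
    unfolding vertex_point_def by (auto split: if_splits)
qed

text \<open>On the edge from \<open>u\<close> to \<open>v\<close> the function
  \<open>c u (main_vertex x)\<close> is a second potential, so it has the same increment between the
  endpoints as \<open>g\<close>. The values of \<open>g\<close> at the vertices therefore serve as
  the 0-cochain.\<close>

lemma coboundary_if_potential:
  assumes T: "finite_abstract_complex T" and c: "simplicial_cocycle T c"
    and g: "potential_on (geom T) (\<lambda>x y. c (main_vertex x) (main_vertex y)) g"
  shows "simplicial_coboundary T c"
  unfolding simplicial_coboundary_def
proof (intro exI allI impI)
  fix u v assume e: "{u, v} \<in> simplices T"
  let ?h = "\<lambda>x. c u (main_vertex x)"
  have sub: "cell {u, v} \<subseteq> geom T" by (rule cell_subset_geom[OF T e])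
  have "c (main_vertex x) (main_vertex y) = ?h y - ?h x" if "x \<in> cell {u, v}" "y \<in> cell {u, v}" for x y
  proof -
    have "main_vertex x \<in> {u, v}" "main_vertex y \<in> {u, v}"
      using main_vertex(1)[OF T] that sub unfolding cell_def by blast+
    then have "{u, main_vertex x, main_vertex y} \<in> simplices T"
      by (intro complex_subset[OF T e]) auto
    with c have "c u (main_vertex x) + c (main_vertex x) (main_vertex y) = c u (main_vertex y)"
      unfolding simplicial_cocycle_def by blast
    then show ?thesis by (simp add: algebra_simps)
  qed
  then have h: "potential_on (cell {u, v}) (\<lambda>x y. c (main_vertex x) (main_vertex y)) ?h"
    unfolding potential_on_def by (intro ballI exI[of _ UNIV]) auto
  have pts: "vertex_point u \<in> cell {u, v}" "vertex_point v \<in> cell {u, v}"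
    by (simp_all add: vertex_point_cell)
  have "{u} \<in> simplices T" "{v} \<in> simplices T"
    using complex_subset[OF T e] by auto
  then have mv: "main_vertex (vertex_point u) = u" "main_vertex (vertex_point v) = v"
    using main_vertex_vertex_point[OF T] by auto
  \<comment> \<open>Cocycles also satisfy the identity on degenerate triples, which forces
    \<open>c u u = 0\<close>.\<close>
  have "{u, u, u} \<in> simplices T" using complex_subset[OF T e] by auto
  then have "c u u + c u u = c u u" using c unfolding simplicial_cocycle_def by blast
  then have "c u u = 0" by simp
  with potential_on_unique[OF cell_connected potential_on_subset[OF g sub] h pts] mv
  show "c u v = g (vertex_point v) - g (vertex_point u)" by simp
qed

text \<open>A local cocycle has a potential on each cell, and the increments of these potentials between
  vertices form a simplicial cocycle.\<close>

definition simplicial_trace ::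
    "'v abstract_complex \<Rightarrow> (('v \<Rightarrow> real) \<Rightarrow> ('v \<Rightarrow> real) \<Rightarrow> 'b::ab_group_add) \<Rightarrow> ('v \<Rightarrow> 'v \<Rightarrow> 'b) \<Rightarrow> bool" where
  "simplicial_trace T \<phi> d \<longleftrightarrow> (\<forall>s\<in>simplices T. \<exists>g. potential_on (cell s) \<phi> g \<and>
     (\<forall>u\<in>s. \<forall>v\<in>s. d u v = g (vertex_point v) - g (vertex_point u)))"

lemma simplicial_trace_cocycle: "simplicial_trace T \<phi> d \<Longrightarrow> simplicial_cocycle T d"
  unfolding simplicial_cocycle_def
proof (intro allI impI)
  fix u v w assume "simplicial_trace T \<phi> d" "{u, v, w} \<in> simplices T"
  then obtain g where g: "\<forall>x\<in>{u, v, w}. \<forall>y\<in>{u, v, w}. d x y = g (vertex_point y) - g (vertex_point x)"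
    unfolding simplicial_trace_def by meson
  then have "d u v = g (vertex_point v) - g (vertex_point u)" "d v w = g (vertex_point w) - g (vertex_point v)"
    "d u w = g (vertex_point w) - g (vertex_point u)" by blast+
  then show "d u v + d v w = d u w" by simp
qed

text \<open>Increments are read off from the potential on the edge \<open>{u, v}\<close>. Every
  larger simplex gives the same increment, because its potential restricts to the connected
  edge.\<close>

lemma simplicial_trace_exists:
  fixes T :: "'v::countable abstract_complex"
  assumes T: "finite_abstract_complex T" and \<phi>: "local_cocycle (geom T) \<phi>"
  shows "\<exists>d. simplicial_trace T \<phi> d"
proof -
  have ex: "\<exists>g. potential_on (cell s) \<phi> g" if "s \<in> simplices T" for s
    using cell_potential_exists local_cocycle_subset[OF \<phi> cell_subset_geom[OF T that]]
      complex_finite_simplex[OF T that] by blast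
  then obtain G where G: "\<And>s. s \<in> simplices T \<Longrightarrow> potential_on (cell s) \<phi> (G s)" by metis
  define d where "d u v = G {u, v} (vertex_point v) - G {u, v} (vertex_point u)" for u v
  have "d u v = G s (vertex_point v) - G s (vertex_point u)" if s: "s \<in> simplices T" "u \<in> s" "v \<in> s" for s u v
  proof -
    have e: "{u, v} \<in> simplices T" using complex_subset[OF T s(1)] s by auto
    have "cell {u, v} \<subseteq> cell s" by (rule cell_mono) (use complex_finite_simplex[OF T s(1)] s in auto)
    then have "potential_on (cell {u, v}) \<phi> (G s)" using G[OF s(1)] potential_on_subset by blast
    from potential_on_unique[OF cell_connected G[OF e] this] show ?thesis
      unfolding d_def by (simp add: vertex_point_cell)
  qed
  then show ?thesis unfolding simplicial_trace_def using G by blast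
qed

lemma simplicial_trace_lincomb:
  fixes \<phi> \<psi> :: "_ \<Rightarrow> _ \<Rightarrow> 'b::comm_ring_1"
  assumes "simplicial_trace T \<phi> d" "simplicial_trace T \<psi> e"
  shows "simplicial_trace T (\<lambda>x y. a * \<phi> x y + b * \<psi> x y) (\<lambda>u v. a * d u v + b * e u v)"
  unfolding simplicial_trace_def
proof
  fix s assume s: "s \<in> simplices T"
  obtain g where g: "potential_on (cell s) \<phi> g"
      "\<forall>u\<in>s. \<forall>v\<in>s. d u v = g (vertex_point v) - g (vertex_point u)"
    using assms(1) s unfolding simplicial_trace_def by meson
  obtain h where h: "potential_on (cell s) \<psi> h"
      "\<forall>u\<in>s. \<forall>v\<in>s. e u v = h (vertex_point v) - h (vertex_point u)"
    using assms(2) s unfolding simplicial_trace_def by meson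
  let ?k = "\<lambda>x. a * g x + b * h x"
  have "potential_on (cell s) (\<lambda>x y. a * \<phi> x y + b * \<psi> x y) ?k"
    unfolding potential_on_def
  proof
    fix p assume p: "p \<in> cell s"
    obtain U where U: "open U" "p \<in> U" "\<And>x y. x \<in> cell s \<inter> U \<Longrightarrow> y \<in> cell s \<inter> U \<Longrightarrow> \<phi> x y = g y - g x"
      using potential_onE[OF g(1) p] by metis
    obtain V where V: "open V" "p \<in> V" "\<And>x y. x \<in> cell s \<inter> V \<Longrightarrow> y \<in> cell s \<inter> V \<Longrightarrow> \<psi> x y = h y - h x"
      using potential_onE[OF h(1) p] by metis
    have "a * \<phi> x y + b * \<psi> x y = ?k y - ?k x" if "x \<in> cell s \<inter> (U \<inter> V)" "y \<in> cell s \<inter> (U \<inter> V)" for x y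
    proof -
      have "\<phi> x y = g y - g x" "\<psi> x y = h y - h x" using that U(3) V(3) by blast+
      then show ?thesis by (simp only:) (simp add: algebra_simps)
    qed
    with U(1,2) V(1,2) show "\<exists>W. open W \<and> p \<in> W \<and> (\<forall>x\<in>cell s \<inter> W. \<forall>y\<in>cell s \<inter> W.
        a * \<phi> x y + b * \<psi> x y = ?k y - ?k x)"
      by (intro exI[of _ "U \<inter> V"]) blast
  qed
  moreover have "\<forall>u\<in>s. \<forall>v\<in>s. a * d u v + b * e u v = ?k (vertex_point v) - ?k (vertex_point u)"
  proof (intro ballI)
    fix u v assume "u \<in> s" "v \<in> s"
    then have "d u v = g (vertex_point v) - g (vertex_point u)" "e u v = h (vertex_point v) - h (vertex_point u)"
      using g(2) h(2) by blast+
    then show "a * d u v + b * e u v = ?k (vertex_point v) - ?k (vertex_point u)"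
      by (simp only:) (simp add: algebra_simps)
  qed
  ultimately show "\<exists>k. potential_on (cell s) (\<lambda>x y. a * \<phi> x y + b * \<psi> x y) k \<and>
      (\<forall>u\<in>s. \<forall>v\<in>s. a * d u v + b * e u v = k (vertex_point v) - k (vertex_point u))"
    by blast
qed

lemma support_nearby:
  assumes T: "finite_abstract_complex T" and p: "p \<in> geom T"
  obtains U where "open U" "p \<in> U" "\<And>x. x \<in> U \<Longrightarrow> {v. p v \<noteq> 0} \<subseteq> {v. x v \<noteq> 0}"
proof -
  let ?s = "{v. p v \<noteq> 0}"
  have "finite ?s" using geom_support_cell(1)[OF T p] complex_finite_simplex[OF T] by blast
  then have "open (\<Inter>v\<in>?s. {x :: _ \<Rightarrow> real. x v \<noteq> 0})"
    by (intro open_INT ballI open_Collect_neq continuous_intros) auto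
  then show ?thesis by (rule that) auto
qed

text \<open>Shifted so as to take the values \<open>b\<close> at the vertices, the potentials on the
  cells agree on common faces, by uniqueness on connected cells, and glue to one function.\<close>

lemma potential_if_coboundary:
  assumes T: "finite_abstract_complex T" and \<phi>: "local_cocycle (geom T) \<phi>"
    and d: "simplicial_trace T \<phi> d" "simplicial_coboundary T d"
  shows "\<exists>g. potential_on (geom T) \<phi> g"
proof -
  obtain b where b: "\<And>u v. {u, v} \<in> simplices T \<Longrightarrow> d u v = b v - b u"
    using d(2) unfolding simplicial_coboundary_def by blast
  have "\<exists>g. potential_on (cell s) \<phi> g \<and> (\<forall>v\<in>s. g (vertex_point v) = b v)" if s: "s \<in> simplices T" for s
  proof -
    obtain g where g: "potential_on (cell s) \<phi> g"
        "\<forall>u\<in>s. \<forall>v\<in>s. d u v = g (vertex_point v) - g (vertex_point u)"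
      using d(1) s unfolding simplicial_trace_def by meson
    show ?thesis
    proof (cases "s = {}")
      case False
      then obtain u where u: "u \<in> s" by blast
      let ?h = "\<lambda>x. g x + (b u - g (vertex_point u))"
      have "?h (vertex_point v) = b v" if v: "v \<in> s" for v
      proof -
        have "{u, v} \<in> simplices T" using complex_subset[OF T s] u v by auto
        then have "b v - b u = g (vertex_point v) - g (vertex_point u)"
          using b g(2) u v by metis
        then show ?thesis by (simp add: algebra_simps)
      qed
      then show ?thesis using potential_on_shift[OF g(1)] by blast
    qed (use g in auto)
  qed
  then obtain G where G: "\<And>s. s \<in> simplices T \<Longrightarrow> potential_on (cell s) \<phi> (G s)"
      "\<And>s v. s \<in> simplices T \<Longrightarrow> v \<in> s \<Longrightarrow> G s (vertex_point v) = b v"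
    by metis
  define g where "g x = G {v. x v \<noteq> 0} x" for x
  have gG: "g x = G s x" if s: "s \<in> simplices T" and x: "x \<in> cell s" for s x
  proof -
    let ?t = "{v. x v \<noteq> 0}"
    have xg: "x \<in> geom T" using cell_subset_geom[OF T s] x by blast
    have t: "?t \<in> simplices T" "x \<in> cell ?t" "?t \<subseteq> s"
      using geom_support_cell[OF T xg] x unfolding cell_def by auto
    have "sum x ?t = 1" using t(2) unfolding cell_def by blast
    then have "?t \<noteq> {}" by (metis sum.empty zero_neq_one)
    then obtain v where v: "v \<in> ?t" by blast
    have sub: "cell ?t \<subseteq> cell s" using cell_mono complex_finite_simplex[OF T s] t(3) by blast
    have "vertex_point v \<in> cell ?t"
      by (rule vertex_point_cell) (use v complex_finite_simplex[OF T t(1)] in auto)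
    from potential_on_unique[OF cell_connected G(1)[OF t(1)] potential_on_subset[OF G(1)[OF s] sub] this t(2)]
    have "G ?t x - b v = G s x - b v" using G(2)[OF t(1) v] G(2)[OF s, of v] v t(3) by auto
    then show ?thesis unfolding g_def by simp
  qed
  have "potential_on (geom T) \<phi> g"
    unfolding potential_on_def
  proof
    fix p assume p: "p \<in> geom T"
    obtain U where U: "open U" "p \<in> U"
        "\<And>x. x \<in> U \<Longrightarrow> {v. p v \<noteq> 0} \<subseteq> {v. x v \<noteq> 0}"
      using support_nearby[OF T p] by metis
    obtain V where V: "open V" "p \<in> V"
        "\<And>x y z. x \<in> geom T \<inter> V \<Longrightarrow> y \<in> geom T \<inter> V \<Longrightarrow> z \<in> geom T \<inter> V \<Longrightarrow> \<phi> x y + \<phi> y z = \<phi> x z"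
      using local_cocycleE[OF \<phi> p] by metis
    let ?I = "{s \<in> simplices T. p \<in> cell s}"
    have "finite (Pow (verts T))" "simplices T \<subseteq> Pow (verts T)"
      using T unfolding finite_abstract_complex_def by auto
    then have fin: "finite ?I" using finite_subset by fastforce
    have "\<forall>s\<in>?I. \<exists>W. open W \<and> p \<in> W \<and> (\<forall>x\<in>cell s \<inter> W. \<forall>y\<in>cell s \<inter> W. \<phi> x y = G s y - G s x)"
      using G(1) unfolding potential_on_def by (metis (no_types, lifting) mem_Collect_eq)
    from bchoice[OF this] obtain W where "\<forall>s\<in>?I. open (W s) \<and> p \<in> W s \<and>
        (\<forall>x\<in>cell s \<inter> W s. \<forall>y\<in>cell s \<inter> W s. \<phi> x y = G s y - G s x)" by (elim exE)
    note W = this[rule_format, THEN conjunct1] this[rule_format, THEN conjunct2, THEN conjunct1]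
      this[rule_format, THEN conjunct2, THEN conjunct2, rule_format]
    define N where "N = U \<inter> V \<inter> (\<Inter>s\<in>?I. W s)"
    have N: "open N" "p \<in> N"
      unfolding N_def using U(1,2) V(1,2) W(1,2) fin by (intro open_Int open_INT IntI INT_I; blast)+
    have *: "\<phi> x p = g p - g x" "\<phi> p x = g x - g p" if x: "x \<in> geom T \<inter> N" for x
    proof -
      let ?s = "{v. x v \<noteq> 0}"
      have s: "?s \<in> simplices T" "x \<in> cell ?s" using geom_support_cell[OF T, of x] x by auto
      have "cell {v. p v \<noteq> 0} \<subseteq> cell ?s"
        using U(3)[of x] x complex_finite_simplex[OF T s(1)] cell_mono unfolding N_def by blast
      then have ps: "p \<in> cell ?s" using geom_support_cell(2)[OF T p] by blast
      then have I: "?s \<in> ?I" using s by blast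
      have "x \<in> W ?s" using x I unfolding N_def by blast
      then have "\<phi> x p = G ?s p - G ?s x" "\<phi> p x = G ?s x - G ?s p"
        using s ps W(2)[OF I] by (intro W(3)[OF I]; blast)+
      then show "\<phi> x p = g p - g x" "\<phi> p x = g x - g p" using gG[OF s(1)] s ps by auto
    qed
    \<comment> \<open>Nearby points \<open>x\<close> and \<open>y\<close> may lie in no common cell,
      but each lies in a common cell with \<open>p\<close>, so the comparison goes through
      \<open>p\<close>.\<close>
    have "\<phi> x y = g y - g x" if x: "x \<in> geom T \<inter> N" and y: "y \<in> geom T \<inter> N" for x y
    proof -
      have "\<phi> x p + \<phi> p y = \<phi> x y" using V(2,3) x y p unfolding N_def by blast
      then show ?thesis using *[OF x] *[OF y] by simp
    qed
    with N show "\<exists>U. open U \<and> p \<in> U \<and> (\<forall>x\<in>geom T \<inter> U. \<forall>y\<in>geom T \<inter> U. \<phi> x y = g y - g x)"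
      by (intro exI[of _ N] conjI ballI)
  qed
  then show ?thesis by blast
qed

section \<open>Homeomorphism invariance of first cohomology\<close>

lemma homeomorphic_space_top_of_set: "top_of_set S homeomorphic_space top_of_set T \<longleftrightarrow> S homeomorphic T"
proof
  assume "top_of_set S homeomorphic_space top_of_set T"
  then obtain f g where fg: "homeomorphic_maps (top_of_set S) (top_of_set T) f g"
    unfolding homeomorphic_space_def by blast
  then have "homeomorphism S T f g"
    unfolding homeomorphic_maps_def homeomorphism_def by (auto simp: image_iff Pi_iff) metis+
  then show "S homeomorphic T" unfolding homeomorphic_def by blast
next
  assume "S homeomorphic T"
  then obtain f g where "homeomorphism S T f g" unfolding homeomorphic_def by blast
  then have "homeomorphic_maps (top_of_set S) (top_of_set T) f g"
    unfolding homeomorphic_maps_def homeomorphism_def by auto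
  then show "top_of_set S homeomorphic_space top_of_set T"
    unfolding homeomorphic_space_def by blast
qed

text \<open>\<open>R\<close> is the graph, on representatives, of an injective linear map between the first
  cohomology groups.\<close>

definition cohomology_embedding ::
  "'v abstract_complex \<Rightarrow> 'v abstract_complex \<Rightarrow> (('v \<Rightarrow> 'v \<Rightarrow> 'b::comm_ring_1) \<Rightarrow> ('v \<Rightarrow> 'v \<Rightarrow> 'b) \<Rightarrow> bool) \<Rightarrow> bool" where
  "cohomology_embedding T T' R \<longleftrightarrow>
     (\<forall>c. simplicial_cocycle T c \<longrightarrow> (\<exists>d. R c d)) \<and>
     (\<forall>c d. R c d \<longrightarrow> simplicial_cocycle T c \<and> simplicial_cocycle T' d) \<and>
     (\<forall>c d c' d' a b. R c d \<longrightarrow> R c' d' \<longrightarrow>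
        R (\<lambda>u v. a * c u v + b * c' u v) (\<lambda>u v. a * d u v + b * d' u v)) \<and>
     (\<forall>c d. R c d \<longrightarrow> simplicial_coboundary T' d \<longrightarrow> simplicial_coboundary T c)"

text \<open>\<open>R\<close> relates a cocycle to the traces of its pullback along \<open>F\<close>.
  If a trace is a coboundary, the pullback has a potential, and carrying this back along
  \<open>G\<close> shows that the original cocycle is a coboundary.\<close>

theorem cocycle_transport:
  fixes T T' :: "'v::countable abstract_complex"
  assumes T: "finite_abstract_complex T" "finite_abstract_complex T'"
    and hom: "realization T homeomorphic_space realization T'"
  shows "\<exists>R :: ('v \<Rightarrow> 'v \<Rightarrow> 'b::comm_ring_1) \<Rightarrow> ('v \<Rightarrow> 'v \<Rightarrow> 'b) \<Rightarrow> bool. cohomology_embedding T T' R"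
proof -
  obtain F G where FG: "homeomorphism (geom T') (geom T) F G"
    using hom unfolding realization_geom homeomorphic_space_top_of_set homeomorphic_sym[of "geom T"]
    unfolding homeomorphic_def by blast
  define \<Phi> where "\<Phi> c x y = c (main_vertex (F x)) (main_vertex (F y))" for c :: "'v \<Rightarrow> 'v \<Rightarrow> 'b" and x y
  define R where "R c d \<longleftrightarrow> simplicial_cocycle T c \<and> simplicial_trace T' (\<Phi> c) d" for c d
  have loc: "local_cocycle (geom T') (\<Phi> c)" if "simplicial_cocycle T c" for c
    unfolding \<Phi>_def using FG
    by (intro local_cocycle_pullback[OF simplicial_cocycle_local_cocycle[OF T(1) that]])
       (auto simp: homeomorphism_def)
  show ?thesis
    unfolding cohomology_embedding_def
  proof (intro exI[of _ R] conjI allI impI)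
    show "\<exists>d. R c d" if "simplicial_cocycle T c" for c
      using simplicial_trace_exists[OF T(2) loc[OF that]] that unfolding R_def by (elim exE) (rule exI, rule conjI)
    show "simplicial_cocycle T c" "simplicial_cocycle T' d" if "R c d" for c d
      using that simplicial_trace_cocycle unfolding R_def by blast+
    show "R (\<lambda>u v. a * c u v + b * c' u v) (\<lambda>u v. a * d u v + b * d' u v)"
      if "R c d" "R c' d'" for c d c' d' a b
    proof -
      have "simplicial_cocycle T (\<lambda>u v. a * c u v + b * c' u v)"
        unfolding simplicial_cocycle_def
      proof (intro allI impI)
        fix u v w assume "{u, v, w} \<in> simplices T"
        then have "c u w = c u v + c v w" "c' u w = c' u v + c' v w"
          using that unfolding R_def simplicial_cocycle_def by auto
        then show "a * c u v + b * c' u v + (a * c v w + b * c' v w) = a * c u w + b * c' u w"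
          by (simp add: algebra_simps)
      qed
      moreover have "simplicial_trace T' (\<Phi> (\<lambda>u v. a * c u v + b * c' u v)) (\<lambda>u v. a * d u v + b * d' u v)"
        using simplicial_trace_lincomb[of T' "\<Phi> c" d "\<Phi> c'" d' a b] that unfolding R_def \<Phi>_def by simp
      ultimately show ?thesis unfolding R_def by blast
    qed
    show "simplicial_coboundary T c" if cd: "R c d" "simplicial_coboundary T' d" for c d
    proof -
      have c: "simplicial_cocycle T c" using cd unfolding R_def by blast
      obtain g where "potential_on (geom T') (\<Phi> c) g"
        using potential_if_coboundary[OF T(2) loc[OF c]] cd unfolding R_def by metis
      then have "potential_on (geom T) (\<lambda>x y. \<Phi> c (G x) (G y)) (\<lambda>x. g (G x))"
        by (rule potential_on_pullback) (use FG in \<open>auto simp: homeomorphism_def\<close>)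
      then have "potential_on (geom T) (\<lambda>x y. c (main_vertex x) (main_vertex y)) (\<lambda>x. g (G x))"
        using FG unfolding potential_on_def \<Phi>_def homeomorphism_def by simp
      then show ?thesis by (rule coboundary_if_potential[OF T(1) c])
    qed
  qed
qed

section \<open>Triangulations of surfaces\<close>

lemma two_manifold_chart:
  assumes "two_manifold (top_of_set S)" "x \<in> S"
  obtains U W h k where "openin (top_of_set S) U" "x \<in> U" "open (W :: (real \<times> real) set)"
    "homeomorphism U W h k"
proof -
  have "\<forall>x\<in>topspace (top_of_set S). \<exists>U W. openin (top_of_set S) U \<and> x \<in> U \<and> open (W :: (real \<times> real) set) \<and>
        subtopology (top_of_set S) U homeomorphic_space top_of_set W"
    using assms(1) unfolding two_manifold_def by blast
  moreover have "x \<in> topspace (top_of_set S)" using assms(2) by simp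
  ultimately obtain U W where UW: "openin (top_of_set S) U" "x \<in> U" "open (W :: (real \<times> real) set)"
      "subtopology (top_of_set S) U homeomorphic_space top_of_set W"
    by meson
  have "U \<subseteq> S" using openin_imp_subset[OF UW(1)] .
  then have "U homeomorphic W"
    using UW(4) by (simp add: subtopology_subtopology inf.absorb2 homeomorphic_space_top_of_set)
  then obtain h k where "homeomorphism U W h k" unfolding homeomorphic_def by blast
  then show ?thesis using that UW by blast
qed

text \<open>Invariance of domain, applied in a chart at each image point. It serves to show that an
  embedded planar patch leaves no room for further cells at its points.\<close>

lemma two_manifold_injective_image_open:
  assumes S: "two_manifold (top_of_set S)" and j: "continuous_on B j" "inj_on j B" "open (B :: (real \<times> real)
      set)" "j ` B \<subseteq> S"
  shows "openin (top_of_set S) (j ` B)"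
proof (subst openin_subopen, intro ballI)
  fix y assume "y \<in> j ` B"
  then obtain b where b: "b \<in> B" "y = j b" by blast
  then obtain U W h k where U: "openin (top_of_set S) U" "y \<in> U" "open (W :: (real \<times> real) set)"
    "homeomorphism U W h k"
    using two_manifold_chart[OF S, of y] j(4) by blast
  let ?B = "B \<inter> j -` U"
  obtain O' where O': "open O'" "U = S \<inter> O'" using U(1) by (auto simp: openin_open)
  have "openin (top_of_set B) (B \<inter> j -` O')"
    using continuous_openin_preimage_gen[OF j(1) O'(1)] .
  moreover have "B \<inter> j -` O' = ?B" using O' j(4) by auto
  ultimately have oB: "open ?B" using j(3) by (simp add: openin_open_eq)
  have sub: "j ` ?B \<subseteq> U" by auto
  have "continuous_on ?B (h \<circ> j)"
    using j(1) U(4) sub by (intro continuous_on_compose)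
      (auto simp: homeomorphism_def intro: continuous_on_subset)
  moreover have "inj_on (h \<circ> j) ?B"
  proof (rule comp_inj_on)
    show "inj_on j ?B" using j(2) by (rule inj_on_subset) auto
    show "inj_on h (j ` ?B)"
      using U(4) sub unfolding homeomorphism_def by (intro inj_on_inverseI[of _ k]) auto
  qed
  ultimately have "open ((h \<circ> j) ` ?B)" using oB by (intro invariance_of_domain)
  moreover have "(h \<circ> j) ` ?B \<subseteq> W" using U(4) sub unfolding homeomorphism_def by auto
  ultimately have "openin (top_of_set W) ((h \<circ> j) ` ?B)" using U(3) openin_open_eq by blast
  then have "openin (top_of_set U) (k ` ((h \<circ> j) ` ?B))"
    using homeomorphism_imp_open_map[OF U(4)[THEN homeomorphism_symD]] by blast
  moreover have "k ` ((h \<circ> j) ` ?B) = j ` ?B"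
    unfolding image_image using U(4) sub by (intro image_cong) (auto simp: homeomorphism_def)
  ultimately have "openin (top_of_set S) (j ` ?B)" using U(1) openin_trans by fastforce
  then show "\<exists>V. openin (top_of_set S) V \<and> y \<in> V \<and> V \<subseteq> j ` B"
    using b U(2) by (intro exI[of _ "j ` ?B"]) auto
qed

text \<open>Again invariance of domain, now for a planar map out of the surface. It excludes pieces
  of a surface whose coordinates would fill only a line or a half-plane with its boundary.\<close>

lemma two_manifold_coordinates_open:
  assumes S: "two_manifold (top_of_set S)" and N: "openin (top_of_set S) N"
    and g: "continuous_on N (g :: _ \<Rightarrow> real \<times> real)" "inj_on g N"
  shows "open (g ` N)"
proof (subst open_subopen, intro ballI)
  fix y assume "y \<in> g ` N"
  then obtain x where x: "x \<in> N" "y = g x" by blast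
  then have "x \<in> S" using openin_imp_subset[OF N] by blast
  then obtain U W h k where U: "openin (top_of_set S) U" "x \<in> U" "open (W :: (real \<times> real) set)"
    "homeomorphism U W h k"
    using two_manifold_chart[OF S, of x] by blast
  have "openin (top_of_set U) (N \<inter> U)"
    using N U(1) openin_imp_subset[OF U(1)] by (metis inf_le2 openin_Int openin_subset_trans)
  then have "openin (top_of_set W) (h ` (N \<inter> U))"
    using homeomorphism_imp_open_map[OF U(4)] by blast
  then have o: "open (h ` (N \<inter> U))" using U(3) openin_open_eq by blast
  have kh: "k (h z) = z" if "z \<in> U" for z using U(4) that by (simp add: homeomorphism_def)
  have "continuous_on (h ` (N \<inter> U)) (g \<circ> k)"
  proof (rule continuous_on_compose)
    show "continuous_on (h ` (N \<inter> U)) k"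
      using U(4) by (auto simp: homeomorphism_def intro: continuous_on_subset)
    have "k ` h ` (N \<inter> U) = N \<inter> U" using kh by (force simp: image_image)
    then show "continuous_on (k ` h ` (N \<inter> U)) g" using g(1) by (auto intro: continuous_on_subset)
  qed
  moreover have "inj_on (g \<circ> k) (h ` (N \<inter> U))"
    using g(2) kh by (auto simp: inj_on_def)
  ultimately have "open ((g \<circ> k) ` h ` (N \<inter> U))" using o by (intro invariance_of_domain)
  moreover have "(g \<circ> k) ` h ` (N \<inter> U) = g ` (N \<inter> U)" using kh by (force simp: image_image)
  ultimately show "\<exists>V. open V \<and> y \<in> V \<and> V \<subseteq> g ` N"
    using x U(2) by (intro exI[of _ "g ` (N \<inter> U)"]) auto
qed

lemma connected_openin_cover:
  assumes "connected S" "openin (top_of_set S) A" "openin (top_of_set S) B" "S \<subseteq> A \<union> B" "A \<inter> B = {}"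
  shows "A = {} \<or> B = {}"
  using assms unfolding connected_openin by auto

text \<open>A punctured disc is connected, so near \<open>x\<close> only one of the two disjoint
  open sets can occur.\<close>

lemma two_manifold_punctured_nbhd_connected:
  assumes S: "two_manifold (top_of_set S)" and AB: "openin (top_of_set S) A" "openin (top_of_set S) B"
    "A \<inter> B = {}" and N: "openin (top_of_set S) N" "x \<in> N" "N - {x} \<subseteq> A \<union> B"
  obtains V where "openin (top_of_set S) V" "x \<in> V" "V \<subseteq> N" "V - {x} \<subseteq> A \<or> V - {x} \<subseteq> B"
proof -
  have "x \<in> S" using openin_imp_subset[OF N(1)] N(2) by blast
  then obtain U W h k where U: "openin (top_of_set S) U" "x \<in> U" "open (W :: (real \<times> real) set)"
    "homeomorphism U W h k"
    using two_manifold_chart[OF S, of x] by blast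
  have "openin (top_of_set U) (N \<inter> U)"
    using N U(1) openin_imp_subset[OF U(1)] by (metis inf_le2 openin_Int openin_subset_trans)
  then have "openin (top_of_set W) (h ` (N \<inter> U))"
    using homeomorphism_imp_open_map[OF U(4)] by blast
  then have "open (h ` (N \<inter> U))" using U(3) openin_open_eq by blast
  moreover have "h x \<in> h ` (N \<inter> U)" using N(2) U(2) by blast
  ultimately obtain r where r: "r > 0" "ball (h x) r \<subseteq> h ` (N \<inter> U)"
    using open_contains_ball by metis
  let ?D = "ball (h x) r" and ?V = "k ` ball (h x) r"
  have kh: "k (h z) = z" if "z \<in> U" for z using U(4) that by (simp add: homeomorphism_def)
  have hk: "h (k z) = z" if "z \<in> W" for z using U(4) that by (simp add: homeomorphism_def)
  have DW: "?D \<subseteq> W" using r(2) U(4) unfolding homeomorphism_def by auto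
  have VN: "?V \<subseteq> N" using r(2) kh by force
  have "openin (top_of_set U) ?V"
    using homeomorphism_imp_open_map[OF U(4)[THEN homeomorphism_symD], of ?D] DW U(3)
    by (simp add: openin_open_eq)
  then have oV: "openin (top_of_set S) ?V" using U(1) openin_trans by blast
  have "connected (?D - {h x})" by (rule connected_punctured_ball) simp
  then have conn: "connected (k ` (?D - {h x}))"
    using U(4) DW by (intro connected_continuous_image) (auto simp: homeomorphism_def intro: continuous_on_subset)
  have eq: "k ` (?D - {h x}) = ?V - {x}"
    using kh[OF U(2)] hk DW by (auto simp: image_iff)
  have sub: "?V - {x} \<subseteq> A \<union> B" using VN N(3) by blast
  have "?V - {x} \<subseteq> S" using oV openin_imp_subset by blast
  then have AB': "openin (top_of_set (?V - {x})) (A \<inter> (?V - {x}))" "openin (top_of_set (?V - {x})) (B \<inter> (?V - {x}))"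
    using AB by (auto simp: openin_open)
  have "A \<inter> (?V - {x}) = {} \<or> B \<inter> (?V - {x}) = {}"
    by (rule connected_openin_cover[OF conn[unfolded eq] AB']) (use sub AB(3) in auto)
  then have "?V - {x} \<subseteq> A \<or> ?V - {x} \<subseteq> B" using sub by blast
  moreover have "x \<in> ?V" using r(1) kh[OF U(2)] by (metis centre_in_ball image_eqI)
  ultimately show ?thesis using that oV VN by blast
qed

lemma openin_contains_path_start:
  fixes \<gamma> :: "real \<Rightarrow> 'a::topological_space"
  assumes "openin (top_of_set S) V" "\<gamma> 0 \<in> V" "continuous_on UNIV \<gamma>" "\<And>t. 0 < t \<Longrightarrow> t < e \<Longrightarrow> \<gamma> t \<in> S" "e > 0"
  obtains t where "0 < t" "t < e" "\<gamma> t \<in> V"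
proof -
  obtain Q where Q: "open Q" "V = S \<inter> Q" using assms(1) by (auto simp: openin_open)
  have "open (\<gamma> -` Q)" using assms(3) Q(1) open_vimage by blast
  moreover have "0 \<in> \<gamma> -` Q" using assms(2) Q by auto
  ultimately obtain d where d: "d > 0" "ball 0 d \<subseteq> \<gamma> -` Q" using open_contains_ball by blast
  let ?t = "min d e / 2"
  have "?t \<in> ball 0 d" using d(1) assms(5) by (auto simp: dist_real_def)
  then have "\<gamma> ?t \<in> Q" using d(2) by blast
  then show ?thesis using that[of ?t] assms(4)[of ?t] d(1) assms(5) Q(2) by auto
qed

section \<open>Combinatorial structure of a triangulated surface\<close>

lemma open_positive: "openin (top_of_set (geom T)) {x \<in> geom T. 0 < x v}"
proof -
  have "{x \<in> geom T. 0 < x v} = geom T \<inter> {x. 0 < x v}" by auto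
  then show ?thesis
    by (auto intro!: openin_open_Int open_Collect_less continuous_intros)
qed

lemma open_positive_some: "openin (top_of_set (geom T)) {x \<in> geom T. \<exists>v\<in>P. 0 < x v}"
proof -
  have "{x \<in> geom T. \<exists>v\<in>P. 0 < x v} = (\<Union>v\<in>P. {x \<in> geom T. 0 < x v})" by auto
  moreover have "openin (top_of_set (geom T)) (\<Union>v\<in>P. {x \<in> geom T. 0 < x v})"
    using open_positive by (intro openin_Union) auto
  ultimately show ?thesis by simp
qed

lemma open_positive_all:
  assumes "finite P"
  shows "openin (top_of_set (geom T)) {x \<in> geom T. \<forall>v\<in>P. 0 < x v}"
proof -
  have "{x \<in> geom T. \<forall>v\<in>P. 0 < x v} = geom T \<inter> (\<Inter>v\<in>P. {x. 0 < x v})" by auto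
  then show ?thesis using assms
    by (auto intro!: openin_open_Int open_INT open_Collect_less continuous_intros)
qed

lemma support_simplex:
  assumes T: "finite_abstract_complex T" "x \<in> geom T" and "\<And>v. v \<in> s \<Longrightarrow> 0 < x v"
  shows "s \<in> simplices T"
  by (rule complex_subset[OF T(1) geom_support_cell(1)[OF T]]) (use assms(3) in fastforce)

lemma continuous_on_const_If [continuous_intros]:
  "(P \<Longrightarrow> continuous_on S f) \<Longrightarrow> (\<not> P \<Longrightarrow> continuous_on S g) \<Longrightarrow> continuous_on S (\<lambda>x. if P then f x else g x)"
  by (cases P) auto

text \<open>A planar slice through the barycentre of a tetrahedron would be open in the surface, yet
  a path transversal to the slice leaves it at once.\<close>

lemma surface_simplex_card:
  assumes T: "finite_abstract_complex T" and M: "two_manifold (realization T)" and s: "s \<in> simplices T"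
  shows "card s \<le> 3"
proof (rule ccontr)
  assume "\<not> card s \<le> 3"
  then have "4 \<le> card s" by simp
  then obtain s' where s': "s' \<subseteq> s" "card s' = 4" by (meson obtain_subset_with_card_n)
  then obtain a b c d where abcd: "s' = {a, b, c, d}" and dist:
    "a \<noteq> b" "a \<noteq> c" "a \<noteq> d" "b \<noteq> c" "b \<noteq> d" "c \<noteq> d"
    by (auto simp: card_Suc_eq numeral_eq_Suc)
  have sub: "cell {a, b, c, d} \<subseteq> geom T"
    using cell_subset_geom[OF T complex_subset[OF T s]] s' abcd by blast
  \<comment> \<open>Coordinates around the barycentre: \<open>r = 0\<close> is the slice and
    \<open>r\<close> the transversal direction. Bounds of 1/12 keep the coordinate at
    \<open>a\<close> positive.\<close>
  define x where "x p q r v = (if v = a then 1/4 - p - q - r else if v = b then 1/4 + p else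
      if v = c then 1/4 + q else if v = d then 1/4 + r else 0)" for p q r :: real and v
  have cell: "x p q r \<in> geom T" if "\<bar>p\<bar> < 1/12" "\<bar>q\<bar> < 1/12" "\<bar>r\<bar> < 1/12" for p q r
  proof -
    have "\<bar>p + q + r\<bar> < 1/4" using that by linarith
    then have "x p q r \<in> cell {a, b, c, d}" using that dist unfolding cell_def x_def by auto
    then show ?thesis using sub by blast
  qed
  let ?B = "{-1/12<..<1/12} \<times> {-1/12<..<1/12} :: (real \<times> real) set"
  let ?j = "\<lambda>z. x (fst z) (snd z) 0"
  have "openin (top_of_set (geom T)) (?j ` ?B)"
  proof (rule two_manifold_injective_image_open[OF M[unfolded realization_geom]])
    show "continuous_on ?B ?j" unfolding x_def by (intro continuous_intros)
    show "inj_on ?j ?B"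
    proof (rule inj_onI)
      fix y z assume "?j y = ?j z"
      then have "?j y b = ?j z b" "?j y c = ?j z c" by simp_all
      then show "y = z" using dist unfolding x_def by (simp add: prod_eq_iff)
    qed
    show "open ?B" by (intro open_Times) auto
    show "?j ` ?B \<subseteq> geom T" by (auto intro!: cell simp: abs_less_iff)
  qed
  moreover have "x 0 0 0 \<in> ?j ` ?B" by (rule image_eqI[of _ _ "(0, 0)"]) auto
  moreover have "continuous_on UNIV (x 0 0)" unfolding x_def by (intro continuous_intros)
  ultimately obtain t where t: "0 < t" "t < 1/12" "x 0 0 t \<in> ?j ` ?B"
    using openin_contains_path_start[of "geom T" "?j ` ?B" "x 0 0" "1/12"] cell by auto
  then obtain z where "x 0 0 t = ?j z" by blast
  then have "x 0 0 t d = ?j z d" by simp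
  then show False using t(1) dist unfolding x_def by simp
qed

text \<open>If a maximal simplex were a vertex (\<open>u = v\<close> below) or an edge, all points
  positive on it would be supported exactly there and be determined by the coordinate at
  \<open>u\<close>. They would form an open piece of the surface with planar coordinates on a
  line.\<close>

lemma surface_simplex_in_face:
  assumes T: "finite_abstract_complex T" and M: "two_manifold (realization T)" and s: "s \<in> simplices T" "s \<noteq> {}"
  obtains f where "f \<in> faces T" "s \<subseteq> f"
proof -
  have "finite (simplices T)"
    using T unfolding finite_abstract_complex_def by (meson finite_Pow_iff finite_subset)
  then obtain m where m: "m \<in> simplices T" "s \<subseteq> m" "\<And>t. t \<in> simplices T \<Longrightarrow> m \<subseteq> t \<Longrightarrow> t = m"
    using finite_has_maximal2[OF _ s(1)] by metis
  have fin: "finite m" using complex_finite_simplex[OF T m(1)] by blast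
  have "card m = 3"
  proof (rule ccontr)
    assume "card m \<noteq> 3"
    moreover have "card m \<noteq> 0" using fin m(2) s(2) by auto
    ultimately have "card m = 1 \<or> card m = 2" using surface_simplex_card[OF T M m(1)] by linarith
    then obtain u v where uv: "m = {u, v}" by (metis card_1_singletonE card_2_iff insert_absorb2)
    let ?N = "{x \<in> geom T. \<forall>w\<in>m. 0 < x w}" and ?g = "\<lambda>x :: _ \<Rightarrow> real. (x u, 0 :: real)"
    have supp: "{w. x w \<noteq> 0} = m" if "x \<in> ?N" for x
    proof (rule m(3))
      show "{w. x w \<noteq> 0} \<in> simplices T" using that geom_support_cell[OF T] by blast
      show "m \<subseteq> {w. x w \<noteq> 0}" using that by auto
    qed
    have "inj_on ?g ?N"
    proof (rule inj_onI)
      fix x y assume xy: "x \<in> ?N" "y \<in> ?N" "?g x = ?g y"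
      have "x \<in> cell m" "y \<in> cell m" using geom_support_cell(2)[OF T] xy supp by (metis (mono_tags, lifting)
          mem_Collect_eq)+
      then have "sum x m = 1" "sum y m = 1" unfolding cell_def by auto
      then have "x v = y v" using xy(3) uv by (cases "u = v") auto
      moreover have "x w = 0" "y w = 0" if "w \<notin> m" for w using supp xy that by auto
      ultimately show "x = y" using xy(3) uv by (intro ext) (metis Pair_inject insertE singletonD)
    qed
    moreover have "continuous_on ?N ?g" by (intro continuous_intros)
    ultimately have "open (?g ` ?N)"
      using two_manifold_coordinates_open[OF M[unfolded realization_geom] open_positive_all[OF fin]] by blast
    moreover obtain x where x: "x \<in> ?N"
    proof
      show "(\<lambda>w. if w \<in> m then 1 / real (card m) else 0) \<in> ?N"
      proof -
        let ?x = "\<lambda>w. if w \<in> m then 1 / real (card m) else 0"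
        have "card m > 0" using \<open>card m \<noteq> 0\<close> by simp
        moreover have "?x \<in> cell m" using fin \<open>card m \<noteq> 0\<close> by (auto simp: cell_def)
        ultimately show ?thesis using cell_subset_geom[OF T m(1)] by auto
      qed
    qed
    ultimately obtain e where e: "e > 0" "ball (?g x) e \<subseteq> ?g ` ?N"
      using open_contains_ball by blast
    have "(x u, e/2) \<in> ball (?g x) e" using e(1) by (simp add: dist_Pair_Pair)
    then show False using e by auto
  qed
  then show ?thesis using that m unfolding faces_def by blast
qed

text \<open>By invariance of domain, two faces at an edge contain a neighbourhood of its midpoint, which
  leaves no room for a third, whereas a single face does not.\<close>

lemma surface_edge_two_faces:
  assumes T: "finite_abstract_complex T" and M: "two_manifold (realization T)" and e: "{u, v} \<in> simplices T" "u \<noteq> v"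
  obtains w1 w2 where "w1 \<noteq> w2" "\<And>w. {u, v, w} \<in> faces T \<longleftrightarrow> w = w1 \<or> w = w2"
proof -
  obtain f where f: "f \<in> faces T" "{u, v} \<subseteq> f" using surface_simplex_in_face[OF T M e(1)] by blast
  then have "card f = 3" unfolding faces_def by blast
  then have fin: "finite f" using card.infinite by fastforce
  have "card (f - {u, v}) = 1" using \<open>card f = 3\<close> f(2) e(2) fin by (simp add: card_Diff_subset)
  then obtain w1 where w1: "f - {u, v} = {w1}" by (meson card_1_singletonE)
  then have fw1: "f = {u, v, w1}" "w1 \<noteq> u" "w1 \<noteq> v" using f(2) by auto
  have face_dist: "w \<noteq> u \<and> w \<noteq> v" if "{u, v, w} \<in> faces T" for w
    using that e(2) unfolding faces_def by (auto simp: insert_commute)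
  let ?N = "{x \<in> geom T. \<forall>w\<in>{u, v}. 0 < x w}"
  have ex2: "\<exists>w2. w2 \<noteq> w1 \<and> {u, v, w2} \<in> faces T"
  proof (rule ccontr)
    assume no: "\<not> ?thesis"
    \<comment> \<open>With a single face at the edge these would be coordinates near its midpoint,
      but \<open>0 \<le> x w1\<close> confines them to a half-plane with the image of the midpoint
      on its boundary.\<close>
    let ?g = "\<lambda>x :: _ \<Rightarrow> real. (x u - x v, x w1)"
    have supp: "x w = 0" if x: "x \<in> ?N" "w \<notin> {u, v, w1}" for x w
    proof (rule ccontr)
      assume "x w \<noteq> 0"
      then have "0 < x w" using x unfolding geom_def by (simp add: order_less_le)
      then have "{u, v, w} \<in> simplices T" using x by (intro support_simplex[OF T, of x]) auto
      then have "{u, v, w} \<in> faces T" using x(2) e(2) unfolding faces_def by auto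
      then show False using no x(2) by auto
    qed
    have "inj_on ?g ?N"
    proof (rule inj_onI)
      fix x y assume xy: "x \<in> ?N" "y \<in> ?N" "?g x = ?g y"
      have sum1: "z u + z v + z w1 = 1" if z: "z \<in> ?N" for z
      proof -
        have "sum z (verts T) = sum z {u, v, w1}"
        proof (rule sum.mono_neutral_right)
          show "finite (verts T)" using T unfolding finite_abstract_complex_def by blast
          show "{u, v, w1} \<subseteq> verts T" using f(1) fw1 complex_finite_simplex[OF T] unfolding faces_def by auto
        qed (use supp[OF z] in auto)
        moreover have "sum z (verts T) = 1" using z unfolding geom_def by auto
        ultimately show ?thesis using e(2) fw1 by (auto simp: add.assoc)
      qed
      from xy(3) sum1[OF xy(1)] sum1[OF xy(2)] have "x u = y u" "x v = y v" "x w1 = y w1" by auto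
      moreover have "x w = 0" "y w = 0" if "w \<notin> {u, v, w1}" for w using supp xy that by auto
      ultimately show "x = y" by (intro ext) (metis insertE singletonD)
    qed
    moreover have "continuous_on ?N ?g" by (intro continuous_intros)
    ultimately have "open (?g ` ?N)"
      using two_manifold_coordinates_open[OF M[unfolded realization_geom] open_positive_all[of "{u, v}" T]] by blast
    moreover have "(0, 0) \<in> ?g ` ?N"
    proof (rule image_eqI)
      let ?m = "\<lambda>w. if w = u \<or> w = v then 1/2 else 0 :: real"
      show "(0, 0) = ?g ?m" using fw1 by auto
      have "?m \<in> cell {u, v}" using e(2) by (auto simp: cell_def)
      then show "?m \<in> ?N" using cell_subset_geom[OF T e(1)] by auto
    qed
    ultimately obtain d where d: "d > 0" "ball (0, 0) d \<subseteq> ?g ` ?N"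
      unfolding open_contains_ball by meson
    have "(0, - d/2) \<in> ball (0, 0) d" using d(1) by (simp add: dist_Pair_Pair)
    then have "(0, - d/2) \<in> ?g ` ?N" using d(2) by (rule rev_subsetD)
    then obtain x where "x \<in> ?N" "(0, - d/2) = ?g x" by blast
    then have "x \<in> geom T" "x w1 = - d/2" by auto
    then show False using d(1) by (auto simp: geom_def dest!: spec[of _ w1])
  qed
  then obtain w2 where w2: "w2 \<noteq> w1" "{u, v, w2} \<in> faces T" by blast
  have "w = w1 \<or> w = w2" if w: "{u, v, w} \<in> faces T" for w
  proof (rule ccontr)
    assume w3: "\<not> ?thesis"
    have d: "w \<noteq> u" "w \<noteq> v" "w2 \<noteq> u" "w2 \<noteq> v" using face_dist w w2 by auto
    note dist = e(2) fw1(2,3) w2(1) d w3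
    \<comment> \<open>\<open>p\<close> slides along the edge, while \<open>q\<close>,
      \<open>r\<close> and \<open>s\<close> lead into the three faces and draw equally on
      \<open>u\<close> and \<open>v\<close>. Bounds of 1/4 keep the coordinates at \<open>u\<close>
      and \<open>v\<close> positive.\<close>
    define x where "x p q r s a = (if a = u then 1/2 + p - (q + r + s)/2 else if a = v then 1/2 - p - (q + r + s)/2 else
      if a = w1 then q else if a = w2 then r else if a = w then s else 0)" for p q r s :: real and a
    have c1: "x p q 0 0 \<in> geom T" if "\<bar>p\<bar> < 1/4" "0 \<le> q" "q < 1/4" for p q
    proof -
      have "x p q 0 0 \<in> cell {u, v, w1}" using that dist unfolding cell_def x_def by (auto simp: field_simps)
      then show ?thesis using cell_subset_geom[OF T, of "{u, v, w1}"] f(1) fw1 unfolding faces_def by auto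
    qed
    have c2: "x p 0 q 0 \<in> geom T" if "\<bar>p\<bar> < 1/4" "0 \<le> q" "q < 1/4" for p q
    proof -
      have "x p 0 q 0 \<in> cell {u, v, w2}" using that dist unfolding cell_def x_def by (auto simp: field_simps)
      then show ?thesis using cell_subset_geom[OF T, of "{u, v, w2}"] w2 unfolding faces_def by auto
    qed
    have c3: "x p 0 0 q \<in> geom T" if "\<bar>p\<bar> < 1/4" "0 \<le> q" "q < 1/4" for p q
    proof -
      have "x p 0 0 q \<in> cell {u, v, w}" using that dist unfolding cell_def x_def by (auto simp: field_simps)
      then show ?thesis using cell_subset_geom[OF T, of "{u, v, w}"] w unfolding faces_def by auto
    qed
    let ?B = "{-1/4<..<1/4} \<times> {-1/4<..<1/4} :: (real \<times> real) set"
    \<comment> \<open>The sign of the second coordinate selects the face: two half-squares joined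
      along the edge. A path into the third face starts at the centre of this square and leaves it
      at once.\<close>
    let ?j = "\<lambda>z. x (fst z) (max 0 (snd z)) (max 0 (- snd z)) 0"
    have "openin (top_of_set (geom T)) (?j ` ?B)"
    proof (rule two_manifold_injective_image_open[OF M[unfolded realization_geom]])
      show "continuous_on ?B ?j" unfolding x_def by (intro continuous_intros) auto
      show "inj_on ?j ?B"
      proof (rule inj_onI)
        fix y z assume "?j y = ?j z"
        then have "?j y w1 = ?j z w1" "?j y w2 = ?j z w2" "?j y u = ?j z u" by simp_all
        then have *: "max 0 (snd y) = max 0 (snd z)" "max 0 (- snd y) = max 0 (- snd z)"
          "1/2 + fst y - (max 0 (snd y) + max 0 (- snd y) + 0)/2 = 1/2 + fst z - (max 0 (snd z) + max 0 (- snd z) + 0)/2"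
          using dist unfolding x_def by simp_all
        then have "snd y = snd z" by linarith
        moreover have "fst y = fst z" using * by simp
        ultimately show "y = z" by (simp add: prod_eq_iff)
      qed
      show "open ?B" by (intro open_Times) auto
      show "?j ` ?B \<subseteq> geom T"
      proof
        fix y assume "y \<in> ?j ` ?B"
        then obtain p q where pq: "y = ?j (p, q)" "\<bar>p\<bar> < 1/4" "\<bar>q\<bar> < 1/4" by (auto simp: abs_less_iff)
        show "y \<in> geom T"
          using c1[of p q] c2[of p "- q"] pq by (cases "0 \<le> q") (auto simp: max_def)
      qed
    qed
    moreover have "x 0 0 0 0 \<in> ?j ` ?B" by (rule image_eqI[of _ _ "(0, 0)"]) auto
    moreover have "continuous_on UNIV (x 0 0 0)" unfolding x_def by (intro continuous_intros) auto
    ultimately obtain t where t: "0 < t" "t < 1/4" "x 0 0 0 t \<in> ?j ` ?B"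
      using openin_contains_path_start[of "geom T" "?j ` ?B" "x 0 0 0" "1/4"] c3 by auto
    then obtain z where "x 0 0 0 t = ?j z" by blast
    then have "x 0 0 0 t w = ?j z w" by simp
    then show False using t(1) dist unfolding x_def by simp
  qed
  moreover have "{u, v, w1} \<in> faces T" using f fw1 by simp
  ultimately show ?thesis using that[of w1 w2] w2 by blast
qed

text \<open>If no face joined \<open>P\<close> to \<open>Q\<close>, the star of \<open>v\<close>
  without \<open>v\<close> would split into two disjoint open sets, and both would come arbitrarily
  near \<open>v\<close>. A punctured neighbourhood in a surface does not allow this.\<close>

lemma surface_link_connected:
  assumes T: "finite_abstract_complex T" and M: "two_manifold (realization T)" and v: "v \<in> verts T"
    and PQ: "P \<union> Q = {w. w \<noteq> v \<and> {v, w} \<in> simplices T}" "P \<inter> Q = {}" "P \<noteq> {}" "Q \<noteq> {}"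
  shows "\<exists>p\<in>P. \<exists>q\<in>Q. {v, p, q} \<in> faces T"
proof (rule ccontr)
  assume "\<not> ?thesis"
  then have no: "{v, p, q} \<notin> faces T" if "p \<in> P" "q \<in> Q" for p q using that by blast
  have notv: "p \<noteq> v" if "p \<in> P \<union> Q" for p using that PQ(1) by blast
  let ?N = "{x \<in> geom T. 0 < x v}"
  let ?A = "{x \<in> geom T. \<exists>p\<in>P. 0 < x p} \<inter> ?N" and ?B = "{x \<in> geom T. \<exists>p\<in>Q. 0 < x p} \<inter> ?N"
  have AB: "?A \<inter> ?B = {}"
  proof (rule equals0I)
    fix x assume x: "x \<in> ?A \<inter> ?B"
    then obtain p q where pq: "p \<in> P" "q \<in> Q" "0 < x p" "0 < x q" by blast
    have "{v, p, q} \<in> simplices T" using x pq by (intro support_simplex[OF T, of x]) auto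
    moreover have "v \<noteq> p" "v \<noteq> q" "p \<noteq> q" using notv pq PQ(2) by blast+
    then have "card {v, p, q} = 3" by simp
    ultimately show False using no[OF pq(1,2)] unfolding faces_def by blast
  qed
  have sv: "{v} \<in> simplices T" using T v unfolding finite_abstract_complex_def by blast
  have cover: "?N - {vertex_point v} \<subseteq> ?A \<union> ?B"
  proof
    fix x assume x: "x \<in> ?N - {vertex_point v}"
    have "\<exists>w. w \<noteq> v \<and> x w \<noteq> 0"
    proof (rule ccontr)
      assume "\<not> ?thesis"
      then have "{w. x w \<noteq> 0} = {v}" using x by auto
      then have "x \<in> cell {v}" using geom_support_cell(2)[OF T, of x] x by auto
      then have "x = vertex_point v" unfolding cell_def vertex_point_def by (intro ext) auto
      then show False using x by blast
    qed
    then obtain w where w: "w \<noteq> v" "0 < x w" using x unfolding geom_def by (auto simp: order_less_le)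
    have "{v, w} \<in> simplices T" using x w by (intro support_simplex[OF T, of x]) auto
    then have "w \<in> P \<union> Q" using PQ(1) w by blast
    then show "x \<in> ?A \<union> ?B" using x w by blast
  qed
  have vN: "vertex_point v \<in> ?N"
    using vertex_point_cell[of "{v}" v] cell_subset_geom[OF T sv] by (auto simp: vertex_point_def)
  obtain V where V: "openin (top_of_set (geom T)) V" "vertex_point v \<in> V" "V \<subseteq> ?N"
      "V - {vertex_point v} \<subseteq> ?A \<or> V - {vertex_point v} \<subseteq> ?B"
    by (rule two_manifold_punctured_nbhd_connected[OF M[unfolded realization_geom]
          openin_Int[OF open_positive_some open_positive] openin_Int[OF open_positive_some open_positive]
          AB open_positive vN cover])
  \<comment> \<open>Start along the edge from \<open>v\<close> to \<open>q\<close>: however small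
    \<open>V\<close> is, it contains interior points of that edge.\<close>
  have path: "\<exists>x. x \<in> V - {vertex_point v} \<and> {w. x w \<noteq> 0} = {v, q}" if q: "q \<in> P \<union> Q" for q
  proof -
    have e: "{v, q} \<in> simplices T" "q \<noteq> v" using q PQ(1) by auto
    define x where "x t w = (if w = v then 1 - t else if w = q then t else 0)" for t :: real and w
    have "x t \<in> geom T" if "0 < t" "t < 1" for t
    proof -
      have "x t \<in> cell {v, q}" using that e(2) unfolding x_def cell_def by auto
      then show ?thesis using cell_subset_geom[OF T e(1)] by blast
    qed
    moreover have "x 0 = vertex_point v" unfolding x_def vertex_point_def by auto
    moreover have "continuous_on UNIV x" unfolding x_def by (intro continuous_intros)
    ultimately obtain t where t: "0 < t" "t < 1" "x t \<in> V"
      using openin_contains_path_start[OF V(1), of x 1] V(2) by auto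
    then have "x t v \<noteq> vertex_point v v" unfolding x_def vertex_point_def by auto
    then have "x t \<noteq> vertex_point v" by metis
    moreover have "{w. x t w \<noteq> 0} = {v, q}" using t e(2) unfolding x_def by auto
    ultimately show ?thesis using t(3) by blast
  qed
  obtain p q where pq: "p \<in> P" "q \<in> Q" using PQ by blast
  obtain x where x: "x \<in> V - {vertex_point v}" "{w. x w \<noteq> 0} = {v, p}" using path pq by blast
  obtain y where y: "y \<in> V - {vertex_point v}" "{w. y w \<noteq> 0} = {v, q}" using path pq by blast
  have "x \<notin> ?B"
  proof
    assume "x \<in> ?B"
    then obtain q' where "q' \<in> Q" "0 < x q'" by blast
    then have "q' \<in> {w. x w \<noteq> 0}" by simp
    then have "q' \<in> {v, p}" unfolding x(2) .
    then show False using \<open>q' \<in> Q\<close> notv pq PQ(2) by auto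
  qed
  moreover have "y \<notin> ?A"
  proof
    assume "y \<in> ?A"
    then obtain p' where "p' \<in> P" "0 < y p'" by blast
    then have "p' \<in> {w. y w \<noteq> 0}" by simp
    then have "p' \<in> {v, q}" unfolding y(2) .
    then show False using \<open>p' \<in> P\<close> notv pq PQ(2) by auto
  qed
  ultimately show False using V(4) x(1) y(1) by blast
qed

lemma connected_complex:
  assumes T: "finite_abstract_complex T" and C: "connected_space (realization T)"
    and PQ: "P \<union> Q = verts T" "P \<inter> Q = {}" "P \<noteq> {}" "Q \<noteq> {}"
  shows "\<exists>p\<in>P. \<exists>q\<in>Q. {p, q} \<in> simplices T"
proof (rule ccontr)
  assume "\<not> ?thesis"
  then have no: "{p, q} \<notin> simplices T" if "p \<in> P" "q \<in> Q" for p q using that by blast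
  let ?A = "{x \<in> geom T. \<exists>p\<in>P. 0 < x p}" and ?B = "{x \<in> geom T. \<exists>p\<in>Q. 0 < x p}"
  have AB: "?A \<inter> ?B = {}"
  proof (rule equals0I)
    fix x assume x: "x \<in> ?A \<inter> ?B"
    then obtain p q where pq: "p \<in> P" "q \<in> Q" "0 < x p" "0 < x q" by blast
    have "{p, q} \<in> simplices T" using x pq by (intro support_simplex[OF T, of x]) auto
    then show False using no pq by blast
  qed
  have cover: "geom T \<subseteq> ?A \<union> ?B"
  proof
    fix x assume x: "x \<in> geom T"
    have "\<exists>w\<in>verts T. x w \<noteq> 0"
    proof (rule ccontr)
      assume "\<not> ?thesis"
      then have "sum x (verts T) = 0" by simp
      then show False using x unfolding geom_def by auto
    qed
    then show "x \<in> ?A \<union> ?B" using x PQ(1) unfolding geom_def by (auto simp: order_less_le)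
  qed
  have ne: "\<exists>x\<in>geom T. 0 < x p" if "p \<in> verts T" for p
  proof -
    have "{p} \<in> simplices T" using T that unfolding finite_abstract_complex_def by blast
    then show ?thesis using vertex_point_cell[of "{p}" p] cell_subset_geom[OF T, of "{p}"]
      by (intro bexI[of _ "vertex_point p"]) (auto simp: vertex_point_def)
  qed
  have "?A \<noteq> {}" "?B \<noteq> {}" using ne PQ by blast+
  moreover have "connectedin euclidean (geom T)"
    using C unfolding realization_geom connectedin_def by simp
  then have "connected (geom T)" by simp
  ultimately show False
    using connected_openin_cover[OF _ open_positive_some open_positive_some cover AB] by blast
qed

section \<open>A lower bound on the number of vertices\<close>

text \<open>All that the counting and the seven-vertex analysis take from topology. Both kinds of
  connectedness are phrased through partitions, to be applied to a set of vertices that is closed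
  under adjacency and its complement.\<close>

locale surface_complex =
  fixes T :: "'v abstract_complex"
  assumes complex: "finite_abstract_complex T"
    and nonempty: "verts T \<noteq> {}"
    and pure: "s \<in> simplices T \<Longrightarrow> s \<noteq> {} \<Longrightarrow> \<exists>f\<in>faces T. s \<subseteq> f"
    and two_faces: "{u, v} \<in> simplices T \<Longrightarrow> u \<noteq> v \<Longrightarrow>
      \<exists>w1 w2. w1 \<noteq> w2 \<and> (\<forall>w. {u, v, w} \<in> faces T \<longleftrightarrow> w = w1 \<or> w = w2)"
    and link_connected: "v \<in> verts T \<Longrightarrow> P \<union> Q = {w. w \<noteq> v \<and> {v, w} \<in> simplices T} \<Longrightarrow>
      P \<inter> Q = {} \<Longrightarrow> P \<noteq> {} \<Longrightarrow> Q \<noteq> {} \<Longrightarrow> \<exists>p\<in>P. \<exists>q\<in>Q. {v, p, q} \<in> faces T"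
    and connected: "P \<union> Q = verts T \<Longrightarrow> P \<inter> Q = {} \<Longrightarrow> P \<noteq> {} \<Longrightarrow> Q \<noteq> {} \<Longrightarrow>
      \<exists>p\<in>P. \<exists>q\<in>Q. {p, q} \<in> simplices T"
begin

definition edges :: "'v set set" where "edges = {e \<in> simplices T. card e = 2}"

lemma finite_verts: "finite (verts T)" and simplices_verts: "s \<in> simplices T \<Longrightarrow> s \<subseteq> verts T"
  and subset_simplex: "s \<in> simplices T \<Longrightarrow> t \<subseteq> s \<Longrightarrow> t \<in> simplices T"
  using complex unfolding finite_abstract_complex_def by auto

lemma finite_simplices: "finite (simplices T)"
  using finite_verts simplices_verts by (meson Pow_iff finite_Pow_iff finite_subset subsetI)

lemma finite_faces: "finite (faces T)" and finite_edges: "finite edges"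
  using finite_simplices unfolding faces_def edges_def by auto

lemma face_simplex: "f \<in> faces T \<Longrightarrow> f \<in> simplices T" "f \<in> faces T \<Longrightarrow> card f = 3"
  unfolding faces_def by auto

lemma face_elements:
  assumes "f \<in> faces T" "u \<in> f" "v \<in> f" "u \<noteq> v"
  obtains w where "f = {u, v, w}" "w \<noteq> u" "w \<noteq> v"
proof -
  have f: "card f = 3" using assms face_simplex by blast
  then have "finite f" using card.infinite by fastforce
  then have "card (f - {u, v}) = 1" using assms f by (simp add: card_Diff_subset)
  then obtain w where "f - {u, v} = {w}" by (meson card_1_singletonE)
  then have "f = {u, v, w}" "w \<noteq> u" "w \<noteq> v" using assms by auto
  then show ?thesis using that by blast
qed

lemma edge_in_two_faces:
  assumes "e \<in> edges" shows "card {f \<in> faces T. e \<subseteq> f} = 2"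
proof -
  obtain u v where e: "e = {u, v}" "u \<noteq> v" using assms unfolding edges_def by (auto simp: card_2_iff)
  then obtain w1 w2 where w: "w1 \<noteq> w2" "\<And>w. {u, v, w} \<in> faces T \<longleftrightarrow> w = w1 \<or> w = w2"
    using two_faces[of u v] assms unfolding edges_def by auto
  have d: "w1 \<notin> {u, v}" "w2 \<notin> {u, v}"
    using w(2)[of w1] w(2)[of w2] e(2) face_simplex(2)[of "{u, v, w1}"] face_simplex(2)[of "{u, v, w2}"]
    by (auto simp: insert_commute)
  have w': "{u, v, w1} \<in> faces T" "{u, v, w2} \<in> faces T" using w(2) by blast+
  have "{f \<in> faces T. e \<subseteq> f} = {{u, v, w1}, {u, v, w2}}"
  proof
    show "{f \<in> faces T. e \<subseteq> f} \<subseteq> {{u, v, w1}, {u, v, w2}}"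
    proof
      fix f assume "f \<in> {f \<in> faces T. e \<subseteq> f}"
      then have f: "f \<in> faces T" "u \<in> f" "v \<in> f" using e(1) by auto
      obtain x where x: "f = {u, v, x}" by (rule face_elements[OF f e(2)])
      then have "x = w1 \<or> x = w2" using f(1) w(2)[of x] by simp
      then show "f \<in> {{u, v, w1}, {u, v, w2}}" using x by blast
    qed
    show "{{u, v, w1}, {u, v, w2}} \<subseteq> {f \<in> faces T. e \<subseteq> f}" using w' unfolding e(1) by blast
  qed
  moreover have "{u, v, w1} \<noteq> {u, v, w2}" using d w(1) by blast
  ultimately show ?thesis by simp
qed

text \<open>Any two faces are joined by a chain of faces with common edges: connected links allow
  moving around a vertex, and connectedness of the complex allows moving from one vertex to the
  next.\<close>

lemma adjacent_closed_all:
  assumes R: "R \<subseteq> faces T" "R \<noteq> {}" "\<And>s t. s \<in> R \<Longrightarrow> t \<in> faces T \<Longrightarrow> card (s \<inter> t) = 2 \<Longrightarrow> t \<in> R"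
  shows "R = faces T"
proof -
  have adj: "t \<in> R" if s: "s \<in> R" "u \<in> s" "v \<in> s" and t: "t \<in> faces T" "u \<in> t" "v \<in> t" and uv: "u \<noteq> v" for s t u v
  proof (cases "s = t")
    case False
    obtain a where a: "s = {u, v, a}" "a \<noteq> u" "a \<noteq> v" using face_elements[of s u v] s uv R(1) by blast
    obtain b where b: "t = {u, v, b}" "b \<noteq> u" "b \<noteq> v" using face_elements[of t u v] t uv by blast
    have "s \<inter> t = {u, v}" using a b False by auto
    then show ?thesis using R(3)[OF s(1) t(1)] uv by simp
  qed (use s in simp)
  have star: "t \<in> R" if v: "s \<in> R" "v \<in> s" and t: "t \<in> faces T" "v \<in> t" for s t v
  proof -
    let ?L = "{w. w \<noteq> v \<and> {v, w} \<in> simplices T}"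
    define P where "P = {w. w \<noteq> v \<and> (\<exists>r\<in>R. v \<in> r \<and> w \<in> r)}"
    have PL: "P \<subseteq> ?L"
    proof
      fix w assume "w \<in> P"
      then obtain r where "w \<noteq> v" "r \<in> R" "v \<in> r" "w \<in> r" unfolding P_def by blast
      then show "w \<in> ?L" using subset_simplex[of r "{v, w}"] R(1) face_simplex(1) by blast
    qed
    have vT: "v \<in> verts T" using simplices_verts face_simplex(1) t by blast
    have "card s = 3" using v R(1) face_simplex by blast
    then have "\<exists>w\<in>s. w \<noteq> v"
      by (metis card_1_singleton_iff is_singletonI is_singletonI' is_singleton_altdef numeral_eq_one_iff
          semiring_norm(86) v(2) empty_iff)
    then have "P \<noteq> {}" unfolding P_def using v by blast
    have "?L - P = {}"
    proof (rule ccontr)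
      assume "?L - P \<noteq> {}"
      then obtain p q where pq: "p \<in> P" "q \<in> ?L - P" "{v, p, q} \<in> faces T"
        using link_connected[OF vT, of P "?L - P"] PL \<open>P \<noteq> {}\<close> by blast
      then obtain r where "r \<in> R" "v \<in> r" "p \<in> r" "p \<noteq> v" unfolding P_def by blast
      then have "{v, p, q} \<in> R" using adj[of r v p "{v, p, q}"] pq(3) by blast
      then have "q \<in> P" unfolding P_def using pq(2) by blast
      then show False using pq(2) by blast
    qed
    moreover have "card t = 3" using t face_simplex by blast
    then obtain w where w: "w \<in> t" "w \<noteq> v"
      by (metis card_1_singleton_iff is_singletonI is_singletonI' is_singleton_altdef numeral_eq_one_iff
          semiring_norm(86) t(2) empty_iff)
    ultimately have "w \<in> P" using subset_simplex[of t "{v, w}"] t face_simplex(1)[of t] by blast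
    then show "t \<in> R" unfolding P_def using adj[of _ v w t] w t by blast
  qed
  have "verts T - \<Union>R = {}"
  proof (rule ccontr)
    assume "verts T - \<Union>R \<noteq> {}"
    moreover have "\<Union>R \<subseteq> verts T" using R(1) face_simplex(1) simplices_verts by blast
    moreover have "\<Union>R \<noteq> {}"
    proof -
      obtain r where "r \<in> R" using R(2) by blast
      then have "card r = 3" using R(1) face_simplex(2) by blast
      then have "r \<noteq> {}" by auto
      then show ?thesis using \<open>r \<in> R\<close> by blast
    qed
    ultimately obtain p q where pq: "p \<in> \<Union>R" "q \<in> verts T - \<Union>R" "{p, q} \<in> simplices T"
      using connected[of "\<Union>R" "verts T - \<Union>R"] by blast
    then obtain f where "f \<in> faces T" "{p, q} \<subseteq> f" using pure by blast
    then have "f \<in> R" using star pq(1) by blast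
    then show False using pq(2) \<open>{p, q} \<subseteq> f\<close> by blast
  qed
  have "t \<in> R" if t: "t \<in> faces T" for t
  proof -
    have "t \<noteq> {}" using face_simplex(2)[OF t] by auto
    then obtain v where "v \<in> t" by blast
    moreover have "v \<in> \<Union>R" using \<open>v \<in> t\<close> \<open>verts T - \<Union>R = {}\<close> simplices_verts face_simplex(1)[OF t] by blast
    ultimately show ?thesis using star t by blast
  qed
  then show ?thesis using R(1) by blast
qed

section \<open>Double counting and the coboundary operator modulo 2\<close>

lemma face_edges:
  assumes "{u, v, w} \<in> faces T" "u \<noteq> v" "u \<noteq> w" "v \<noteq> w"
  shows "{e \<in> edges. e \<subseteq> {u, v, w}} = {{u, v}, {v, w}, {u, w}}"
proof
  show "{e \<in> edges. e \<subseteq> {u, v, w}} \<subseteq> {{u, v}, {v, w}, {u, w}}"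
  proof
    fix e assume "e \<in> {e \<in> edges. e \<subseteq> {u, v, w}}"
    then obtain a b where "e = {a, b}" "a \<noteq> b" "a \<in> {u, v, w}" "b \<in> {u, v, w}"
      unfolding edges_def by (auto simp: card_2_iff)
    then show "e \<in> {{u, v}, {v, w}, {u, w}}" by auto
  qed
  show "{{u, v}, {v, w}, {u, w}} \<subseteq> {e \<in> edges. e \<subseteq> {u, v, w}}"
    using assms subset_simplex[OF face_simplex(1)[OF assms(1)]] unfolding edges_def by auto
qed

lemma double_count: "3 * card (faces T) = 2 * card edges"
proof -
  have "(\<Sum>f\<in>faces T. card {e \<in> edges. e \<subseteq> f}) = 2 * card edges"
    using edge_in_two_faces by (intro sum_multicount finite_faces finite_edges) blast
  moreover have "card {e \<in> edges. e \<subseteq> f} = 3" if f: "f \<in> faces T" for f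
  proof -
    obtain u v w where "f = {u, v, w}" "u \<noteq> v" "u \<noteq> w" "v \<noteq> w"
      using face_simplex(2)[OF f] by (auto simp: card_3_iff)
    then show ?thesis using face_edges f by (simp add: doubleton_eq_iff)
  qed
  ultimately show ?thesis by simp
qed

text \<open>Sets of edges are cochains modulo 2, and \<open>odd_faces\<close> is the coboundary operator on them.
  Its image contains all pairs of faces, so its rank is at least the number of faces minus one.\<close>

definition odd_faces :: "'v set set \<Rightarrow> 'v set set" where
  "odd_faces C = {f \<in> faces T. odd (card {e \<in> C. e \<subseteq> f})}"

lemma odd_card_sym_diff:
  assumes "finite A" "finite B"
  shows "odd (card (sym_diff A B)) \<longleftrightarrow> odd (card A) \<noteq> odd (card B)"
proof -
  have "card (sym_diff A B) = card (A - B) + card (B - A)"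
    using assms by (intro card_Un_disjoint) auto
  moreover have "card A = card (A - B) + card (A \<inter> B)" "card B = card (B - A) + card (A \<inter> B)"
    using assms by (metis Int_commute add.commute card_Int_Diff)+
  ultimately show ?thesis by auto
qed

lemma odd_faces_sym_diff:
  assumes "A \<subseteq> edges" "B \<subseteq> edges"
  shows "odd_faces (sym_diff A B) = sym_diff (odd_faces A) (odd_faces B)"
proof -
  have "odd (card {e \<in> sym_diff A B. e \<subseteq> f}) \<longleftrightarrow> odd (card {e \<in> A. e \<subseteq> f}) \<noteq> odd (card {e \<in> B. e \<subseteq> f})" for f
  proof -
    have eq: "{e \<in> sym_diff A B. e \<subseteq> f} = sym_diff {e \<in> A. e \<subseteq> f} {e \<in> B. e \<subseteq> f}" by auto
    have "finite {e \<in> A. e \<subseteq> f}" "finite {e \<in> B. e \<subseteq> f}"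
      using assms finite_edges by (auto intro: finite_subset)
    then show ?thesis unfolding eq by (rule odd_card_sym_diff)
  qed
  then show ?thesis unfolding odd_faces_def by auto
qed

lemma sym_diff_edges: "A \<subseteq> edges \<Longrightarrow> B \<subseteq> edges \<Longrightarrow> sym_diff A B \<subseteq> edges" by blast

text \<open>The common edge of the two faces lies in no third face, so its coboundary is exactly
  this pair.\<close>

lemma odd_faces_pair:
  assumes "s \<in> faces T" "t \<in> faces T" "card (s \<inter> t) = 2"
  shows "{s, t} \<in> odd_faces ` Pow edges"
proof -
  let ?e = "s \<inter> t"
  have e: "?e \<in> edges" using assms subset_simplex[OF face_simplex(1)[OF assms(1)]] unfolding edges_def by auto
  have "{f \<in> faces T. ?e \<subseteq> f} = {s, t}"
  proof (rule card_seteq[symmetric])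
    have "s \<noteq> t" using assms face_simplex by fastforce
    then show "card {f \<in> faces T. ?e \<subseteq> f} \<le> card {s, t}" using edge_in_two_faces[OF e] by simp
  qed (use assms finite_faces in auto)
  moreover have "{e \<in> {?e}. e \<subseteq> f} = (if ?e \<subseteq> f then {?e} else {})" for f by auto
  then have "odd_faces {?e} = {f \<in> faces T. ?e \<subseteq> f}" unfolding odd_faces_def by auto
  ultimately show ?thesis using e by (intro image_eqI[of _ _ "{?e}"]) auto
qed

lemma odd_faces_image_sym_diff:
  assumes "X \<in> odd_faces ` Pow edges" "Y \<in> odd_faces ` Pow edges"
  shows "sym_diff X Y \<in> odd_faces ` Pow edges"
proof -
  obtain A B where "A \<subseteq> edges" "B \<subseteq> edges" "X = odd_faces A" "Y = odd_faces B" using assms by blast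
  then show ?thesis using odd_faces_sym_diff sym_diff_edges by (intro image_eqI[of _ _ "sym_diff A B"]) auto
qed

lemma odd_faces_empty: "odd_faces {} = {}" unfolding odd_faces_def by simp

lemma card_odd_faces_image: "2 ^ (card (faces T) - 1) \<le> card (odd_faces ` Pow edges)"
proof -
  obtain v where "v \<in> verts T" using nonempty by blast
  then have "{v} \<in> simplices T" using complex unfolding finite_abstract_complex_def by blast
  then obtain t0 where t0: "t0 \<in> faces T" using pure by blast
  let ?I = "odd_faces ` Pow edges"
  have "{} \<in> ?I" using odd_faces_empty by (intro image_eqI[of _ _ "{}"]) auto
  \<comment> \<open>The faces that form a coboundary together with \<open>t0\<close>. Adding the
    pair of two adjacent faces leads from one of them to the next.\<close>
  define R where "R = {t \<in> faces T. t = t0 \<or> {t, t0} \<in> ?I}"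
  have "R = faces T"
  proof (rule adjacent_closed_all)
    fix s t assume st: "s \<in> R" "t \<in> faces T" "card (s \<inter> t) = 2"
    have I: "{s, t} \<in> ?I" by (rule odd_faces_pair) (use st in \<open>auto simp: R_def\<close>)
    have ne: "s \<noteq> t" using st face_simplex(2)[OF st(2)] by auto
    show "t \<in> R"
    proof (cases "s = t0 \<or> t = t0")
      case True
      then show ?thesis using I st(2) unfolding R_def by (auto simp: insert_commute)
    next
      case False
      then have "{s, t0} \<in> ?I" using st(1) unfolding R_def by simp
      then have "sym_diff {s, t} {s, t0} \<in> ?I" by (rule odd_faces_image_sym_diff[OF I])
      moreover have "sym_diff {s, t} {s, t0} = {t, t0}" using False ne by auto
      ultimately show ?thesis using st(2) unfolding R_def by auto
    qed
  qed (use t0 in \<open>auto simp: R_def\<close>)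
  then have pair: "{t, t0} \<in> ?I" if "t \<in> faces T" "t \<noteq> t0" for t
    using that unfolding R_def by blast
  \<comment> \<open>Up to membership of \<open>t0\<close>, every set of faces is a sum of pairs
    \<open>{t, t0}\<close>. Forgetting \<open>t0\<close> accounts for the exponent
    \<open>card (faces T) - 1\<close>.\<close>
  have surj: "\<exists>D\<in>?I. D - {t0} = S" if S: "finite S" "S \<subseteq> faces T - {t0}" for S
    using S
  proof (induction S rule: finite_induct)
    case empty
    then show ?case using \<open>{} \<in> ?I\<close> by blast
  next
    case (insert t S)
    then obtain D where D: "D \<in> ?I" "D - {t0} = S" by blast
    have t: "t \<in> faces T" "t \<noteq> t0" using insert.prems by auto
    have "sym_diff D {t, t0} - {t0} = insert t S" using D(2) insert.hyps t(2) by auto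
    then show ?case using odd_faces_image_sym_diff[OF D(1) pair[OF t]] by blast
  qed
  have "Pow (faces T - {t0}) \<subseteq> (\<lambda>D. D - {t0}) ` ?I"
  proof
    fix S assume "S \<in> Pow (faces T - {t0})"
    then obtain D where "D \<in> ?I" "D - {t0} = S"
      using surj[of S] finite_faces by (meson PowD finite_Diff finite_subset)
    then show "S \<in> (\<lambda>D. D - {t0}) ` ?I" by blast
  qed
  then have "card (Pow (faces T - {t0})) \<le> card ?I"
    using finite_edges by (meson card_image_le card_mono finite_Pow_iff finite_imageI le_trans)
  then show ?thesis using t0 finite_faces by (simp add: card_Pow)
qed

definition even_edge_sets :: "'v set set set" where
  "even_edge_sets = {C. C \<subseteq> edges \<and> odd_faces C = {}}"

text \<open>Rank and nullity by counting: the fibres of \<open>odd_faces\<close> are translates of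
  its kernel under symmetric difference, so the sizes of image and kernel multiply to
  \<open>2 ^ card edges\<close>.\<close>

lemma card_even_edge_sets: "card even_edge_sets * 2 ^ (card (faces T) - 1) \<le> 2 ^ card edges"
proof -
  let ?I = "odd_faces ` Pow edges" and ?fib = "\<lambda>D. {C \<in> Pow edges. odd_faces C = D}"
  have "card (?fib D) = card even_edge_sets" if D: "D \<in> ?I" for D
  proof -
    obtain C0 where C0: "C0 \<subseteq> edges" "D = odd_faces C0" using D by blast
    have "bij_betw (sym_diff C0) even_edge_sets (?fib D)"
    proof (rule bij_betw_byWitness[where f' = "sym_diff C0"])
      show "\<forall>C\<in>even_edge_sets. sym_diff C0 (sym_diff C0 C) = C" by auto
      show "\<forall>C\<in>?fib D. sym_diff C0 (sym_diff C0 C) = C" by auto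
      show "sym_diff C0 ` even_edge_sets \<subseteq> ?fib D"
      proof
        fix X assume "X \<in> sym_diff C0 ` even_edge_sets"
        then obtain C where C: "C \<subseteq> edges" "odd_faces C = {}" "X = sym_diff C0 C"
          unfolding even_edge_sets_def by blast
        then show "X \<in> ?fib D" using odd_faces_sym_diff[OF C0(1) C(1)] C0 sym_diff_edges[OF C0(1) C(1)] by simp
      qed
      show "sym_diff C0 ` ?fib D \<subseteq> even_edge_sets"
      proof
        fix X assume "X \<in> sym_diff C0 ` ?fib D"
        then obtain C where C: "C \<subseteq> edges" "odd_faces C = D" "X = sym_diff C0 C" by blast
        then show "X \<in> even_edge_sets"
          using odd_faces_sym_diff[OF C0(1) C(1)] C0 sym_diff_edges[OF C0(1) C(1)]
          unfolding even_edge_sets_def by simp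
      qed
    qed
    then show ?thesis by (rule bij_betw_same_card[symmetric])
  qed
  moreover have "card (Pow edges) = (\<Sum>D\<in>?I. card (?fib D))"
    using sum.image_gen[of "Pow edges" "\<lambda>_. 1 :: nat" odd_faces] finite_edges by simp
  ultimately have "2 ^ card edges = card ?I * card even_edge_sets"
    using finite_edges by (simp add: card_Pow)
  then show ?thesis using mult_le_mono1[OF card_odd_faces_image, of "card even_edge_sets"]
    by (simp add: mult.commute)
qed

section \<open>Cocycles modulo 2 as even edge sets\<close>

definition support_edges :: "('v \<Rightarrow> 'v \<Rightarrow> bit) \<Rightarrow> 'v set set" where
  "support_edges c = {e \<in> edges. \<exists>u v. e = {u, v} \<and> c u v = 1}"

text \<open>The degenerate triples \<open>u, v, u\<close> and \<open>u, u, u\<close> give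
  antisymmetry, which is symmetry in characteristic 2. A cocycle is thus recorded by a set of
  unordered edges.\<close>

lemma bit_cocycle_sym:
  fixes c :: "'v \<Rightarrow> 'v \<Rightarrow> bit"
  assumes "simplicial_cocycle T c" "{u, v} \<in> simplices T"
  shows "c u v = c v u"
proof -
  have "{u, v, u} \<in> simplices T" "{u, u, u} \<in> simplices T"
    using assms(2) subset_simplex[OF assms(2), of "{u}"] by (auto simp: insert_commute)
  then have "c u v + c v u = c u u" "c u u + c u u = c u u"
    using assms(1) unfolding simplicial_cocycle_def by blast+
  then show ?thesis by (cases "c u v"; cases "c v u"; cases "c u u") auto
qed

lemma support_edges_iff:
  assumes "simplicial_cocycle T c" "{u, v} \<in> edges"
  shows "{u, v} \<in> support_edges c \<longleftrightarrow> c u v = 1"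
  using assms bit_cocycle_sym[OF assms(1), of u v]
  unfolding support_edges_def edges_def by (auto simp: doubleton_eq_iff)

lemma support_edges_even:
  assumes c: "simplicial_cocycle T c" shows "support_edges c \<in> even_edge_sets"
proof -
  have "even (card {e \<in> support_edges c. e \<subseteq> f})" if f: "f \<in> faces T" for f
  proof -
    obtain u v w where uvw: "f = {u, v, w}" "u \<noteq> v" "u \<noteq> w" "v \<noteq> w"
      using face_simplex(2)[OF f] by (auto simp: card_3_iff)
    have e: "{u, v} \<in> edges" "{v, w} \<in> edges" "{u, w} \<in> edges"
      using face_edges[of u v w] uvw f by auto
    have "{e \<in> support_edges c. e \<subseteq> f} = {e \<in> {{u, v}, {v, w}, {u, w}}. e \<in> support_edges c}"
    proof -
      have "{e \<in> support_edges c. e \<subseteq> f} = {e \<in> {e \<in> edges. e \<subseteq> f}. e \<in> support_edges c}"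
        unfolding support_edges_def by auto
      moreover have "{e \<in> edges. e \<subseteq> f} = {{u, v}, {v, w}, {u, w}}"
        using face_edges[of u v w] uvw f by simp
      ultimately show ?thesis by (simp only:)
    qed
    also have "\<dots> = (if c u v = 1 then {{u, v}} else {}) \<union> (if c v w = 1 then {{v, w}} else {}) \<union>
        (if c u w = 1 then {{u, w}} else {})"
      using support_edges_iff[OF c] e by auto
    finally have *: "{e \<in> support_edges c. e \<subseteq> f} = \<dots>" .
    have "c u v + c v w = c u w"
      using c face_simplex(1)[OF f] uvw(1) unfolding simplicial_cocycle_def by blast
    then show ?thesis unfolding * using uvw(2-4)
      by (cases "c u v"; cases "c v w"; cases "c u w") (auto simp: doubleton_eq_iff)
  qed
  then show ?thesis unfolding even_edge_sets_def odd_faces_def support_edges_def by auto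
qed

lemma coboundary_connected:
  assumes "v0 \<in> verts T" "v \<in> verts T" "\<And>u v. {u, v} \<in> simplices T \<Longrightarrow> b u = b v"
  shows "b v = b v0"
proof (rule ccontr)
  assume "b v \<noteq> b v0"
  then obtain p q where "p \<in> {u \<in> verts T. b u = b v0}" "q \<in> {u \<in> verts T. b u \<noteq> b v0}" "{p, q} \<in> simplices T"
    using connected[of "{u \<in> verts T. b u = b v0}" "{u \<in> verts T. b u \<noteq> b v0}"] assms by blast
  then show False using assms(3) by force
qed

text \<open>Two independent classes and the coboundaries of vertex sets avoiding \<open>v0\<close> span a space of
  \<open>2 ^ (card (verts T) + 1)\<close> even edge sets.\<close>

lemma card_edges_lower_bound:
  fixes c1 c2 :: "'v \<Rightarrow> 'v \<Rightarrow> bit"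
  assumes c: "simplicial_cocycle T c1" "simplicial_cocycle T c2"
    and nt: "\<not> simplicial_coboundary T c1" "\<not> simplicial_coboundary T c2"
      "\<not> simplicial_coboundary T (\<lambda>u v. c1 u v + c2 u v)"
  shows "card (verts T) + card (faces T) \<le> card edges"
proof -
  obtain v0 where v0: "v0 \<in> verts T" using nonempty by blast
  \<comment> \<open>Complementary vertex sets have the same coboundary; keeping \<open>v0\<close>
    out of \<open>P\<close> removes this ambiguity. Two bits and the choice of \<open>P\<close>
    account for the exponent \<open>card (verts T) + 1\<close>.\<close>
  define k where "k = (\<lambda>(i, j, P) u v. of_bool i * c1 u v + of_bool j * c2 u v + (of_bool (v \<in> P) - of_bool (u \<in>
      P)) :: bit)"
  let ?D = "(UNIV :: bool set) \<times> (UNIV :: bool set) \<times> Pow (verts T - {v0})"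
  have kc: "simplicial_cocycle T (k x)" for x
    unfolding simplicial_cocycle_def
  proof (intro allI impI)
    fix u v w assume "{u, v, w} \<in> simplices T"
    then have eq: "c1 u w = c1 u v + c1 v w" "c2 u w = c2 u v + c2 v w"
      using c unfolding simplicial_cocycle_def by auto
    have lin: "i * a + j * b + (q - p) + (i * a' + j * b' + (r - q)) = i * (a + a') + j * (b + b') + (r - p)"
      for i j a b a' b' p q r :: "'a::comm_ring_1" by (simp add: algebra_simps)
    show "k x u v + k x v w = k x u w"
      unfolding k_def by (cases x) (simp only: prod.case lin eq)
  qed
  have "inj_on (\<lambda>x. support_edges (k x)) ?D"
  proof (rule inj_onI)
    fix x y assume xy: "x \<in> ?D" "y \<in> ?D" "support_edges (k x) = support_edges (k y)"
    obtain i j P i' j' P' where x: "x = (i, j, P)" and y: "y = (i', j', P')" by (metis prod.exhaust)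
    have eq: "k x u v = k y u v" if e: "{u, v} \<in> simplices T" for u v
    proof (cases "u = v")
      case True
      have "{u, u, u} \<in> simplices T" using e True by simp
      then have "k z u u + k z u u = k z u u" for z using kc unfolding simplicial_cocycle_def by blast
      then show ?thesis using True by simp
    next
      case False
      then have "{u, v} \<in> edges" using e unfolding edges_def by simp
      then have "k x u v = 1 \<longleftrightarrow> k y u v = 1" using support_edges_iff[OF kc] xy(3) by metis
      then show ?thesis by (cases "k x u v"; cases "k y u v") auto
    qed
    \<comment> \<open>Modulo 2 differences are sums, so two parameters with equal supports exhibit a
      combination of \<open>c1\<close> and \<open>c2\<close> as the coboundary of \<open>?b\<close>.
      The hypotheses then force its two coefficients to vanish.\<close>
    let ?b = "\<lambda>v. of_bool (v \<in> P) + of_bool (v \<in> P') :: bit"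
    have cob: "(of_bool i + of_bool i') * c1 u v + (of_bool j + of_bool j') * c2 u v = ?b v - ?b u"
      if "{u, v} \<in> simplices T" for u v
    proof -
      have lin: "(s + s') * a + (t + t') * b = (q + q') - (p + p')"
        if "s * a + t * b + (q - p) = s' * a + t' * b + (q' - p')" "(2 :: 'a) = 0"
        for s t s' t' a b p q p' q' :: "'a::comm_ring_1"
      proof -
        have "(s + s') * a + (t + t') * b - ((q + q') - (p + p')) =
          (s * a + t * b + (q - p)) - (s' * a + t' * b + (q' - p')) + 2 * (s' * a + t' * b - q + p)"
          by (simp add: algebra_simps)
        then show ?thesis using that by simp
      qed
      show ?thesis by (rule lin) (use eq[OF that] in \<open>simp_all only: x y k_def prod.case, simp\<close>)
    qed
    have ij: "i = i'" "j = j'"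
    proof -
      consider "i = i' \<and> j = j'" | "i = i' \<and> j \<noteq> j'" | "i \<noteq> i' \<and> j = j'" | "i \<noteq> i' \<and> j \<noteq> j'" by blast
      then have "i = i' \<and> j = j'"
      proof cases
        case 2
        then have "of_bool i + of_bool i' = (0 :: bit)" "of_bool j + of_bool j' = (1 :: bit)" by (cases i';
            cases j; simp)+
        then have "c2 u v = ?b v - ?b u" if "{u, v} \<in> simplices T" for u v
          using cob[OF that] by (simp only: mult_zero_left mult_1 add_0_left add_0_right)
        then have "simplicial_coboundary T c2" unfolding simplicial_coboundary_def by (intro exI[of _ ?b]) blast
        then show ?thesis using nt by blast
      next
        case 3
        then have "of_bool i + of_bool i' = (1 :: bit)" "of_bool j + of_bool j' = (0 :: bit)" by (cases i; cases
            j'; simp)+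
        then have "c1 u v = ?b v - ?b u" if "{u, v} \<in> simplices T" for u v
          using cob[OF that] by (simp only: mult_zero_left mult_1 add_0_left add_0_right)
        then have "simplicial_coboundary T c1" unfolding simplicial_coboundary_def by (intro exI[of _ ?b]) blast
        then show ?thesis using nt by blast
      next
        case 4
        then have "of_bool i + of_bool i' = (1 :: bit)" "of_bool j + of_bool j' = (1 :: bit)" by (cases i; cases j; simp)+
        then have "c1 u v + c2 u v = ?b v - ?b u" if "{u, v} \<in> simplices T" for u v
          using cob[OF that] by (simp only: mult_zero_left mult_1 add_0_left add_0_right)
        then have "simplicial_coboundary T (\<lambda>u v. c1 u v + c2 u v)" unfolding simplicial_coboundary_def by
            (intro exI[of _ ?b]) blast
        then show ?thesis using nt by blast
      qed
      then show "i = i'" "j = j'" by auto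
    qed
    have sub: "P \<subseteq> verts T - {v0}" "P' \<subseteq> verts T - {v0}" using xy x y by auto
    have "?b v = ?b v0" if "v \<in> verts T" for v
    proof (rule coboundary_connected[OF v0 that])
      fix u v assume "{u, v} \<in> simplices T"
      then have "?b v - ?b u = 0" using cob[of u v] ij by (cases i'; cases j'; simp)
      then show "?b u = ?b v" by (simp only: right_minus_eq)
    qed
    \<comment> \<open>Neither set contains \<open>v0\<close>, so the constant \<open>?b\<close> is
      zero and the two sets coincide.\<close>
    moreover have "?b v0 = 0" using sub by auto
    ultimately have "v \<in> P \<longleftrightarrow> v \<in> P'" if "v \<in> verts T" for v
      using that by (cases "v \<in> P"; cases "v \<in> P'") auto
    then have "P = P'" using sub by blast
    then show "x = y" using ij x y by simp
  qed
  moreover have "(\<lambda>x. support_edges (k x)) ` ?D \<subseteq> even_edge_sets" using support_edges_even[OF kc] by blast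
  moreover have "finite even_edge_sets" unfolding even_edge_sets_def using finite_edges by simp
  ultimately have "card ?D \<le> card even_edge_sets" by (meson card_inj_on_le)
  moreover have "card ?D = 4 * 2 ^ (card (verts T) - 1)"
    using v0 finite_verts by (simp add: card_cartesian_product card_Pow)
  moreover have "card (verts T) > 0" using v0 finite_verts card_gt_0_iff by blast
  then have "4 * 2 ^ (card (verts T) - 1) = (2 :: nat) ^ (card (verts T) + 1)"
    by (cases "card (verts T)") simp_all
  ultimately have "2 ^ (card (verts T) + 1) \<le> card even_edge_sets" by simp
  then have "2 ^ (card (verts T) + 1) * 2 ^ (card (faces T) - 1) \<le> (2 :: nat) ^ card edges"
    by (rule le_trans[OF mult_le_mono1 card_even_edge_sets])
  then have "2 ^ (card (verts T) + 1 + (card (faces T) - 1)) \<le> (2 :: nat) ^ card edges"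
    by (simp only: power_add)
  then have "card (verts T) + 1 + (card (faces T) - 1) \<le> card edges"
    by (rule power_le_imp_le_exp[rotated]) simp
  \<comment> \<open>Truncated subtraction does no harm: \<open>card (faces T)\<close> is at most
    \<open>1 + (card (faces T) - 1)\<close> in any case.\<close>
  then show ?thesis by linarith
qed

text \<open>With V vertices and E edges, eliminating the faces leaves 3 V \<le> E, and E is at most
  the number V (V - 1) / 2 of pairs. At V = 7 both ends equal 21.\<close>

theorem vertex_bound:
  fixes c1 c2 :: "'v \<Rightarrow> 'v \<Rightarrow> bit"
  assumes "simplicial_cocycle T c1" "simplicial_cocycle T c2"
    "\<not> simplicial_coboundary T c1" "\<not> simplicial_coboundary T c2"
    "\<not> simplicial_coboundary T (\<lambda>u v. c1 u v + c2 u v)"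
  shows "7 \<le> card (verts T)"
    and "card (verts T) = 7 \<Longrightarrow> u \<in> verts T \<Longrightarrow> v \<in> verts T \<Longrightarrow> {u, v} \<in> simplices T"
proof -
  let ?n = "card (verts T)" and ?P = "{e. e \<subseteq> verts T \<and> card e = 2}"
  have low: "3 * ?n \<le> card edges"
    using card_edges_lower_bound[OF assms] double_count by linarith
  have sub: "edges \<subseteq> ?P" unfolding edges_def using simplices_verts by blast
  have P: "card ?P = ?n choose 2" using n_subsets[OF finite_verts] by simp
  have finP: "finite ?P" using finite_verts by simp
  have "3 * ?n \<le> ?n choose 2" using low card_mono[OF finP sub] P by linarith
  then have "6 * ?n \<le> ?n * (?n - 1)" unfolding choose_two by (simp add: less_eq_div_iff_mult_less_eq)
  moreover have "?n > 0" using nonempty finite_verts card_gt_0_iff by blast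
  ultimately show "7 \<le> ?n" by (simp add: mult.commute)
  assume n: "?n = 7" and uv: "u \<in> verts T" "v \<in> verts T"
  have "card ?P \<le> card edges" using low P unfolding n by (simp add: choose_two)
  then have "edges = ?P" using card_seteq[OF finP sub] by blast
  then have "{u, v} \<in> edges" if "u \<noteq> v" using that uv by simp
  moreover have "{u} \<in> simplices T" using uv complex unfolding finite_abstract_complex_def by blast
  ultimately show "{u, v} \<in> simplices T" unfolding edges_def by (cases "u = v") auto
qed

end

section \<open>Seven vertices force the Moebius torus\<close>

context surface_complex
begin

text \<open>Turns the two faces at an edge into an equation between truth values over the remaining
  vertices, so that the seven-vertex case becomes a small Boolean system.\<close>

lemma card_third_vertices:
  assumes "{u, v} \<in> simplices T" "u \<noteq> v" "verts T = insert u (insert v S)" "u \<notin> S" "v \<notin> S"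
  shows "(\<Sum>w\<in>S. of_bool ({u, v, w} \<in> faces T)) = (2 :: nat)"
proof -
  obtain w1 w2 where w: "w1 \<noteq> w2" "\<And>w. {u, v, w} \<in> faces T \<longleftrightarrow> w = w1 \<or> w = w2"
    using two_faces[OF assms(1,2)] by blast
  have S: "w \<in> S" if "{u, v, w} \<in> faces T" for w
  proof -
    have "w \<in> verts T" using face_simplex(1)[OF that] simplices_verts by blast
    moreover have "w \<noteq> u" "w \<noteq> v" using face_simplex(2)[OF that] assms(2) by (auto simp: insert_commute)
    ultimately show ?thesis using assms(3) by blast
  qed
  have fin: "finite S" using finite_verts assms(3) by (metis finite_insert)
  have "S \<inter> {w. {u, v, w} \<in> faces T} = {w1, w2}" using S w(2) by blast
  then have "card (S \<inter> {w. {u, v, w} \<in> faces T}) = 2" using w(1) by simp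
  then show ?thesis using fin by (simp add: of_bool_def sum.If_cases)
qed

lemma complete_link_connected:
  assumes complete: "\<And>u v. u \<in> verts T \<Longrightarrow> v \<in> verts T \<Longrightarrow> {u, v} \<in> simplices T"
    and "v \<in> verts T" "P \<subseteq> verts T - {v}" "P \<noteq> {}" "q \<in> verts T - {v} - P"
  shows "\<exists>p\<in>P. \<exists>q\<in>verts T - {v} - P. {v, p, q} \<in> faces T"
proof (rule link_connected[OF assms(2)])
  have "w \<in> verts T" if "{v, w} \<in> simplices T" for w using simplices_verts[OF that] by blast
  then show "P \<union> (verts T - {v} - P) = {w. w \<noteq> v \<and> {v, w} \<in> simplices T}"
    using complete assms(2,3) by blast
qed (use assms in auto)

text \<open>The link of \<open>v\<close> would contain a closed triangle. By connectedness some
  further face at \<open>v\<close> leaves it, and then an edge from \<open>v\<close> to the triangle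
  lies in three faces.\<close>

lemma complete_no_closed_triangle:
  assumes complete: "\<And>u v. u \<in> verts T \<Longrightarrow> v \<in> verts T \<Longrightarrow> {u, v} \<in> simplices T"
    and card: "4 < card (verts T)"
    and f: "{v, p, q} \<in> faces T" "{v, q, r} \<in> faces T" "{v, p, r} \<in> faces T"
    and d: "p \<noteq> q" "q \<noteq> r" "p \<noteq> r"
  shows False
proof -
  have sub: "{v, p, q, r} \<subseteq> verts T"
    using face_simplex(1)[OF f(1)] face_simplex(1)[OF f(2)] simplices_verts by blast
  have vd: "v \<noteq> p" "v \<noteq> q" "v \<noteq> r"
    using face_simplex(2)[OF f(1)] face_simplex(2)[OF f(3)] d by (auto simp: insert_commute)
  have "card {v, p, q, r} \<le> 4" by (simp add: card_insert_if)
  then have "verts T \<noteq> {v, p, q, r}" using card by auto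
  then obtain z where z: "z \<in> verts T - {v} - {p, q, r}" using sub by blast
  have "\<exists>x\<in>{p, q, r}. \<exists>y\<in>verts T - {v} - {p, q, r}. {v, x, y} \<in> faces T"
    by (rule complete_link_connected[OF complete _ _ _ z]) (use sub vd in auto)
  then obtain x y where xy: "x \<in> {p, q, r}" "y \<notin> {p, q, r}" "{v, x, y} \<in> faces T" by blast
  have "x \<in> verts T" "v \<in> verts T" "v \<noteq> x" using xy(1) sub vd by auto
  then obtain w1 w2 where "\<And>w. {v, x, w} \<in> faces T \<longleftrightarrow> w = w1 \<or> w = w2"
    using two_faces[OF complete, of v x] by blast
  then have *: "\<And>w w' w''. {v, x, w} \<in> faces T \<Longrightarrow> {v, x, w'} \<in> faces T \<Longrightarrow> {v, x, w''} \<in> faces T \<Longrightarrow>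
      w = w' \<or> w = w'' \<or> w' = w''" by metis
  from xy(1) consider "x = p" | "x = q" | "x = r" by blast
  then show False
  proof cases
    case 1 then show ?thesis using *[of q r y] f xy d by (auto simp: insert_commute)
  next
    case 2 then show ?thesis using *[of p r y] f xy d by (auto simp: insert_commute)
  next
    case 3 then show ?thesis using *[of p q y] f xy d by (auto simp: insert_commute)
  qed
qed

text \<open>The link of \<open>z\<close> is a connected graph on six vertices, each of degree two,
  hence a hexagon. The fact \<open>closed\<close> prevents a walk along it from returning
  early.\<close>

lemma seven_vertices_hexagonal_link:
  assumes card: "card (verts T) = 7"
    and complete: "\<And>u v. u \<in> verts T \<Longrightarrow> v \<in> verts T \<Longrightarrow> {u, v} \<in> simplices T"
  obtains z a b c d e f where "verts T = {z, a, b, c, d, e, f}" "distinct [z, a, b, c, d, e, f]"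
    "{z, a, b} \<in> faces T" "{z, b, c} \<in> faces T" "{z, c, d} \<in> faces T" "{z, d, e} \<in> faces T"
    "{z, e, f} \<in> faces T" "{z, f, a} \<in> faces T"
proof -
  obtain z where z: "z \<in> verts T" using nonempty by blast
  define L where "L x y \<longleftrightarrow> {z, x, y} \<in> faces T" for x y
  have Lsym: "L x y = L y x" for x y unfolding L_def by (simp add: insert_commute)
  have LV: "x \<in> verts T - {z} \<and> y \<in> verts T - {z} \<and> x \<noteq> y" if "L x y" for x y
  proof -
    have "{z, x, y} \<in> simplices T" "card {z, x, y} = 3" using that face_simplex unfolding L_def by blast+
    then show ?thesis using simplices_verts[of "{z, x, y}"] by (auto simp: card_insert_if split: if_splits)
  qed
  have two: "\<exists>w1 w2. w1 \<noteq> w2 \<and> (\<forall>w. L x w \<longleftrightarrow> w = w1 \<or> w = w2)" if "x \<in> verts T - {z}" for x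
    unfolding L_def using two_faces[OF complete, of z x] that z by auto
  have other: "\<exists>w. w \<noteq> y \<and> (\<forall>v. L x v \<longleftrightarrow> v = y \<or> v = w)" if "L x y" for x y
    using two[of x] LV[OF that] that by metis
  have closed: False if P: "P \<subseteq> verts T - {z}" "P \<noteq> {}" "finite P" "card P < 6" "\<And>p q. p \<in> P \<Longrightarrow> L p q \<Longrightarrow> q \<in> P" for P
  proof -
    have "card (verts T - {z}) = 6" using card z finite_verts by simp
    then obtain q where "q \<in> verts T - {z} - P" using P(1,4) by (metis Diff_eq_empty_iff all_not_in_conv
        less_irrefl subset_antisym)
    from complete_link_connected[OF complete z P(1,2) this] show False
      using P(5) unfolding L_def by blast
  qed
  have "card (verts T - {z}) = 6" using card z finite_verts by simp
  then obtain a where a: "a \<in> verts T - {z}" by (metis card.empty equals0I zero_neq_numeral)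
  obtain b f where bf: "b \<noteq> f" "\<And>w. L a w \<longleftrightarrow> w = b \<or> w = f" using two[OF a] by blast
  obtain c where c: "c \<noteq> a" "\<And>w. L b w \<longleftrightarrow> w = a \<or> w = c" using other[of b a] bf Lsym by blast
  obtain d where d: "d \<noteq> b" "\<And>w. L c w \<longleftrightarrow> w = b \<or> w = d" using other[of c b] c Lsym by blast
  obtain e where e: "e \<noteq> c" "\<And>w. L d w \<longleftrightarrow> w = c \<or> w = e" using other[of d c] d Lsym by blast
  obtain g where g: "g \<noteq> d" "\<And>w. L e w \<longleftrightarrow> w = d \<or> w = g" using other[of e d] e Lsym by blast
  \<comment> \<open>The neighbour of \<open>f\<close> other than \<open>a\<close>. If the walk from
    \<open>a\<close> through \<open>b\<close> reached \<open>f\<close> too early, \<open>h\<close>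
    would be the vertex before it and the visited vertices would be closed under adjacency.\<close>
  obtain h where h: "h \<noteq> a" "\<And>w. L f w \<longleftrightarrow> w = a \<or> w = h" using other[of f a] bf Lsym by blast
  have V: "a \<in> verts T - {z}" "b \<in> verts T - {z}" "c \<in> verts T - {z}" "d \<in> verts T - {z}"
    "e \<in> verts T - {z}" "f \<in> verts T - {z}"
    using LV[of a b] LV[of b c] LV[of c d] LV[of d e] LV[of a f] bf(2) c(2) d(2) e(2) by auto
  have ne: "a \<noteq> b" "a \<noteq> f" "b \<noteq> c" "c \<noteq> d" "d \<noteq> e"
    using LV[of a b] LV[of b c] LV[of c d] LV[of d e] LV[of a f] bf(2) c(2) d(2) e(2) by auto
  have cf: "c \<noteq> f"
  proof
    assume eq: "c = f"
    have "h = b" using c(2)[of f] h(2)[of b] Lsym[of b f] ne eq by auto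
    show False
    proof (rule closed)
      show "q \<in> {a, b, f}" if "p \<in> {a, b, f}" "L p q" for p q
        using that bf(2) c(2) h(2) eq \<open>h = b\<close> by blast
    qed (use V ne in \<open>auto simp: card_insert_if\<close>)
  qed
  have da: "d \<noteq> a" using bf(2) d(2) Lsym cf ne by metis
  have df: "d \<noteq> f"
  proof
    assume eq: "d = f"
    then have "h = c" using h d Lsym c by metis
    show False
    proof (rule closed)
      show "q \<in> {a, b, c, f}" if "p \<in> {a, b, c, f}" "L p q" for p q
        using that bf(2) c(2) d(2) h(2) eq \<open>h = c\<close> by blast
    qed (use V ne in \<open>auto simp: card_insert_if\<close>)
  qed
  have ea: "e \<noteq> a" using bf(2) e(2) Lsym df d(1) by metis
  have eb: "e \<noteq> b" using c(2) e(2) Lsym da ne by metis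
  have ef: "e \<noteq> f"
  proof
    assume eq: "e = f"
    then have "h = d" using h e Lsym da by metis
    show False
    proof (rule closed)
      show "q \<in> {a, b, c, d, f}" if "p \<in> {a, b, c, d, f}" "L p q" for p q
        using that bf(2) c(2) d(2) e(2) h(2) eq \<open>h = d\<close> by blast
    qed (use V ne in \<open>auto simp: card_insert_if\<close>)
  qed
  have dist: "distinct [z, a, b, c, d, e, f]"
    using V ne cf da df ea eb ef bf(1) c(1) d(1) e(1) by auto
  have "card {z, a, b, c, d, e, f} = 7" using dist by simp
  then have VT: "{z, a, b, c, d, e, f} = verts T"
    using V z card finite_verts by (intro card_subset_eq) auto
  have "g \<in> verts T - {z}" "e \<noteq> g" using LV g by blast+
  moreover have "g \<noteq> a" "g \<noteq> b" "g \<noteq> c" using bf(2) c(2) d(2) g(2) Lsym dist by (metis distinct_length_2_or_more)+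
  ultimately have "g = f" using VT g(1) by blast
  then show ?thesis
    using that[OF VT[symmetric] dist] bf(2) c(2) d(2) e(2) g(2) Lsym unfolding L_def by metis
qed

text \<open>The cyclic form of the seven-vertex torus of Moebius: its faces are the translates
  modulo 7 of \<open>{0, 1, 3}\<close> and \<open>{0, 2, 3}\<close>.\<close>

definition moebius_labelling :: "('v \<Rightarrow> nat) \<Rightarrow> bool" where
  "moebius_labelling \<ll> \<longleftrightarrow> bij_betw \<ll> (verts T) {..<7} \<and> (\<forall>g\<in>faces T. \<exists>k<7.
     \<ll> ` g = {k, (k+1) mod 7, (k+3) mod 7} \<or> \<ll> ` g = {k, (k+2) mod 7, (k+3) mod 7})"

lemma moebius_torus_labelling:
  assumes V: "verts T = {z, a, b, c, d, e, f}" and dist: "distinct [z, a, b, c, d, e, f]"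
    and card: "card (faces T) = 14"
    and hex: "{z, a, b} \<in> faces T" "{z, b, c} \<in> faces T" "{z, c, d} \<in> faces T" "{z, d, e} \<in> faces T"
      "{z, e, f} \<in> faces T" "{z, f, a} \<in> faces T"
    and inner: "{a, b, e} \<in> faces T" "{b, c, f} \<in> faces T" "{c, d, a} \<in> faces T" "{d, e, b} \<in> faces T"
      "{e, f, c} \<in> faces T" "{f, a, d} \<in> faces T" "{a, c, e} \<in> faces T" "{b, d, f} \<in> faces T"
  shows "\<exists>\<ll>. moebius_labelling \<ll>"
proof -
  have dist': "distinct [f, e, d, c, b, a, z]" using dist by auto
  \<comment> \<open>Around \<open>z\<close> the vertices \<open>a, b, c, d, e, f\<close> receive 1,
    3, 2, 6, 4, 5, the powers of 3 modulo 7. This is the cyclic order of the link of 0 in the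
    translates of \<open>{0, 1, 3}\<close> and \<open>{0, 2, 3}\<close>.\<close>
  define p where "p k = [z, a, c, b, e, f, d] ! k" for k
  have I7: "{..<7::nat} = {0, 1, 2, 3, 4, 5, 6}" by auto
  have p: "p 0 = z" "p 1 = a" "p 2 = c" "p 3 = b" "p 4 = e" "p 5 = f" "p 6 = d" "p (Suc 0) = a"
    unfolding p_def by simp_all
  have bij: "bij_betw p {..<7} (verts T)"
    unfolding bij_betw_def inj_on_def I7 V using dist dist' p by (simp add: insert_commute)
  define N where "N = (\<lambda>k. {k, (k+1) mod 7, (k+3) mod 7}) ` {..<7::nat} \<union> (\<lambda>k. {k, (k+2) mod 7, (k+3) mod 7}) ` {..<7}"
  have N: "N = {{0,1,3},{1,2,4},{2,3,5},{3,4,6},{4,5,0},{5,6,1},{6,0,2},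
      {0,2,3},{1,3,4},{2,4,5},{3,5,6},{4,6,0},{5,0,1},{6,1,2}}"
    unfolding N_def I7 by (simp add: insert_commute numeral_2_eq_2)
  have "card N = 14"
    unfolding N by (simp add: set_eq_subset)
  moreover have NI: "s \<subseteq> {..<7}" if "s \<in> N" for s using that unfolding N I7 by auto
  moreover have "inj_on ((`) p) N"
    using bij NI unfolding bij_betw_def by (meson Pow_iff inj_on_image_Pow inj_on_subset subsetI)
  ultimately have c: "card ((`) p ` N) = 14" by (simp add: card_image)
  have "(`) p ` N \<subseteq> faces T"
    unfolding N using hex inner by (simp add: p insert_commute)
  \<comment> \<open>An inclusion between two sets of 14 elements.\<close>
  then have eq: "(`) p ` N = faces T"
    using card_seteq[OF finite_faces] c card by simp
  have "moebius_labelling (inv_into {..<7} p)"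
    unfolding moebius_labelling_def
  proof (intro conjI ballI)
    show "bij_betw (inv_into {..<7} p) (verts T) {..<7}" using bij by (rule bij_betw_inv_into)
    fix g assume "g \<in> faces T"
    then obtain s where s: "s \<in> N" "g = p ` s" using eq by blast
    have "inv_into {..<7} p ` g = s"
      using s NI[OF s(1)] bij unfolding bij_betw_def by (simp add: inv_into_image_cancel)
    then show "\<exists>k<7. inv_into {..<7} p ` g = {k, (k+1) mod 7, (k+3) mod 7} \<or>
        inv_into {..<7} p ` g = {k, (k+2) mod 7, (k+3) mod 7}"
      using s(1) unfolding N_def by blast
  qed
  then show ?thesis by blast
qed

section \<open>Determining the faces outside the star of \<open>z\<close>\<close>

lemma two_of_three: "of_bool p + of_bool q + of_bool r = (2 :: nat) \<longleftrightarrow>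
   p \<and> q \<and> \<not> r \<or> p \<and> \<not> q \<and> r \<or> \<not> p \<and> q \<and> r"
  by (cases p; cases q; cases r; simp)

lemma two_of_four: "of_bool p + of_bool q + of_bool r + of_bool s = (2 :: nat) \<longleftrightarrow>
   p \<and> q \<and> \<not> r \<and> \<not> s \<or> p \<and> \<not> q \<and> r \<and> \<not> s \<or> p \<and> \<not> q \<and> \<not> r \<and> s \<or>
   \<not> p \<and> q \<and> r \<and> \<not> s \<or> \<not> p \<and> q \<and> \<not> r \<and> s \<or> \<not> p \<and> \<not> q \<and> r \<and> s"
  by (cases p; cases q; cases r; cases s; simp)

text \<open>\<open>a1\<close> to \<open>a6\<close> say which of two possible faces lies on the outer
  side of each edge of the hexagon, \<open>i1\<close> and \<open>i2\<close> whether its two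
  inscribed triangles are faces. The first six equations belong to the short diagonals, the last
  three to the long ones.\<close>

lemma hexagon_fillings:
  assumes "of_bool (\<not> a3) + of_bool i1 + of_bool a6 = (2 :: nat)"
    "of_bool a1 + of_bool (\<not> a4) + of_bool i2 = (2 :: nat)"
    "of_bool i1 + of_bool a2 + of_bool (\<not> a5) = (2 :: nat)"
    "of_bool (\<not> a6) + of_bool i2 + of_bool a3 = (2 :: nat)"
    "of_bool (\<not> a1) + of_bool i1 + of_bool a4 = (2 :: nat)"
    "of_bool (\<not> a2) + of_bool i2 + of_bool a5 = (2 :: nat)"
    "of_bool a1 + of_bool (\<not> a3) + of_bool a4 + of_bool (\<not> a6) = (2 :: nat)"
    "of_bool (\<not> a1) + of_bool a2 + of_bool (\<not> a4) + of_bool a5 = (2 :: nat)"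
    "of_bool a6 + of_bool (\<not> a2) + of_bool a3 + of_bool (\<not> a5) = (2 :: nat)"
  shows "(\<not> a1 \<and> \<not> a2 \<and> \<not> a3 \<and> \<not> a4 \<and> \<not> a5 \<and> \<not> a6 \<and> i1 \<and> i2) \<or> (a1 \<and> a2 \<and> a3 \<and> a4 \<and> a5 \<and> a6 \<and> i1 \<and> i2)"
  using assms unfolding two_of_three two_of_four by blast

text \<open>Two ways of filling in the hexagonal link survive, and they are mirror images.\<close>

lemma seven_vertices_moebius_torus:
  assumes card: "card (verts T) = 7"
    and complete: "\<And>u v. u \<in> verts T \<Longrightarrow> v \<in> verts T \<Longrightarrow> {u, v} \<in> simplices T"
  shows "\<exists>\<ll>. moebius_labelling \<ll>"
proof -
  obtain z a b c d e f where V: "verts T = {z, a, b, c, d, e, f}" and dist: "distinct [z, a, b, c, d, e, f]"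
    and hex: "{z, a, b} \<in> faces T" "{z, b, c} \<in> faces T" "{z, c, d} \<in> faces T" "{z, d, e} \<in> faces T"
      "{z, e, f} \<in> faces T" "{z, f, a} \<in> faces T"
    by (rule seven_vertices_hexagonal_link[OF card complete])
  have "edges = {e. e \<subseteq> verts T \<and> card e = 2}"
    unfolding edges_def using simplices_verts complete by (auto simp: card_2_iff)
  then have "card edges = 21" using n_subsets[OF finite_verts, of 2] card by (simp add: choose_two)
  then have F14: "card (faces T) = 14" using double_count by simp
  have dist': "distinct [f, e, d, c, b, a, z]" using dist by auto
  have third: "of_bool ({u, v, p} \<in> faces T) + of_bool ({u, v, q} \<in> faces T) + of_bool ({u, v, r} \<in> faces T) +
      of_bool ({u, v, s} \<in> faces T) + of_bool ({u, v, t} \<in> faces T) = (2 :: nat)"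
    if "distinct [u, v, p, q, r, s, t]" "{z, a, b, c, d, e, f} = {u, v, p, q, r, s, t}" for u v p q r s t
    using card_third_vertices[of u v "{p, q, r, s, t}"] complete[of u v] that V by (simp del: sum_of_bool_eq)
  \<comment> \<open>With this third face the link of \<open>y\<close> would contain the triangle on
    \<open>z\<close>, \<open>x\<close> and \<open>w\<close>.\<close>
  have noclosed: "{x, y, w} \<notin> faces T" if "{z, x, y} \<in> faces T" "{z, y, w} \<in> faces T" "x \<noteq> w" for x y w
  proof
    assume "{x, y, w} \<in> faces T"
    moreover have "z \<noteq> x" "z \<noteq> w"
      using face_simplex(2)[OF that(1)] face_simplex(2)[OF that(2)] by (auto simp: card_insert_if split: if_splits)
    ultimately show False
      using complete_no_closed_triangle[OF complete, of y z x w] that card by (simp add: insert_commute)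
  qed
  have flat: "{a, b, c} \<notin> faces T" "{b, c, d} \<notin> faces T" "{c, d, e} \<notin> faces T" "{d, e, f} \<notin> faces T"
      "{e, f, a} \<notin> faces T" "{f, a, b} \<notin> faces T"
    using noclosed[OF hex(1,2)] noclosed[OF hex(2,3)] noclosed[OF hex(3,4)] noclosed[OF hex(4,5)]
      noclosed[OF hex(5,6)] noclosed[OF hex(6,1)] dist by auto
  have spoke: "{z, x, w} \<notin> faces T"
    if "distinct [z, x, p, q, r, s, w]" "{z, a, b, c, d, e, f} = {z, x, p, q, r, s, w}"
      "{z, x, p} \<in> faces T" "{z, x, q} \<in> faces T" for x p q r s w
    using third[OF that(1,2)] that(3,4) by auto
  have spokes: "{z, a, c} \<notin> faces T" "{z, b, d} \<notin> faces T" "{z, c, e} \<notin> faces T" "{z, d, f} \<notin> faces T" "{z, a,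
      e} \<notin> faces T" "{z, b, f} \<notin> faces T" "{z, a, d} \<notin> faces T" "{z, b, e} \<notin> faces T" "{z, c, f} \<notin> faces T"
    using spoke[of a b f d e c]
      spoke[of b c a e f d]
      spoke[of c d b a f e]
      spoke[of d e c a b f]
      spoke[of a b f c d e]
      spoke[of b c a d e f]
      spoke[of a b f c e d]
      spoke[of b c a d f e]
      spoke[of c d b a e f] dist dist' hex
    by (simp_all add: insert_commute)
  note known = hex flat spokes
  \<comment> \<open>The edge \<open>ab\<close> lies in one face with \<open>z\<close>. The facts
    \<open>flat\<close> exclude \<open>c\<close> and \<open>f\<close>, so its second face has third
    vertex \<open>d\<close> or \<open>e\<close>. The other sides of the hexagon are treated
    alike.\<close>
  have ab1: "{a, b, e} \<in> faces T \<longleftrightarrow> \<not> {a, b, d} \<in> faces T"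
    using third[of a b z c d e f] dist dist' known by (auto simp: insert_commute of_bool_def split: if_splits)
  have ab2: "{b, c, f} \<in> faces T \<longleftrightarrow> \<not> {b, c, e} \<in> faces T"
    using third[of b c z a d e f] dist dist' known by (auto simp: insert_commute of_bool_def split: if_splits)
  have ab3: "{c, d, a} \<in> faces T \<longleftrightarrow> \<not> {c, d, f} \<in> faces T"
    using third[of c d z a b e f] dist dist' known by (auto simp: insert_commute of_bool_def split: if_splits)
  have ab4: "{d, e, b} \<in> faces T \<longleftrightarrow> \<not> {d, e, a} \<in> faces T"
    using third[of d e z a b c f] dist dist' known by (auto simp: insert_commute of_bool_def split: if_splits)
  have ab5: "{e, f, c} \<in> faces T \<longleftrightarrow> \<not> {e, f, b} \<in> faces T"
    using third[of e f z a b c d] dist dist' known by (auto simp: insert_commute of_bool_def split: if_splits)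
  have ab6: "{f, a, d} \<in> faces T \<longleftrightarrow> \<not> {f, a, c} \<in> faces T"
    using third[of f a z b c d e] dist dist' known by (auto simp: insert_commute of_bool_def split: if_splits)
  note ab = ab1 ab2 ab3 ab4 ab5 ab6
  have sh1: "of_bool ({c, d, a} \<in> faces T) + of_bool ({a, c, e} \<in> faces T) + of_bool ({f, a, c} \<in> faces T) = (2 :: nat)"
    using third[of a c z b d e f] dist dist' known by (simp add: insert_commute)
  have sh2: "of_bool ({a, b, d} \<in> faces T) + of_bool ({d, e, b} \<in> faces T) + of_bool ({b, d, f} \<in> faces T) = (2 :: nat)"
    using third[of b d z a c e f] dist dist' known by (simp add: insert_commute)
  have sh3: "of_bool ({a, c, e} \<in> faces T) + of_bool ({b, c, e} \<in> faces T) + of_bool ({e, f, c} \<in> faces T) = (2 :: nat)"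
    using third[of c e z a b d f] dist dist' known by (simp add: insert_commute)
  have sh4: "of_bool ({f, a, d} \<in> faces T) + of_bool ({b, d, f} \<in> faces T) + of_bool ({c, d, f} \<in> faces T) = (2 :: nat)"
    using third[of d f z a b c e] dist dist' known by (simp add: insert_commute)
  have sh5: "of_bool ({a, b, e} \<in> faces T) + of_bool ({a, c, e} \<in> faces T) + of_bool ({d, e, a} \<in> faces T) = (2 :: nat)"
    using third[of e a z b c d f] dist dist' known by (simp add: insert_commute)
  have sh6: "of_bool ({b, c, f} \<in> faces T) + of_bool ({b, d, f} \<in> faces T) + of_bool ({e, f, b} \<in> faces T) = (2 :: nat)"
    using third[of f b z a c d e] dist dist' known by (simp add: insert_commute)
  have lo1: "of_bool ({a, b, d} \<in> faces T) + of_bool ({c, d, a} \<in> faces T) + of_bool ({d, e, a} \<in> faces T) +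
      of_bool ({f, a, d} \<in> faces T) = (2 :: nat)"
    using third[of a d z b c e f] dist dist' known by (simp add: insert_commute)
  have lo2: "of_bool ({a, b, e} \<in> faces T) + of_bool ({b, c, e} \<in> faces T) + of_bool ({d, e, b} \<in> faces T) +
      of_bool ({e, f, b} \<in> faces T) = (2 :: nat)"
    using third[of b e z a c d f] dist dist' known by (simp add: insert_commute)
  have lo3: "of_bool ({f, a, c} \<in> faces T) + of_bool ({b, c, f} \<in> faces T) + of_bool ({c, d, f} \<in> faces T) +
      of_bool ({e, f, c} \<in> faces T) = (2 :: nat)"
    using third[of c f z a b d e] dist dist' known by (simp add: insert_commute)
  have "({a, b, e} \<in> faces T \<and> {b, c, f} \<in> faces T \<and> {c, d, a} \<in> faces T \<and> {d, e, b} \<in> faces T \<and> {e, f, c} \<in>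
      faces T \<and> {f, a, d} \<in> faces T \<and> {a, c, e} \<in> faces T \<and> {b, d, f} \<in> faces T) \<or> ({a, b, d} \<in> faces T \<and> {b, c,
      e} \<in> faces T \<and> {c, d, f} \<in> faces T \<and> {d, e, a} \<in> faces T \<and> {e, f, b} \<in> faces T \<and> {f, a, c} \<in> faces T \<and> {a,
      c, e} \<in> faces T \<and> {b, d, f} \<in> faces T)"
    using hexagon_fillings[OF sh1[unfolded ab] sh2[unfolded ab] sh3[unfolded ab] sh4[unfolded ab] sh5[unfolded ab]
      sh6[unfolded ab] lo1[unfolded ab] lo2[unfolded ab] lo3[unfolded ab]]
    unfolding ab by simp
  then show ?thesis
  proof (elim disjE conjE)
    assume "{a, b, e} \<in> faces T" "{b, c, f} \<in> faces T" "{c, d, a} \<in> faces T" "{d, e, b} \<in> faces T" "{e, f, c} \<in>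
        faces T" "{f, a, d} \<in> faces T" "{a, c, e} \<in> faces T" "{b, d, f} \<in> faces T"
    then show ?thesis by (rule moebius_torus_labelling[OF V dist F14 hex])
  next
    assume *: "{a, b, d} \<in> faces T" "{b, c, e} \<in> faces T" "{c, d, f} \<in> faces T" "{d, e, a} \<in> faces T" "{e, f, b}
        \<in> faces T" "{f, a, c} \<in> faces T" "{a, c, e} \<in> faces T" "{b, d, f} \<in> faces T"
    \<comment> \<open>Reading the hexagon backwards from \<open>a\<close> turns the second filling
      into the first.\<close>
    have "verts T = {z, a, f, e, d, c, b}" "distinct [z, a, f, e, d, c, b]" using V dist by auto
    then show ?thesis
      by (rule moebius_torus_labelling[OF _ _ F14]) (use hex * in \<open>simp_all add: insert_commute\<close>)
  qed
qed

text \<open>In both kinds of faces a label step of 1 and one of 2 add up to a step of 3. Values for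
  the steps 1 and 2 can therefore be chosen freely, and each choice extends to a cocycle.\<close>

theorem seven_vertices_cocycles:
  assumes card: "card (verts T) = 7"
    and complete: "\<And>u v. u \<in> verts T \<Longrightarrow> v \<in> verts T \<Longrightarrow> {u, v} \<in> simplices T"
  shows "\<exists>c1 c2 :: 'v \<Rightarrow> 'v \<Rightarrow> int. simplicial_cocycle T c1 \<and> simplicial_cocycle T c2 \<and>
    (\<forall>m n. simplicial_coboundary T (\<lambda>u v. m * c1 u v + n * c2 u v) \<longrightarrow> m = 0 \<and> n = 0)"
proof -
  obtain \<ll> where "moebius_labelling \<ll>" using seven_vertices_moebius_torus[OF card complete] by blast
  then have bij: "bij_betw \<ll> (verts T) {..<7}" and faces: "\<And>f. f \<in> faces T \<Longrightarrow>
      \<exists>k<7. \<ll> ` f = {k, (k+1) mod 7, (k+3) mod 7} \<or> \<ll> ` f = {k, (k+2) mod 7, (k+3) mod 7}"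
    unfolding moebius_labelling_def by auto
  have I7: "{..<7::nat} = {0, 1, 2, 3, 4, 5, 6}" by auto
  \<comment> \<open>The torus is the triangular lattice modulo the kernel of the labelling: steps of 1, 2 and
    3 along labels are the three lattice directions, to which \<open>D\<close> assigns the values
    \<open>\<alpha>\<close>, \<open>\<beta>\<close> and \<open>\<alpha> + \<beta>\<close>.\<close>
  define D where "D \<alpha> \<beta> i j = [0, \<alpha>, \<beta>, \<alpha> + \<beta>, - (\<alpha> + \<beta>), - \<beta>, - \<alpha>] ! ((j + 7 - i) mod 7)"
    for \<alpha> \<beta> :: int and i j :: nat
  have refl: "D \<alpha> \<beta> i i = 0" for \<alpha> \<beta> i unfolding D_def by simp
  have anti: "D \<alpha> \<beta> i j + D \<alpha> \<beta> j i = 0" if "i < 7" "j < 7" for \<alpha> \<beta> i j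
  proof -
    have "i \<in> {0, 1, 2, 3, 4, 5, 6}" "j \<in> {0, 1, 2, 3, 4, 5, 6}" using that by auto
    then show ?thesis unfolding D_def by (elim insertE emptyE) simp_all
  qed
  have tri: "D \<alpha> \<beta> i j + D \<alpha> \<beta> j l = D \<alpha> \<beta> i l"
    if ijl: "k < 7" "{i, j, l} = {k, (k+1) mod 7, (k+3) mod 7} \<or> {i, j, l} = {k, (k+2) mod 7, (k+3) mod 7}"
      "i \<noteq> j" "i \<noteq> l" "j \<noteq> l" for \<alpha> \<beta> i j k l
  proof -
    \<comment> \<open>By \<open>anti\<close>, the identity for one ordering of a face yields all
      six.\<close>
    have perm: "D \<alpha> \<beta> i j + D \<alpha> \<beta> j l = D \<alpha> \<beta> i l"
      if eq: "{i, j, l} = {p, q, r}" and lt: "p < 7" "q < 7" "r < 7"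
        and base: "D \<alpha> \<beta> p q + D \<alpha> \<beta> q r = D \<alpha> \<beta> p r" for p q r
    proof -
      have "i \<in> {p, q, r}" "j \<in> {p, q, r}" "l \<in> {p, q, r}" using eq by blast+
      then consider "i = p" "j = q" "l = r" | "i = p" "j = r" "l = q" | "i = q" "j = p" "l = r"
        | "i = q" "j = r" "l = p" | "i = r" "j = p" "l = q" | "i = r" "j = q" "l = p"
        using ijl(3-5) by blast
      then show ?thesis
        using base anti[OF lt(1,2), of \<alpha> \<beta>] anti[OF lt(2,3), of \<alpha> \<beta>] anti[OF lt(1,3), of \<alpha> \<beta>]
        by cases (hypsubst, linarith)+
    qed
    have k: "k \<in> {0, 1, 2, 3, 4, 5, 6}" using ijl(1) by auto
    from ijl(2) show ?thesis
    proof (elim disjE)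
      assume "{i, j, l} = {k, (k+1) mod 7, (k+3) mod 7}"
      then show ?thesis by (rule perm) (use k in \<open>auto simp: D_def\<close>)
    next
      assume "{i, j, l} = {k, (k+2) mod 7, (k+3) mod 7}"
      then show ?thesis by (rule perm) (use k in \<open>auto simp: D_def\<close>)
    qed
  qed
  define c where "c \<alpha> \<beta> u v = D \<alpha> \<beta> (\<ll> u) (\<ll> v)" for \<alpha> \<beta> u v
  have coc: "simplicial_cocycle T (c \<alpha> \<beta>)" for \<alpha> \<beta>
    unfolding simplicial_cocycle_def
  proof (intro allI impI)
    fix u v w assume s: "{u, v, w} \<in> simplices T"
    have lt: "\<ll> x < 7" if "x \<in> {u, v, w}" for x
      using that simplices_verts[OF s] bij unfolding bij_betw_def by blast
    show "c \<alpha> \<beta> u v + c \<alpha> \<beta> v w = c \<alpha> \<beta> u w"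
    proof (cases "u = v \<or> v = w \<or> u = w")
      case True
      then show ?thesis using refl anti lt unfolding c_def by auto
    next
      case False
      then have f: "{u, v, w} \<in> faces T" using s unfolding faces_def by simp
      have "inj_on \<ll> {u, v, w}" using bij simplices_verts[OF s] unfolding bij_betw_def by (meson inj_on_subset)
      then have "\<ll> u \<noteq> \<ll> v" "\<ll> u \<noteq> \<ll> w" "\<ll> v \<noteq> \<ll> w" using False unfolding inj_on_def by auto
      moreover obtain k where "k < 7" "{\<ll> u, \<ll> v, \<ll> w} = {k, (k+1) mod 7, (k+3) mod 7} \<or>
          {\<ll> u, \<ll> v, \<ll> w} = {k, (k+2) mod 7, (k+3) mod 7}"
        using faces[OF f] by auto
      ultimately show ?thesis unfolding c_def by (intro tri)
    qed
  qed
  have nontriv: "m = 0 \<and> n = 0" if cob: "simplicial_coboundary T (\<lambda>u v. m * c 1 0 u v + n * c 0 1 u v)" for m n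
  proof -
    define p where "p = inv_into (verts T) \<ll>"
    have p: "p i \<in> verts T" "\<ll> (p i) = i" if "i < 7" for i
      using bij that unfolding p_def bij_betw_def by (simp_all add: inv_into_into f_inv_into_f)
    obtain b where "\<And>u v. {u, v} \<in> simplices T \<Longrightarrow> m * c 1 0 u v + n * c 0 1 u v = b v - b u"
      using cob unfolding simplicial_coboundary_def by blast
    then have b: "m * D 1 0 i j + n * D 0 1 i j = b (p j) - b (p i)" if "i < 7" "j < 7" for i j
      using complete p[OF that(1)] p[OF that(2)] unfolding c_def by metis
    \<comment> \<open>A coboundary sums to zero along the closed path of label steps 1, on which
      only the first cocycle is nonzero. The path of label steps 2 does the same for
      \<open>n\<close>.\<close>
    have "7 * m = 0"
      using b[of 0 1] b[of 1 2] b[of 2 3] b[of 3 4] b[of 4 5] b[of 5 6] b[of 6 0] unfolding D_def by simp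
    moreover have "7 * n = 0"
      using b[of 0 2] b[of 2 4] b[of 4 6] b[of 6 1] b[of 1 3] b[of 3 5] b[of 5 0] unfolding D_def by simp
    ultimately show ?thesis by simp
  qed
  show ?thesis using coc[of 1 0] coc[of 0 1] nontriv by (intro exI[of _ "c 1 0"] exI[of _ "c 0 1"]) simp
qed

end

section \<open>The Klein bottle as a surface\<close>

lemma equivclp_class_eq: "{q. equivclp r p q} = {q. equivclp r p' q} \<longleftrightarrow> equivclp r p p'"
proof
  assume "{q. equivclp r p q} = {q. equivclp r p' q}"
  then have "p' \<in> {q. equivclp r p q}" by simp
  then show "equivclp r p p'" by simp
next
  assume "equivclp r p p'"
  then show "{q. equivclp r p q} = {q. equivclp r p' q}"
    by (blast intro: equivclp_sym equivclp_trans)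
qed

lemma equivclp_invariant:
  assumes "equivclp r p q" "\<And>x y. r x y \<Longrightarrow> f x = f y"
  shows "f p = f q"
  using assms(1) by (induction rule: equivclp_induct) (use assms(2) in auto)

lemma unit_square_iff: "(a, b) \<in> unit_square \<longleftrightarrow> 0 \<le> a \<and> a \<le> 1 \<and> 0 \<le> b \<and> b \<le> 1"
  unfolding unit_square_def by auto

lemma compact_unit_square: "compact unit_square" and connected_unit_square: "connected unit_square"
  unfolding unit_square_def
  by (auto intro!: compact_Times convex_connected convex_Times)

text \<open>A continuous map from a compact space onto a Hausdorff space is a quotient map, and
  quotient maps with the same fibres have homeomorphic targets. Applied to \<open>klein_map\<close>
  it gives charts, applied to \<open>square_map\<close> the triangulation.\<close>

lemma glued_square_homeomorphic:
  fixes f :: "real \<times> real \<Rightarrow> 'a::metric_space"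
  assumes f: "continuous_on unit_square f"
    and fibres: "\<And>p q. p \<in> unit_square \<Longrightarrow> q \<in> unit_square \<Longrightarrow> f p = f q \<longleftrightarrow> equivclp r p q"
  shows "glued_square r homeomorphic_space top_of_set (f ` unit_square)"
proof -
  let ?X = "top_of_set unit_square" and ?Z = "top_of_set (f ` unit_square)"
  define \<pi> where "\<pi> p = {q. equivclp r p q}" for p
  have Y: "glued_square r = quotient_topology ?X \<pi>" unfolding glued_square_def \<pi>_def ..
  have q1: "quotient_map ?X (glued_square r) \<pi>"
    unfolding Y by (rule quotient_map_quotient_topology)
  have q2: "quotient_map ?X ?Z f"
  proof (rule continuous_imp_quotient_map)
    show "Hausdorff_space ?Z"
      by (intro Hausdorff_space_subtopology Hausdorff_space_euclidean)
  qed (use f compact_unit_square in \<open>auto simp: compact_space_subtopology\<close>)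
  have fib: "\<pi> p = \<pi> q \<longleftrightarrow> f p = f q" if "p \<in> unit_square" "q \<in> unit_square" for p q
    unfolding \<pi>_def equivclp_class_eq using fibres that by simp
  have fib1: "f p = f q" if "p \<in> topspace ?X" "q \<in> topspace ?X" "\<pi> p = \<pi> q" for p q
    using fib that by simp
  have fib2: "\<pi> p = \<pi> q" if "p \<in> topspace ?X" "q \<in> topspace ?X" "f p = f q" for p q
    using fib that by simp
  have "\<exists>g. continuous_map (glued_square r) ?Z g \<and> (\<forall>x\<in>topspace ?X. g (\<pi> x) = f x)"
    by (rule quotient_map_lift_exists[OF q1 quotient_imp_continuous_map[OF q2]]; use fib1 in blast)
  then obtain g where g: "continuous_map (glued_square r) ?Z g" "\<And>x. x \<in> topspace ?X \<Longrightarrow> g (\<pi> x) = f x"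
    by blast
  have "\<exists>h. continuous_map ?Z (glued_square r) h \<and> (\<forall>x\<in>topspace ?X. h (f x) = \<pi> x)"
    by (rule quotient_map_lift_exists[OF q2 quotient_imp_continuous_map[OF q1]]; use fib2 in blast)
  then obtain h where h: "continuous_map ?Z (glued_square r) h" "\<And>x. x \<in> topspace ?X \<Longrightarrow> h (f x) = \<pi> x"
    by blast
  have "topspace (glued_square r) = \<pi> ` unit_square"
    unfolding Y topspace_quotient_topology by simp
  then have "homeomorphic_maps (glued_square r) ?Z g h"
    unfolding homeomorphic_maps_def using g h by auto
  then show ?thesis unfolding homeomorphic_space_def by blast
qed

text \<open>Embeds the plane modulo the group generated by \<open>(x, y) \<mapsto> (x, y + 1)\<close> and
  \<open>(x, y) \<mapsto> (x + 1, - y)\<close>.\<close>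

definition klein_map :: "real \<times> real \<Rightarrow> complex \<times> real \<times> complex" where
  "klein_map = (\<lambda>(x, y). (cis (2 * pi * x), cos (2 * pi * y), cis (pi * x) * of_real (sin (2 * pi * y))))"

lemma klein_map_continuous: "continuous_on S klein_map"
  unfolding klein_map_def case_prod_beta by (intro continuous_intros)

lemma cis_pi_int: "cis (pi * of_int m) = (if even m then 1 else - 1)"
  by (simp add: complex_eq_iff cos_npi_int sin_npi_int)

text \<open>An odd shift of \<open>x\<close> changes the sign of \<open>cis (pi * x)\<close>, which
  compensates the sign that the reflection of \<open>y\<close> gives to the sine; the cosine does
  not notice the reflection.\<close>

lemma klein_map_eq_iff:
  "klein_map (x, y) = klein_map (x', y') \<longleftrightarrow>
     (\<exists>m n :: int. x' = x + of_int m \<and> y' = (if even m then y else - y) + of_int n)"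
proof
  assume "\<exists>m n :: int. x' = x + of_int m \<and> y' = (if even m then y else - y) + of_int n"
  then obtain m n :: int where x': "x' = x + of_int m" and y': "y' = (if even m then y else - y) + of_int n" by blast
  have 1: "cis (2 * pi * x') = cis (2 * pi * x)"
    unfolding x' by (simp add: distrib_left cis_mult[symmetric] cis_multiple_2pi)
  have 2: "cis (pi * x') = cis (pi * x) * (if even m then 1 else - 1)"
    unfolding x' by (simp add: distrib_left cis_mult[symmetric] cis_pi_int)
  have "2 * pi * y' = 2 * pi * (if even m then y else - y) + 2 * pi * of_int n"
    unfolding y' by (simp add: algebra_simps)
  then have "sin (2 * pi * y') = sin (2 * pi * (if even m then y else - y)) \<and>
      cos (2 * pi * y') = cos (2 * pi * (if even m then y else - y))"
    unfolding sin_cos_eq_iff by blast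
  then have 3: "sin (2 * pi * y') = (if even m then 1 else - 1) * sin (2 * pi * y)"
    "cos (2 * pi * y') = cos (2 * pi * y)" by auto
  show "klein_map (x, y) = klein_map (x', y')"
    unfolding klein_map_def using 1 2 3 by simp
next
  assume eq: "klein_map (x, y) = klein_map (x', y')"
  then have "cis (2 * pi * x) = cis (2 * pi * x')" unfolding klein_map_def by simp
  then have "sin (2 * pi * x') = sin (2 * pi * x) \<and> cos (2 * pi * x') = cos (2 * pi * x)"
    by (simp add: complex_eq_iff)
  then obtain m :: int where "2 * pi * x' = 2 * pi * x + 2 * pi * of_int m"
    unfolding sin_cos_eq_iff by blast
  then have "2 * pi * x' = 2 * pi * (x + of_int m)" by (simp add: algebra_simps)
  then have m: "x' = x + of_int m" by simp
  have 2: "cis (pi * x') = cis (pi * x) * (if even m then 1 else - 1)"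
    unfolding m by (simp add: distrib_left cis_mult[symmetric] cis_pi_int)
  have "cis (pi * x) * of_real (sin (2 * pi * y)) = cis (pi * x') * of_real (sin (2 * pi * y'))"
    using eq unfolding klein_map_def by simp
  then have "cis (pi * x) * of_real (sin (2 * pi * y)) = cis (pi * x) * of_real ((if even m then 1 else - 1) *
      sin (2 * pi * y'))"
    unfolding 2 by simp
  then have "complex_of_real (sin (2 * pi * y)) = of_real ((if even m then 1 else - 1) * sin (2 * pi * y'))"
    by (simp only: mult_cancel_left cis_neq_zero) simp
  then have "sin (2 * pi * y) = (if even m then 1 else - 1) * sin (2 * pi * y')"
    by (simp only: of_real_eq_iff)
  moreover have "cos (2 * pi * y) = cos (2 * pi * y')" using eq unfolding klein_map_def by simp
  ultimately have "sin (2 * pi * y') = sin (2 * pi * (if even m then y else - y)) \<and>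
      cos (2 * pi * y') = cos (2 * pi * (if even m then y else - y))" by auto
  then obtain n :: int where "2 * pi * y' = 2 * pi * (if even m then y else - y) + 2 * pi * of_int n"
    unfolding sin_cos_eq_iff by blast
  then have "2 * pi * y' = 2 * pi * ((if even m then y else - y) + of_int n)" by (simp add: algebra_simps)
  then have "y' = (if even m then y else - y) + of_int n" by simp
  with m show "\<exists>m n :: int. x' = x + of_int m \<and> y' = (if even m then y else - y) + of_int n" by blast
qed

lemma klein_glue_horizontal: "0 \<le> x \<Longrightarrow> x \<le> 1 \<Longrightarrow> equivclp klein_glue (x, 0) (x, 1)"
  by (rule r_into_equivclp) (auto simp: klein_glue_def)

lemma klein_glue_vertical: "0 \<le> y \<Longrightarrow> y \<le> 1 \<Longrightarrow> equivclp klein_glue (0, y) (1, 1 - y)"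
  by (rule r_into_equivclp) (auto simp: klein_glue_def)

lemma klein_glue_corners:
  assumes "a \<in> {0, 1}" "b \<in> {0, 1}" "c \<in> {0, 1}" "d \<in> {0, 1}"
  shows "equivclp klein_glue (a, b) (c, d)"
proof -
  have 1: "equivclp klein_glue (0, 0) (0, 1)" by (rule klein_glue_horizontal) auto
  have "equivclp klein_glue (0, 0) (1, 1 - 0)" by (rule klein_glue_vertical) auto
  then have 2: "equivclp klein_glue (0, 0) (1, 1)" by simp
  have 3: "equivclp klein_glue (1, 0) (1, 1)" by (rule klein_glue_horizontal) auto
  have "equivclp klein_glue (0, 0) (x, y)" if "x \<in> {0, 1}" "y \<in> {0, 1}" for x y
    using that 1 2 equivclp_trans[OF 2 equivclp_sym[OF 3]] by auto
  then show ?thesis using assms by (meson equivclp_sym equivclp_trans)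
qed

text \<open>Between points of the square only shifts with \<open>m\<close> in {-1, 0, 1} occur. For
  odd \<open>m\<close> the extreme values 0 and 2 of \<open>n\<close> relate corners only, and
  \<open>n = 1\<close> is the gluing of the vertical sides.\<close>

lemma klein_map_fibres:
  assumes "p \<in> unit_square" "q \<in> unit_square"
  shows "klein_map p = klein_map q \<longleftrightarrow> equivclp klein_glue p q"
proof
  assume "equivclp klein_glue p q"
  then show "klein_map p = klein_map q"
  proof (rule equivclp_invariant)
    fix u v assume "klein_glue u v"
    then consider x where "u = (x, 0)" "v = (x, 1)" | y where "u = (0, y)" "v = (1, 1 - y)"
      unfolding klein_glue_def by blast
    then show "klein_map u = klein_map v"
    proof cases
      case 1
      show ?thesis unfolding 1 klein_map_eq_iff by (intro exI[of _ 0] exI[of _ 1]) simp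
    next
      case 2
      show ?thesis unfolding 2 klein_map_eq_iff by (intro exI[of _ 1]) simp
    qed
  qed
next
  assume eq: "klein_map p = klein_map q"
  obtain x y x' y' where pq: "p = (x, y)" "q = (x', y')" by (metis prod.exhaust)
  have b: "0 \<le> x" "x \<le> 1" "0 \<le> y" "y \<le> 1" "0 \<le> x'" "x' \<le> 1" "0 \<le> y'" "y' \<le> 1"
    using assms unfolding pq unit_square_iff by auto
  obtain m n :: int where m: "x' = x + of_int m" and n: "y' = (if even m then y else - y) + of_int n"
    using eq unfolding pq klein_map_eq_iff by blast
  have "-1 \<le> real_of_int m" "real_of_int m \<le> 1" using m b by linarith+
  then have "m = 0 \<or> m = 1 \<or> m = -1" by linarith
  then show "equivclp klein_glue p q"
  proof (elim disjE)
    assume m0: "m = 0"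
    then have "-1 \<le> real_of_int n" "real_of_int n \<le> 1" using n b by auto
    then have "n = 0 \<or> n = 1 \<or> n = -1" by linarith
    then show ?thesis
    proof (elim disjE)
      assume "n = 0" then show ?thesis using m n m0 pq by simp
    next
      assume "n = 1"
      then have "y = 0" "y' = 1" "x' = x" using m n m0 b by auto
      then show ?thesis using klein_glue_horizontal b pq by simp
    next
      assume "n = -1"
      then have "y = 1" "y' = 0" "x' = x" using m n m0 b by auto
      then show ?thesis using equivclp_sym[OF klein_glue_horizontal] b pq by simp
    qed
  next
    assume m1: "m = 1"
    then have x: "x = 0" "x' = 1" and y': "y' = - y + of_int n" using m n b by auto
    then have "0 \<le> real_of_int n" "real_of_int n \<le> 2" using b by linarith+
    then have "n = 0 \<or> n = 1 \<or> n = 2" by linarith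
    then show ?thesis
    proof (elim disjE)
      assume "n = 0"
      then have "y = 0" "y' = 0" using y' b by auto
      then show ?thesis using klein_glue_corners x pq by simp
    next
      assume "n = 1"
      then show ?thesis using y' x pq klein_glue_vertical[of y] b by simp
    next
      assume "n = 2"
      then have "y = 1" "y' = 1" using y' b by auto
      then show ?thesis using klein_glue_corners x pq by simp
    qed
  next
    assume m1: "m = -1"
    then have x: "x = 1" "x' = 0" and y': "y' = - y + of_int n" using m n b by auto
    then have "0 \<le> real_of_int n" "real_of_int n \<le> 2" using b by linarith+
    then have "n = 0 \<or> n = 1 \<or> n = 2" by linarith
    then show ?thesis
    proof (elim disjE)
      assume "n = 0"
      then have "y = 0" "y' = 0" using y' b by auto
      then show ?thesis using klein_glue_corners x pq by simp
    next
      assume "n = 1"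
      then show ?thesis using y' x pq equivclp_sym[OF klein_glue_vertical[of y']] b by simp
    next
      assume "n = 2"
      then have "y = 1" "y' = 1" using y' b by auto
      then show ?thesis using klein_glue_corners x pq by simp
    qed
  qed
qed

lemma klein_map_range: "range klein_map = klein_map ` unit_square"
proof -
  have "klein_map (x, y) \<in> klein_map ` unit_square" for x y
  proof -
    let ?m = "- \<lfloor>x\<rfloor>"
    let ?z = "if even ?m then y else - y"
    have "klein_map (x, y) = klein_map (frac x, frac ?z)"
      unfolding klein_map_eq_iff frac_def by (intro exI[of _ ?m] exI[of _ "- \<lfloor>?z\<rfloor>"]) simp
    moreover have "(frac x, frac ?z) \<in> unit_square"
      unfolding unit_square_iff using frac_ge_0 frac_lt_1 by (metis less_imp_le)
    ultimately show ?thesis by blast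
  qed
  then show ?thesis by auto
qed

text \<open>The saturation of an open set is a union of its preimages under the group, hence open.
  What it leaves of the square is compact, and the image of that remainder is the closed
  complement.\<close>

lemma klein_map_open:
  assumes "open W" shows "openin (top_of_set (range klein_map)) (klein_map ` W)"
proof -
  define g where "g m n = (\<lambda>(x, y). (x + of_int m, (if even m then y else - y) + of_int n) :: real \<times> real)" for m n :: int
  have sat: "klein_map -` klein_map ` W = (\<Union>m. \<Union>n. g m n -` W)"
  proof -
    have "z \<in> klein_map -` klein_map ` W \<longleftrightarrow> (\<exists>m n. g m n z \<in> W)" for z
    proof -
      obtain x y where z: "z = (x, y)" by (metis prod.exhaust)
      show ?thesis
      proof
        assume "z \<in> klein_map -` klein_map ` W"
        then obtain w where w: "w \<in> W" "klein_map (x, y) = klein_map w" unfolding z by blast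
        obtain x' y' where xy: "w = (x', y')" by (metis prod.exhaust)
        obtain m n :: int where "x' = x + of_int m" "y' = (if even m then y else - y) + of_int n"
          using w(2) unfolding xy klein_map_eq_iff by blast
        then have "g m n z = w" unfolding g_def z xy by simp
        then show "\<exists>m n. g m n z \<in> W" using w(1) by blast
      next
        assume "\<exists>m n. g m n z \<in> W"
        then obtain m n where mn: "g m n z \<in> W" by blast
        have "klein_map z = klein_map (g m n z)"
          unfolding z g_def prod.case klein_map_eq_iff by blast
        then show "z \<in> klein_map -` klein_map ` W" using mn by auto
      qed
    qed
    then show ?thesis by (intro set_eqI) simp
  qed
  have "continuous_on UNIV (g m n)" for m n
    unfolding g_def case_prod_beta by (cases "even m") (auto intro!: continuous_intros)
  then have "open (klein_map -` klein_map ` W)"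
    unfolding sat using assms by (intro open_UN ballI open_vimage) auto
  then have "compact (unit_square - klein_map -` klein_map ` W)"
    using compact_unit_square compact_diff by blast
  then have "compact (klein_map ` (unit_square - klein_map -` klein_map ` W))"
    using klein_map_continuous compact_continuous_image by blast
  moreover have "f ` (S - f -` B) = f ` S - B" for f :: "real \<times> real \<Rightarrow> complex \<times> real \<times> complex" and S B
    by blast
  then have "klein_map ` (unit_square - klein_map -` klein_map ` W) = range klein_map - klein_map ` W"
    unfolding klein_map_range by blast
  ultimately have "closed (range klein_map - klein_map ` W)" using compact_imp_closed by metis
  then have "openin (top_of_set (range klein_map)) (range klein_map - (range klein_map - klein_map ` W))"
    by (intro openin_diff closed_subset) auto
  moreover have "range klein_map - (range klein_map - klein_map ` W) = klein_map ` W" by blast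
  ultimately show ?thesis by simp
qed

section \<open>The Klein bottle is a closed connected 2-manifold\<close>

lemma second_countable_euclidean: "second_countable (euclidean :: 'a::second_countable_topology topology)"
proof -
  obtain B :: "'a set set" where B: "countable B" "topological_basis B"
    using ex_countable_basis by blast
  have "\<exists>U\<in>B. x \<in> U \<and> U \<subseteq> W" if "open W" "x \<in> W" for W x
    using topological_basisE[OF B(2) that] by metis
  then show ?thesis
    unfolding second_countable_def using B topological_basis_open[OF B(2)] by (intro exI[of _ B]) auto
qed

text \<open>A box of side 1/2 is embedded: coordinates within it differ by less than 1, which forces
  first \<open>m = 0\<close> and then \<open>n = 0\<close>.\<close>

lemma klein_map_two_manifold: "two_manifold (top_of_set (range klein_map))"
  unfolding two_manifold_def
proof (intro conjI ballI)
  show "Hausdorff_space (top_of_set (range klein_map))"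
    by (intro Hausdorff_space_subtopology Hausdorff_space_euclidean)
  show "second_countable (top_of_set (range klein_map))"
    by (intro second_countable_subtopology second_countable_euclidean)
  fix p assume "p \<in> topspace (top_of_set (range klein_map))"
  then obtain a b where p: "p = klein_map (a, b)" by auto
  let ?W = "{a - 1/4<..<a + 1/4} \<times> {b - 1/4<..<b + 1/4}"
  have W: "open ?W" by (intro open_Times) auto
  have inj: "inj_on klein_map ?W"
  proof (rule inj_onI)
    fix u v assume uv: "u \<in> ?W" "v \<in> ?W" "klein_map u = klein_map v"
    obtain x y x' y' where *: "u = (x, y)" "v = (x', y')" by (metis prod.exhaust)
    obtain m n :: int where m: "x' = x + of_int m" and n: "y' = (if even m then y else - y) + of_int n"
      using uv(3) unfolding * klein_map_eq_iff by blast
    have "\<bar>real_of_int m\<bar> < 1" using m uv * by auto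
    then have "m = 0" by linarith
    then have "\<bar>real_of_int n\<bar> < 1" using n uv * by auto
    then have "n = 0" by linarith
    then show "u = v" using m n \<open>m = 0\<close> * by simp
  qed
  obtain k where k: "homeomorphism ?W (klein_map ` ?W) klein_map k"
  proof (rule homeomorphism_injective_open_map[OF klein_map_continuous refl inj])
    fix U assume "openin (top_of_set ?W) U"
    then have "open U" "U \<subseteq> ?W" using W openin_open_eq by blast+
    then show "openin (top_of_set (klein_map ` ?W)) (klein_map ` U)"
      using klein_map_open[of U] by (meson image_mono openin_subset_trans subset_UNIV)
  qed
  have "subtopology (top_of_set (range klein_map)) (klein_map ` ?W) = top_of_set (klein_map ` ?W)"
    by (simp add: subtopology_subtopology inf.absorb2 image_mono)
  moreover have "top_of_set (klein_map ` ?W) homeomorphic_space top_of_set ?W"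
    using homeomorphism_symD[OF k] unfolding homeomorphic_space_top_of_set homeomorphic_def by blast
  moreover have "p \<in> klein_map ` ?W" unfolding p by auto
  ultimately show "\<exists>U W. openin (top_of_set (range klein_map)) U \<and> p \<in> U \<and> open (W :: (real \<times> real) set) \<and>
      subtopology (top_of_set (range klein_map)) U homeomorphic_space top_of_set W"
    using klein_map_open[OF W] W by (intro exI[of _ "klein_map ` ?W"] exI[of _ ?W]) simp
qed

lemma homeomorphic_two_manifold:
  assumes "M homeomorphic_space N" "two_manifold N" shows "two_manifold M"
proof -
  obtain f g where fg: "homeomorphic_maps M N f g" using assms(1) unfolding homeomorphic_space_def by blast
  have f: "continuous_map M N f" "\<And>x. x \<in> topspace M \<Longrightarrow> g (f x) = x" "\<And>y. y \<in> topspace N \<Longrightarrow> f (g y) = y"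
    "continuous_map N M g"
    using fg unfolding homeomorphic_maps_def by auto
  show ?thesis
    unfolding two_manifold_def
  proof (intro conjI ballI)
    show "Hausdorff_space M" "second_countable M"
      using assms homeomorphic_Hausdorff_space homeomorphic_space_second_countability
      unfolding two_manifold_def by blast+
    fix x assume x: "x \<in> topspace M"
    then have "f x \<in> topspace N" using f(1) continuous_map_image_subset_topspace by blast
    then obtain U W where U: "openin N U" "f x \<in> U" "open (W :: (real \<times> real) set)"
        "subtopology N U homeomorphic_space top_of_set W"
      using assms(2) unfolding two_manifold_def by meson
    let ?V = "{z \<in> topspace M. f z \<in> U}"
    have "homeomorphic_maps (subtopology M ?V) (subtopology N U) f g"
    proof (rule homeomorphic_maps_subtopologies_alt[OF fg])
      show "f ` (topspace M \<inter> ?V) \<subseteq> U" by auto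
      show "g ` (topspace N \<inter> U) \<subseteq> ?V"
        using f(3,4) continuous_map_image_subset_topspace by fastforce
    qed
    then have "subtopology M ?V homeomorphic_space top_of_set W"
      using U(4) homeomorphic_space_trans unfolding homeomorphic_space_def[of "subtopology M ?V" "subtopology N U"]
      by (meson homeomorphic_space_def homeomorphic_space_trans)
    moreover have "openin M ?V" using f(1) U(1) by (rule openin_continuous_map_preimage)
    ultimately show "\<exists>U W. openin M U \<and> x \<in> U \<and> open (W :: (real \<times> real) set) \<and>
        subtopology M U homeomorphic_space top_of_set W"
      using x U(2,3) by blast
  qed
qed

lemma klein_bottle_embedding: "klein_bottle homeomorphic_space top_of_set (range klein_map)"
  unfolding klein_bottle_def klein_map_range
  by (rule glued_square_homeomorphic[OF klein_map_continuous klein_map_fibres])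

theorem klein_bottle_closed_surface: "closed_connected_two_manifold klein_bottle"
  unfolding closed_connected_two_manifold_def
proof (intro conjI)
  show "two_manifold klein_bottle"
    by (rule homeomorphic_two_manifold[OF klein_bottle_embedding klein_map_two_manifold])
  have "compact (range klein_map)" "connected (range klein_map)"
    unfolding klein_map_range
    by (simp_all add: compact_continuous_image connected_continuous_image klein_map_continuous
        compact_unit_square connected_unit_square)
  then have *: "compact_space (top_of_set (range klein_map))" "connected_space (top_of_set (range klein_map))"
    by (simp_all add: compact_space_subtopology connected_space_subtopology)
  show "compact_space klein_bottle"
    using *(1) homeomorphic_compact_space[OF klein_bottle_embedding] by simp
  show "connected_space klein_bottle"
    using *(2) homeomorphic_connected_space[OF klein_bottle_embedding] by simp
  have "(0, 0) \<in> unit_square" by (simp add: unit_square_iff)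
  then show "topspace klein_bottle \<noteq> {}"
    unfolding klein_bottle_def glued_square_def topspace_quotient_topology by auto
qed

section \<open>The eight-vertex triangulation\<close>

definition klein8_faces :: "nat set set" where
  "klein8_faces = {{0, 1, 2}, {0, 1, 3}, {0, 2, 5}, {0, 3, 4}, {0, 4, 6}, {0, 5, 7}, {0, 6, 7}, {1, 2, 4}, {1,
      3, 5}, {1, 4, 5}, {2, 3, 4}, {2, 3, 7}, {2, 5, 6}, {2, 6, 7}, {3, 5, 7}, {4, 5, 6}}"

definition klein8 :: "nat abstract_complex" where
  "klein8 = \<lparr>verts = {0, 1, 2, 3, 4, 5, 6, 7}, simplices = {s. \<exists>f\<in>klein8_faces. s \<subseteq> f}\<rparr>"

lemma klein8_faces_subset: "f \<in> klein8_faces \<Longrightarrow> f \<subseteq> verts klein8"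
  unfolding klein8_faces_def klein8_def by (elim insertE emptyE) simp_all

lemma klein8_complex: "finite_abstract_complex klein8"
  unfolding finite_abstract_complex_def
proof (intro conjI ballI allI impI)
  show "finite (verts klein8)" unfolding klein8_def by simp
  show "simplices klein8 \<subseteq> Pow (verts klein8)"
  proof
    fix s assume "s \<in> simplices klein8"
    then obtain f where "f \<in> klein8_faces" "s \<subseteq> f" unfolding klein8_def by auto
    then show "s \<in> Pow (verts klein8)" using klein8_faces_subset by blast
  qed
  show "t \<in> simplices klein8" if "s \<in> simplices klein8" "t \<subseteq> s" for s t
    using that unfolding klein8_def by auto
  fix v assume "v \<in> verts klein8"
  then have "v \<in> {0, 1, 2} \<or> v \<in> {0, 3, 4} \<or> v \<in> {0, 5, 7} \<or> v \<in> {0, 6, 7}"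
    unfolding klein8_def by auto
  moreover have "{0, 1, 2} \<in> klein8_faces" "{0, 3, 4} \<in> klein8_faces" "{0, 5, 7} \<in> klein8_faces" "{0, 6, 7} \<in>
      klein8_faces"
    by (simp_all only: klein8_faces_def insert_iff simp_thms)
  ultimately have "\<exists>f\<in>klein8_faces. v \<in> f" by (elim disjE) (rule bexI; assumption)+
  then show "{v} \<in> simplices klein8" unfolding klein8_def by auto
qed

lemma klein8_card_verts: "card (verts klein8) = 8"
  unfolding klein8_def by simp

lemma klein8_faces: "faces klein8 = klein8_faces"
proof
  have card: "card f = 3" if "f \<in> klein8_faces" for f using that unfolding klein8_faces_def by auto
  show "faces klein8 \<subseteq> klein8_faces"
  proof
    fix s assume "s \<in> faces klein8"
    then obtain f where f: "f \<in> klein8_faces" "s \<subseteq> f" "card s = 3" unfolding faces_def klein8_def by auto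
    moreover have "finite f" using card[OF f(1)] card.infinite by fastforce
    ultimately show "s \<in> klein8_faces" using card[OF f(1)] card_subset_eq by metis
  qed
  show "klein8_faces \<subseteq> faces klein8" using card unfolding faces_def klein8_def by auto
qed

text \<open>The square is cut into 16 triangles with vertices in the grid of multiples of 1/3, one for
  each face; \<open>tiling a b x0 \<dots> x7\<close> says that the point \<open>(a, b)\<close> of one of these
  triangles has barycentric coordinates \<open>x0, \<dots>, x7\<close>.\<close>

inductive tiling :: "real \<Rightarrow> real \<Rightarrow> real \<Rightarrow> real \<Rightarrow> real \<Rightarrow> real \<Rightarrow> real \<Rightarrow> real \<Rightarrow> real \<Rightarrow> real \<Rightarrow> bool" where
  "\<lbrakk>0 \<le> x0; 0 \<le> x6; 0 \<le> x7; x0 + x6 + x7 = 1; 3 * a = x6; 3 * b = x0\<rbrakk> \<Longrightarrow>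
     tiling a b x0 0 0 0 0 0 x6 x7"
| "\<lbrakk>0 \<le> x0; 0 \<le> x3; 0 \<le> x4; x0 + x3 + x4 = 1; 3 * a = x4; 3 * b = x0 + 2 * x3 + x4\<rbrakk> \<Longrightarrow>
     tiling a b x0 0 0 x3 x4 0 0 0"
| "\<lbrakk>0 \<le> x0; 0 \<le> x4; 0 \<le> x6; x0 + x4 + x6 = 1; 3 * a = x4 + x6; 3 * b = x0 + x4\<rbrakk> \<Longrightarrow>
     tiling a b x0 0 0 0 x4 0 x6 0"
| "\<lbrakk>0 \<le> x2; 0 \<le> x3; 0 \<le> x7; x2 + x3 + x7 = 1; 3 * a = x2; 3 * b = 2 * x2 + 2 * x3 + 3 * x7\<rbrakk> \<Longrightarrow>
     tiling a b 0 0 x2 x3 0 0 0 x7"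
| "\<lbrakk>0 \<le> x2; 0 \<le> x3; 0 \<le> x4; x2 + x3 + x4 = 1; 3 * a = x2 + x4; 3 * b = 2 * x2 + 2 * x3 + x4\<rbrakk> \<Longrightarrow>
     tiling a b 0 0 x2 x3 x4 0 0 0"
| "\<lbrakk>0 \<le> x2; 0 \<le> x6; 0 \<le> x7; x2 + x6 + x7 = 1; 3 * a = x2 + x6; 3 * b = 2 * x2 + 3 * x6 + 3 * x7\<rbrakk> \<Longrightarrow>
     tiling a b 0 0 x2 0 0 0 x6 x7"
| "\<lbrakk>0 \<le> x4; 0 \<le> x5; 0 \<le> x6; x4 + x5 + x6 = 1; 3 * a = x4 + 2 * x5 + x6; 3 * b = x4\<rbrakk> \<Longrightarrow>
     tiling a b 0 0 0 0 x4 x5 x6 0"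
| "\<lbrakk>0 \<le> x1; 0 \<le> x2; 0 \<le> x4; x1 + x2 + x4 = 1; 3 * a = 2 * x1 + x2 + x4; 3 * b = x1 + 2 * x2 + x4\<rbrakk> \<Longrightarrow>
     tiling a b 0 x1 x2 0 x4 0 0 0"
| "\<lbrakk>0 \<le> x1; 0 \<le> x4; 0 \<le> x5; x1 + x4 + x5 = 1; 3 * a = 2 * x1 + x4 + 2 * x5; 3 * b = x1 + x4\<rbrakk> \<Longrightarrow>
     tiling a b 0 x1 0 0 x4 x5 0 0"
| "\<lbrakk>0 \<le> x2; 0 \<le> x5; 0 \<le> x6; x2 + x5 + x6 = 1; 3 * a = x2 + 2 * x5 + x6; 3 * b = 2 * x2 + 3 * x5 + 3 * x6\<rbrakk> \<Longrightarrow>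
     tiling a b 0 0 x2 0 0 x5 x6 0"
| "\<lbrakk>0 \<le> x0; 0 \<le> x1; 0 \<le> x2; x0 + x1 + x2 = 1; 3 * a = 3 * x0 + 2 * x1 + x2; 3 * b = 2 * x0 + x1 + 2 * x2\<rbrakk> \<Longrightarrow>
     tiling a b x0 x1 x2 0 0 0 0 0"
| "\<lbrakk>0 \<le> x0; 0 \<le> x2; 0 \<le> x5; x0 + x2 + x5 = 1; 3 * a = 3 * x0 + x2 + 2 * x5; 3 * b = 2 * x0 + 2 * x2 + 3 * x5\<rbrakk> \<Longrightarrow>
     tiling a b x0 0 x2 0 0 x5 0 0"
| "\<lbrakk>0 \<le> x1; 0 \<le> x3; 0 \<le> x5; x1 + x3 + x5 = 1; 3 * a = 2 * x1 + 3 * x3 + 2 * x5; 3 * b = x1 + x3\<rbrakk> \<Longrightarrow>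
     tiling a b 0 x1 0 x3 0 x5 0 0"
| "\<lbrakk>0 \<le> x3; 0 \<le> x5; 0 \<le> x7; x3 + x5 + x7 = 1; 3 * a = 3 * x3 + 2 * x5 + 3 * x7; 3 * b = x3\<rbrakk> \<Longrightarrow>
     tiling a b 0 0 0 x3 0 x5 0 x7"
| "\<lbrakk>0 \<le> x0; 0 \<le> x1; 0 \<le> x3; x0 + x1 + x3 = 1; 3 * a = 3 * x0 + 2 * x1 + 3 * x3; 3 * b = 2 * x0 + x1 + x3\<rbrakk> \<Longrightarrow>
     tiling a b x0 x1 0 x3 0 0 0 0"
| "\<lbrakk>0 \<le> x0; 0 \<le> x5; 0 \<le> x7; x0 + x5 + x7 = 1; 3 * a = 3 * x0 + 2 * x5 + 3 * x7; 3 * b = 2 * x0 + 3 * x5 + 3 * x7\<rbrakk> \<Longrightarrow>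
     tiling a b x0 0 0 0 0 x5 0 x7"

text \<open>Sixteen tiles give 256 pairs, each a linear problem: two tiles meet only in common sides
  or corners, where their coordinates agree.\<close>

lemma tiling_unique:
  "tiling a b x0 x1 x2 x3 x4 x5 x6 x7 \<Longrightarrow> tiling a b y0 y1 y2 y3 y4 y5 y6 y7 \<Longrightarrow>
   x0 = y0 \<and> x1 = y1 \<and> x2 = y2 \<and> x3 = y3 \<and> x4 = y4 \<and> x5 = y5 \<and> x6 = y6 \<and> x7 = y7"
  by (elim tiling.cases; argo)

lemma tiling_horizontal_sides:
  "tiling a 0 x0 x1 x2 x3 x4 x5 x6 x7 \<Longrightarrow> tiling a 1 y0 y1 y2 y3 y4 y5 y6 y7 \<Longrightarrow>
   x0 = y0 \<and> x1 = y1 \<and> x2 = y2 \<and> x3 = y3 \<and> x4 = y4 \<and> x5 = y5 \<and> x6 = y6 \<and> x7 = y7"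
  by (elim tiling.cases; argo)

lemma tiling_vertical_sides:
  "tiling 0 b x0 x1 x2 x3 x4 x5 x6 x7 \<Longrightarrow> tiling 1 (1 - b) y0 y1 y2 y3 y4 y5 y6 y7 \<Longrightarrow>
   x0 = y0 \<and> x1 = y1 \<and> x2 = y2 \<and> x3 = y3 \<and> x4 = y4 \<and> x5 = y5 \<and> x6 = y6 \<and> x7 = y7"
  by (elim tiling.cases; argo)

text \<open>Inside the square a point is recovered from its coordinates; ambiguity arises only on
  the boundary. The last alternative concerns the corners, all of which carry the label 7.\<close>

lemma tiling_glued:
  "tiling a b x0 x1 x2 x3 x4 x5 x6 x7 \<Longrightarrow> tiling c d x0 x1 x2 x3 x4 x5 x6 x7 \<Longrightarrow>
   a = c \<and> b = d \<or> a = c \<and> b = 0 \<and> d = 1 \<or> a = c \<and> b = 1 \<and> d = 0 \<or>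
   a = 0 \<and> c = 1 \<and> d = 1 - b \<or> a = 1 \<and> c = 0 \<and> d = 1 - b \<or>
   (a = 0 \<or> a = 1) \<and> (b = 0 \<or> b = 1) \<and> (c = 0 \<or> c = 1) \<and> (d = 0 \<or> d = 1)"
  by (elim tiling.cases; argo)

lemma tiling_in_square:
  "tiling a b x0 x1 x2 x3 x4 x5 x6 x7 \<Longrightarrow> 0 \<le> a \<and> a \<le> 1 \<and> 0 \<le> b \<and> b \<le> 1"
  by (elim tiling.cases; argo)

text \<open>Each column of width 1/3 is cut into six stacked pieces by the sign of a barycentric
  coordinate. The witnesses solve the linear system of the respective tile.\<close>

lemma tiling_cover:
  assumes "0 \<le> a" "a \<le> 1" "0 \<le> b" "b \<le> 1"
  shows "\<exists>x0 x1 x2 x3 x4 x5 x6 x7. tiling a b x0 x1 x2 x3 x4 x5 x6 x7"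
proof -
  consider "a \<le> 1/3" | "1/3 \<le> a" "a \<le> 2/3" | "2/3 \<le> a" by linarith
  then show ?thesis
  proof cases
    case 1
    note col = this
    consider "0 \<le> 1 - 3 * a - 3 * b"
      | "1 - 3 * a - 3 * b < 0" "0 \<le> 1 - 3 * b"
      | "1 - 3 * b < 0" "0 \<le> 2 - 3 * a - 3 * b"
      | "2 - 3 * a - 3 * b < 0" "0 \<le> 2 - 3 * b"
      | "2 - 3 * b < 0" "0 \<le> 3 - 3 * a - 3 * b"
      | "3 - 3 * a - 3 * b < 0"
      by linarith
    then show ?thesis
    proof cases
      case 1
      note * = this assms col
      have "tiling a b (3 * b) 0 0 0 0 0 (3 * a) (1 - 3 * a - 3 * b)"
        by (rule tiling.intros; use * in \<open>linarith | simp add: field_simps\<close>)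
      then show ?thesis by blast
    next
      case 2
      note * = this assms col
      have "tiling a b (1 - 3 * a) 0 0 0 (-1 + 3 * a + 3 * b) 0 (1 - 3 * b) 0"
        by (rule tiling.intros; use * in \<open>linarith | simp add: field_simps\<close>)
      then show ?thesis by blast
    next
      case 3
      note * = this assms col
      have "tiling a b (2 - 3 * a - 3 * b) 0 0 (-1 + 3 * b) (3 * a) 0 0 0"
        by (rule tiling.intros; use * in \<open>linarith | simp add: field_simps\<close>)
      then show ?thesis by blast
    next
      case 4
      note * = this assms col
      have "tiling a b 0 0 (-2 + 3 * a + 3 * b) (1 - 3 * a) (2 - 3 * b) 0 0 0"
        by (rule tiling.intros; use * in \<open>linarith | simp add: field_simps\<close>)
      then show ?thesis by blast
    next
      case 5
      note * = this assms col
      have "tiling a b 0 0 (3 * a) (3 - 3 * a - 3 * b) 0 0 0 (-2 + 3 * b)"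
        by (rule tiling.intros; use * in \<open>linarith | simp add: field_simps\<close>)
      then show ?thesis by blast
    next
      case 6
      note * = this assms col
      have "tiling a b 0 0 (3 - 3 * b) 0 0 0 (-3 + 3 * a + 3 * b) (1 - 3 * a)"
        by (rule tiling.intros; use * in \<open>linarith | simp add: field_simps\<close>)
      then show ?thesis by blast
    qed
  next
    case 2
    note col = this
    consider "0 \<le> 2 - 3 * a - 3 * b"
      | "2 - 3 * a - 3 * b < 0" "0 \<le> 1 - 3 * b"
      | "1 - 3 * b < 0" "0 \<le> 3 - 3 * a - 3 * b"
      | "3 - 3 * a - 3 * b < 0" "0 \<le> 2 - 3 * b"
      | "2 - 3 * b < 0" "0 \<le> (1 + 3 * a - 3 * b) / 2"
      | "(1 + 3 * a - 3 * b) / 2 < 0"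
      by linarith
    then show ?thesis
    proof cases
      case 1
      note * = this assms col
      have "tiling a b 0 0 0 0 (3 * b) (-1 + 3 * a) (2 - 3 * a - 3 * b) 0"
        by (rule tiling.intros; use * in \<open>linarith | simp add: field_simps\<close>)
      then show ?thesis by blast
    next
      case 2
      note * = this assms col
      have "tiling a b 0 (-2 + 3 * a + 3 * b) 0 0 (2 - 3 * a) (1 - 3 * b) 0 0"
        by (rule tiling.intros; use * in \<open>linarith | simp add: field_simps\<close>)
      then show ?thesis by blast
    next
      case 3
      note * = this assms col
      have "tiling a b 0 (-1 + 3 * a) (-1 + 3 * b) 0 (3 - 3 * a - 3 * b) 0 0 0"
        by (rule tiling.intros; use * in \<open>linarith | simp add: field_simps\<close>)
      then show ?thesis by blast
    next
      case 4
      note * = this assms col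
      \<comment> \<open>The grid point (2/3, 2/3) carries no label: it is the midpoint of the edge
        from 2 to 0, which saves a ninth vertex. The two tiles at this edge span two columns, and
        their doubled width causes the denominators.\<close>
      have "tiling a b ((-3 + 3 * a + 3 * b) / 2) (2 - 3 * b) ((1 - 3 * a + 3 * b) / 2) 0 0 0 0 0"
        by (rule tiling.intros; use * in \<open>linarith | simp add: field_simps\<close>)
      then show ?thesis by blast
    next
      case 5
      note * = this assms col
      have "tiling a b ((1 + 3 * a - 3 * b) / 2) 0 ((5 - 3 * a - 3 * b) / 2) 0 0 (-2 + 3 * b) 0 0"
        by (rule tiling.intros; use * in \<open>linarith | simp add: field_simps\<close>)
      then show ?thesis by blast
    next
      case 6
      note * = this assms col
      have "tiling a b 0 0 (3 - 3 * b) 0 0 (-1 + 3 * a) (-1 - 3 * a + 3 * b) 0"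
        by (rule tiling.intros; use * in \<open>linarith | simp add: field_simps\<close>)
      then show ?thesis by blast
    qed
  next
    case 3
    note col = this
    consider "0 \<le> -2 + 3 * a - 3 * b"
      | "-2 + 3 * a - 3 * b < 0" "0 \<le> 1 - 3 * b"
      | "1 - 3 * b < 0" "0 \<le> -1 + 3 * a - 3 * b"
      | "-1 + 3 * a - 3 * b < 0" "0 \<le> 2 - 3 * b"
      | "2 - 3 * b < 0" "0 \<le> (5 - 3 * a - 3 * b) / 2"
      | "(5 - 3 * a - 3 * b) / 2 < 0"
      by linarith
    then show ?thesis
    proof cases
      case 1
      note * = this assms col
      have "tiling a b 0 0 0 (3 * b) 0 (3 - 3 * a) 0 (-2 + 3 * a - 3 * b)"
        by (rule tiling.intros; use * in \<open>linarith | simp add: field_simps\<close>)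
      then show ?thesis by blast
    next
      case 2
      note * = this assms col
      have "tiling a b 0 (2 - 3 * a + 3 * b) 0 (-2 + 3 * a) 0 (1 - 3 * b) 0 0"
        by (rule tiling.intros; use * in \<open>linarith | simp add: field_simps\<close>)
      then show ?thesis by blast
    next
      case 3
      note * = this assms col
      have "tiling a b (-1 + 3 * b) (3 - 3 * a) 0 (-1 + 3 * a - 3 * b) 0 0 0 0"
        by (rule tiling.intros; use * in \<open>linarith | simp add: field_simps\<close>)
      then show ?thesis by blast
    next
      case 4
      note * = this assms col
      have "tiling a b ((-3 + 3 * a + 3 * b) / 2) (2 - 3 * b) ((1 - 3 * a + 3 * b) / 2) 0 0 0 0 0"
        by (rule tiling.intros; use * in \<open>linarith | simp add: field_simps\<close>)
      then show ?thesis by blast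
    next
      case 5
      note * = this assms col
      have "tiling a b ((1 + 3 * a - 3 * b) / 2) 0 ((5 - 3 * a - 3 * b) / 2) 0 0 (-2 + 3 * b) 0 0"
        by (rule tiling.intros; use * in \<open>linarith | simp add: field_simps\<close>)
      then show ?thesis by blast
    next
      case 6
      note * = this assms col
      have "tiling a b (3 - 3 * b) 0 0 0 0 (3 - 3 * a) 0 (-5 + 3 * a + 3 * b)"
        by (rule tiling.intros; use * in \<open>linarith | simp add: field_simps\<close>)
      then show ?thesis by blast
    qed
  qed
qed

section \<open>The quotient map from the square onto the realization\<close>

definition placed :: "(nat \<Rightarrow> real) \<Rightarrow> real \<times> real \<Rightarrow> bool" where
  "placed x z \<longleftrightarrow> (\<forall>v. v \<notin> verts klein8 \<longrightarrow> x v = 0) \<and>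
     tiling (fst z) (snd z) (x 0) (x 1) (x 2) (x 3) (x 4) (x 5) (x 6) (x 7)"

lemma klein8_verts: "verts klein8 = {0, 1, 2, 3, 4, 5, 6, 7}"
  unfolding klein8_def by simp

lemma klein8_simplex_iff: "s \<in> simplices klein8 \<longleftrightarrow> (\<exists>f\<in>klein8_faces. s \<subseteq> f)"
  unfolding klein8_def by simp

lemma placed_unique:
  assumes "placed x z" "placed y z" shows "x = y"
proof
  fix v
  have "v \<in> {0, 1, 2, 3, 4, 5, 6, 7} \<Longrightarrow> x v = y v"
    using assms tiling_unique[of "fst z" "snd z" "x 0" "x 1" "x 2" "x 3" "x 4" "x 5" "x 6" "x 7" "y 0" "y 1" "y
        2" "y 3" "y 4" "y 5" "y 6" "y 7"]
    unfolding placed_def by auto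
  moreover have "v \<notin> {0, 1, 2, 3, 4, 5, 6, 7} \<Longrightarrow> x v = y v" using assms unfolding placed_def klein8_verts by metis
  ultimately show "x v = y v" by blast
qed

lemma placed_exists_cell:
  assumes f: "f \<in> klein8_faces" and x: "x \<in> cell f" shows "\<exists>z. placed x z"
proof -
  have out: "\<forall>v. v \<notin> verts klein8 \<longrightarrow> x v = 0"
    using klein8_faces_subset[OF f] x unfolding cell_def by blast
  have nn: "0 \<le> x v" for v using x unfolding cell_def by blast
  have zero: "x v = 0" if "v \<notin> f" for v using x that unfolding cell_def by blast
  have sum: "sum x f = 1" using x unfolding cell_def by blast
  have third: "3 * (t / 3) = t" for t :: real by simp
  have "\<exists>a b. tiling a b (x 0) (x 1) (x 2) (x 3) (x 4) (x 5) (x 6) (x 7)"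
    using f sum zero unfolding klein8_faces_def
    by (elim insertE emptyE; hypsubst)
       (simp_all, (intro exI; rule tiling.intros; (rule nn third | simp add: add.assoc))+)
  then show ?thesis using out unfolding placed_def by auto
qed

lemma placed_cell:
  assumes "placed x z" shows "\<exists>f\<in>klein8_faces. x \<in> cell f"
proof -
  have out: "x v = 0" if "v \<notin> {0, 1, 2, 3, 4, 5, 6, 7}" for v using assms that unfolding placed_def klein8_verts by blast
  from assms have "tiling (fst z) (snd z) (x 0) (x 1) (x 2) (x 3) (x 4) (x 5) (x 6) (x 7)" unfolding placed_def by blast
  then have "\<exists>f\<in>klein8_faces. (\<forall>v\<in>f. 0 \<le> x v) \<and> (\<forall>v\<in>{0, 1, 2, 3, 4, 5, 6, 7}. v \<notin> f \<longrightarrow> x v = 0) \<and> sum x f = 1"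
    unfolding klein8_faces_def by cases (simp_all add: add.assoc)
  then obtain f where f: "f \<in> klein8_faces" "\<forall>v\<in>f. 0 \<le> x v" "\<forall>v\<in>{0, 1, 2, 3, 4, 5, 6, 7}. v \<notin> f \<longrightarrow> x v = 0" "sum x f = 1"
    by blast
  have "x v = 0" if "v \<notin> f" for v using out f(3) that by blast
  moreover have "0 \<le> x v" for v using calculation f(2) by (cases "v \<in> f") auto
  ultimately show ?thesis using f(1,4) unfolding cell_def by auto
qed

lemma klein8_geom_iff: "x \<in> geom klein8 \<longleftrightarrow> (\<exists>z. placed x z)"
proof
  assume x: "x \<in> geom klein8"
  obtain f where f: "f \<in> klein8_faces" "{v. x v \<noteq> 0} \<subseteq> f"
    using geom_support_cell(1)[OF klein8_complex x] unfolding klein8_simplex_iff by blast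
  have "finite f" using finite_subset[OF klein8_faces_subset[OF f(1)]] by (simp add: klein8_verts)
  then have "x \<in> cell f" using cell_mono[OF _ f(2)] geom_support_cell(2)[OF klein8_complex x] by blast
  then show "\<exists>z. placed x z" by (rule placed_exists_cell[OF f(1)])
next
  assume "\<exists>z. placed x z"
  then obtain f where f: "f \<in> klein8_faces" "x \<in> cell f" using placed_cell by blast
  then have "f \<in> simplices klein8" unfolding klein8_simplex_iff by blast
  then show "x \<in> geom klein8" using cell_subset_geom[OF klein8_complex] f(2) by blast
qed

lemma placed_in_square: "placed x z \<Longrightarrow> z \<in> unit_square"
  using tiling_in_square unfolding placed_def unit_square_def by (cases z) auto

lemma placed_exists:
  assumes "z \<in> unit_square" shows "\<exists>x. placed x z"
proof -
  obtain a b where z: "z = (a, b)" by (cases z)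
  then obtain x0 x1 x2 x3 x4 x5 x6 x7 where *: "tiling a b x0 x1 x2 x3 x4 x5 x6 x7"
    using tiling_cover assms unfolding z unit_square_iff by blast
  let ?x = "\<lambda>v. if v < 8 then [x0, x1, x2, x3, x4, x5, x6, x7] ! v else 0"
  have "placed ?x z" unfolding placed_def z klein8_verts using * by auto
  then show ?thesis by blast
qed

definition square_map :: "real \<times> real \<Rightarrow> nat \<Rightarrow> real" where
  "square_map z = (THE x. placed x z)"

lemma square_map_eq: "placed x z \<Longrightarrow> square_map z = x"
  unfolding square_map_def using placed_unique by blast

lemma placed_square_map: "z \<in> unit_square \<Longrightarrow> placed (square_map z) z"
  using placed_exists square_map_eq by metis

lemma square_map_image: "square_map ` unit_square = geom klein8"
proof
  show "square_map ` unit_square \<subseteq> geom klein8"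
  proof
    fix x assume "x \<in> square_map ` unit_square"
    then obtain z where "z \<in> unit_square" "x = square_map z" by blast
    then have "placed x z" using placed_square_map by simp
    then show "x \<in> geom klein8" unfolding klein8_geom_iff by blast
  qed
  show "geom klein8 \<subseteq> square_map ` unit_square"
  proof
    fix x assume "x \<in> geom klein8"
    then obtain z where z: "placed x z" unfolding klein8_geom_iff by blast
    show "x \<in> square_map ` unit_square"
      using square_map_eq[OF z] placed_in_square[OF z] by blast
  qed
qed

text \<open>The relation \<open>placed\<close> is a finite disjunction of closed conditions, so the
  graph is closed and hence compact. The inverse of its injective projection to the square is then
  continuous.\<close>

lemma square_map_continuous: "continuous_on unit_square square_map"
proof -
  let ?\<Gamma> = "{w. placed (snd w) (fst w)}"
  have [continuous_intros]: "continuous_on S (\<lambda>w. snd w v)" for S :: "((real \<times> real) \<times> (nat \<Rightarrow> real)) set" and v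
    by (rule continuous_on_product_then_coordinatewise[OF continuous_on_snd[OF continuous_on_id]])
  have "?\<Gamma> = (\<Inter>v\<in>- verts klein8. {w. snd w v = 0}) \<inter> {w. tiling (fst (fst w)) (snd (fst w))
      (snd w 0) (snd w 1) (snd w 2) (snd w 3) (snd w 4) (snd w 5) (snd w 6) (snd w 7)}"
    unfolding placed_def by auto
  also have "closed \<dots>"
    unfolding tiling.simps
    by (simp; intro closed_Int closed_INT ballI closed_Collect_disj closed_Collect_conj closed_Collect_le
        closed_Collect_eq continuous_intros)
  finally have "closed ?\<Gamma>" .
  moreover have "?\<Gamma> \<subseteq> unit_square \<times> cell (verts klein8)"
  proof
    fix w assume "w \<in> ?\<Gamma>"
    then have w: "placed (snd w) (fst w)" by simp
    obtain f where "f \<in> klein8_faces" "snd w \<in> cell f" using placed_cell[OF w] by blast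
    then have "snd w \<in> cell (verts klein8)"
      using cell_mono[OF _ klein8_faces_subset] by (auto simp: klein8_verts)
    then show "w \<in> unit_square \<times> cell (verts klein8)" using placed_in_square[OF w] by (cases w) auto
  qed
  moreover have "compact (unit_square \<times> cell (verts klein8))"
    by (intro compact_Times compact_unit_square cell_compact) (simp add: klein8_verts)
  ultimately have "compact ?\<Gamma>" using compact_Int_closed[of "unit_square \<times> cell (verts klein8)" ?\<Gamma>] by (simp add:
      inf.absorb2)
  then have "continuous_on (fst ` ?\<Gamma>) (\<lambda>z. (z, square_map z))"
    by (intro continuous_on_inv continuous_intros) (auto simp: square_map_eq)
  moreover have "fst ` ?\<Gamma> = unit_square"
    using placed_exists placed_in_square by (auto simp: image_iff)
  ultimately have "continuous_on unit_square (\<lambda>z. (z, square_map z))" by simp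
  then have "continuous_on unit_square (\<lambda>z. snd (z, square_map z))" by (rule continuous_on_snd)
  then show ?thesis by simp
qed

lemma square_map_fibres:
  assumes "p \<in> unit_square" "q \<in> unit_square"
  shows "square_map p = square_map q \<longleftrightarrow> equivclp klein_glue p q"
proof
  assume "equivclp klein_glue p q"
  then show "square_map p = square_map q"
  proof (rule equivclp_invariant)
    fix u v assume uv: "klein_glue u v"
    then have sq: "u \<in> unit_square" "v \<in> unit_square" unfolding klein_glue_def by (auto simp: unit_square_iff)
    have P: "placed (square_map u) u" "placed (square_map v) v" using placed_square_map sq by auto
    have "square_map u w = square_map v w" if w: "w \<in> {0, 1, 2, 3, 4, 5, 6, 7}" for w
    proof -
      from uv consider x where "u = (x, 0)" "v = (x, 1)" | y where "u = (0, y)" "v = (1, 1 - y)"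
        unfolding klein_glue_def by blast
      then show ?thesis
      proof cases
        case 1
        then show ?thesis using P w tiling_horizontal_sides unfolding placed_def by auto
      next
        case 2
        then show ?thesis using P w tiling_vertical_sides unfolding placed_def by auto
      qed
    qed
    moreover have "square_map u w = square_map v w" if "w \<notin> {0, 1, 2, 3, 4, 5, 6, 7}" for w
      using P that unfolding placed_def klein8_verts by metis
    ultimately show "square_map u = square_map v" by blast
  qed
next
  assume eq: "square_map p = square_map q"
  obtain a b c d where pq: "p = (a, b)" "q = (c, d)" by (metis prod.exhaust)
  have sq: "0 \<le> a" "a \<le> 1" "0 \<le> b" "b \<le> 1" "0 \<le> c" "c \<le> 1" "0 \<le> d" "d \<le> 1"
    using assms unfolding pq unit_square_iff by auto
  let ?x = "square_map p"
  have "placed ?x p" "placed ?x q" using placed_square_map assms eq by metis+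
  then have "tiling a b (?x 0) (?x 1) (?x 2) (?x 3) (?x 4) (?x 5) (?x 6) (?x 7)"
      "tiling c d (?x 0) (?x 1) (?x 2) (?x 3) (?x 4) (?x 5) (?x 6) (?x 7)"
    unfolding placed_def pq by auto
  from tiling_glued[OF this] show "equivclp klein_glue p q"
    unfolding pq
  proof (elim disjE conjE)
    assume "a = c" "b = d" then show "equivclp klein_glue (a, b) (c, d)" by simp
  next
    assume "a = c" "b = 0" "d = 1"
    then show "equivclp klein_glue (a, b) (c, d)" using klein_glue_horizontal sq by simp
  next
    assume "a = c" "b = 1" "d = 0"
    then show "equivclp klein_glue (a, b) (c, d)" using equivclp_sym[OF klein_glue_horizontal] sq by simp
  next
    assume "a = 0" "c = 1" "d = 1 - b"
    then show "equivclp klein_glue (a, b) (c, d)" using klein_glue_vertical sq by simp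
  next
    assume "a = 1" "c = 0" "d = 1 - b"
    then show "equivclp klein_glue (a, b) (c, d)" using equivclp_sym[OF klein_glue_vertical[of d]] sq by simp
  qed (use klein_glue_corners in auto)
qed

theorem klein8_triangulation: "triangulation_of klein8 klein_bottle"
proof -
  have "klein_bottle homeomorphic_space top_of_set (square_map ` unit_square)"
    unfolding klein_bottle_def by (rule glued_square_homeomorphic[OF square_map_continuous square_map_fibres])
  then show ?thesis
    unfolding triangulation_of_def realization_geom square_map_image
    using klein8_complex homeomorphic_space_sym by blast
qed

text \<open>Two cocycles that are normalised to vanish on all edges at vertex 0.\<close>

definition klein8_cocycle :: "nat \<Rightarrow> nat \<Rightarrow> int" where
  "klein8_cocycle u v =
     (let P = {(1, 4), (2, 3), (2, 4), (2, 6), (2, 7), (5, 6), (5, 4)} in of_bool ((u, v) \<in> P) - of_bool ((v, u) \<in> P))"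

definition klein8_bit_cocycle :: "nat \<Rightarrow> nat \<Rightarrow> bit" where
  "klein8_bit_cocycle u v =
     (let P = {(1, 5), (2, 6), (2, 7), (3, 5), (3, 7), (4, 5), (5, 6)} in of_bool ((u, v) \<in> P \<or> (v, u) \<in> P))"

text \<open>Antisymmetry and vanishing on the diagonal reduce the cocycle identity on a face to a
  single ordering of its vertices.\<close>

lemma face_cocycle:
  fixes c :: "'v \<Rightarrow> 'v \<Rightarrow> 'b::ab_group_add"
  assumes "\<And>u v. c v u = - c u v" "\<And>u. c u u = 0" "c i j + c j k = c i k"
    "{u, v, w} \<subseteq> {i, j, k}"
  shows "c u v + c v w = c u w"
proof -
  have "u \<in> {i, j, k}" "v \<in> {i, j, k}" "w \<in> {i, j, k}" using assms(4) by auto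
  then show ?thesis
    using assms(1)[of j i] assms(1)[of k i] assms(1)[of k j] assms(2,3)
    by (elim insertE emptyE) (simp_all add: algebra_simps)
qed

lemma klein8_cocycle: "simplicial_cocycle klein8 klein8_cocycle"
  unfolding simplicial_cocycle_def klein8_simplex_iff
proof (intro allI impI)
  fix u v w :: nat assume "\<exists>f\<in>klein8_faces. {u, v, w} \<subseteq> f"
  then obtain f where f: "f \<in> klein8_faces" "{u, v, w} \<subseteq> f" by blast
  have anti: "klein8_cocycle j i = - klein8_cocycle i j" "klein8_cocycle i i = 0" for i j
    unfolding klein8_cocycle_def Let_def minus_diff_eq by (rule refl, rule diff_self)
  note face = face_cocycle[of klein8_cocycle, OF anti]
  from f show "klein8_cocycle u v + klein8_cocycle v w = klein8_cocycle u w"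
    unfolding klein8_faces_def
    by (elim insertE emptyE; hypsubst; elim face[rotated]; simp add: klein8_cocycle_def)
qed

lemma klein8_bit_cocycle: "simplicial_cocycle klein8 klein8_bit_cocycle"
  unfolding simplicial_cocycle_def klein8_simplex_iff
proof (intro allI impI)
  fix u v w :: nat assume "\<exists>f\<in>klein8_faces. {u, v, w} \<subseteq> f"
  then obtain f where f: "f \<in> klein8_faces" "{u, v, w} \<subseteq> f" by blast
  have anti: "klein8_bit_cocycle j i = - klein8_bit_cocycle i j" "klein8_bit_cocycle i i = 0" for i j
    unfolding klein8_bit_cocycle_def Let_def by auto
  note face = face_cocycle[of klein8_bit_cocycle, OF anti]
  from f show "klein8_bit_cocycle u v + klein8_bit_cocycle v w = klein8_bit_cocycle u w"
    unfolding klein8_faces_def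
    by (elim insertE emptyE; hypsubst; elim face[rotated]) (simp_all add: klein8_bit_cocycle_def)
qed

lemma klein8_edge_0:
  assumes "v \<in> verts klein8" shows "{0, v} \<in> simplices klein8"
proof -
  have I: "{0, v} \<in> simplices klein8" if "f \<in> klein8_faces" "{0, v} \<subseteq> f" for f
    using that unfolding klein8_simplex_iff by blast
  have m: "{0, 1, 2} \<in> klein8_faces" "{0, 3, 4} \<in> klein8_faces" "{0, 5, 7} \<in> klein8_faces" "{0, 6, 7} \<in> klein8_faces"
    by (simp_all only: klein8_faces_def insert_iff simp_thms)
  have "v \<in> {0, 1, 2} \<or> v \<in> {0, 3, 4} \<or> v \<in> {0, 5, 7} \<or> v \<in> {0, 6, 7}"
    using assms unfolding klein8_verts by auto
  then show ?thesis
  proof (elim disjE)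
    assume "v \<in> {0, 1, 2}" then show ?thesis by (intro I[OF m(1)]) simp
  next
    assume "v \<in> {0, 3, 4}" then show ?thesis by (intro I[OF m(2)]) simp
  next
    assume "v \<in> {0, 5, 7}" then show ?thesis by (intro I[OF m(3)]) simp
  next
    assume "v \<in> {0, 6, 7}" then show ?thesis by (intro I[OF m(4)]) simp
  qed
qed

text \<open>Vertex 0 is adjacent to all others, so a coboundary that vanishes on its star is zero.\<close>

lemma klein8_coboundary_zero:
  assumes "simplicial_coboundary klein8 c" "\<And>v. c 0 v = 0" "{u, v} \<in> simplices klein8"
  shows "c u v = 0"
proof -
  obtain b where b: "\<And>u v. {u, v} \<in> simplices klein8 \<Longrightarrow> c u v = b v - b u"
    using assms(1) unfolding simplicial_coboundary_def by blast
  have "{u, v} \<subseteq> verts klein8" using complex_finite_simplex[OF klein8_complex assms(3)] by blast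
  then have "b u = b 0" "b v = b 0" using b[OF klein8_edge_0] assms(2) by auto
  then show ?thesis using b[OF assms(3)] by simp
qed

lemma klein8_edges: "{1, 4} \<in> simplices klein8" "{1, 5} \<in> simplices klein8"
proof -
  have "{1, 4, 5} \<in> klein8_faces" by (simp_all only: klein8_faces_def insert_iff simp_thms)
  then show "{1, 4} \<in> simplices klein8" "{1, 5} \<in> simplices klein8"
    unfolding klein8_simplex_iff by (rule bexI[rotated]; simp)+
qed

lemma klein8_cocycle_nontrivial: "\<not> simplicial_coboundary klein8 klein8_cocycle"
  using klein8_coboundary_zero[OF _ _ klein8_edges(1), of klein8_cocycle] by (auto simp: klein8_cocycle_def)

text \<open>The expression in \<open>zero\<close> is the value of \<open>c\<close> around the closed
  path 0, 1, 4, which bounds no face. This one period detects all integral classes, so the integral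
  cohomology embeds into the integers.\<close>

lemma klein8_coboundary_if:
  fixes c :: "nat \<Rightarrow> nat \<Rightarrow> int"
  assumes c: "simplicial_cocycle klein8 c" and zero: "c 1 4 - c 0 4 + c 0 1 = 0"
  shows "simplicial_coboundary klein8 c"
proof -
  define e where "e u v = c u v - c 0 v + c 0 u" for u v
  have eq: "e u v + e v w = e u w" if "f \<in> klein8_faces" "{u, v, w} \<subseteq> f" for u v w f
  proof -
    have "c u v + c v w = c u w" using c that unfolding simplicial_cocycle_def klein8_simplex_iff by blast
    then show ?thesis unfolding e_def by simp
  qed
  have tri: "e i j + e j k = e i k" if "{i, j, k} \<in> klein8_faces" for i j k
    by (rule eq[OF that]) simp
  have mem: "{0, 1, 2} \<in> klein8_faces" "{0, 1, 3} \<in> klein8_faces" "{0, 2, 5} \<in> klein8_faces" "{0, 3, 4} \<in>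
      klein8_faces" "{0, 4, 6} \<in> klein8_faces" "{0, 5, 7} \<in> klein8_faces" "{0, 6, 7} \<in> klein8_faces" "{1, 2, 4}
      \<in> klein8_faces" "{1, 3, 5} \<in> klein8_faces" "{1, 4, 5} \<in> klein8_faces" "{2, 3, 4} \<in> klein8_faces" "{2, 3,
      7} \<in> klein8_faces" "{2, 5, 6} \<in> klein8_faces" "{2, 6, 7} \<in> klein8_faces" "{3, 5, 7} \<in> klein8_faces" "{4,
      5, 6} \<in> klein8_faces"
    by (simp_all only: klein8_faces_def insert_iff simp_thms)
  have "{0, 0, 0} \<subseteq> {0, 1, 2 :: nat}" by simp
  then have "e 0 0 + e 0 0 = e 0 0" by (rule eq[OF mem(1)])
  then have "c 0 0 = 0" unfolding e_def by simp
  then have e0: "e 0 v = 0" for v unfolding e_def by simp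
  have e14: "e 1 4 = 0" using zero unfolding e_def by simp
  note t = mem[THEN tri, unfolded e0 add_0]
  \<comment> \<open>Once \<open>e 1 4 = 0\<close>, the faces make every other value zero or equal,
    up to sign, to one number \<open>s\<close> with \<open>s = - s\<close>, which is zero over the
    integers. Modulo 2 it may be 1, and that solution is \<open>klein8_bit_cocycle\<close>.\<close>
  have e: "e 1 2 = 0" "e 1 3 = 0" "e 1 4 = 0" "e 1 5 = 0" "e 2 3 = 0" "e 2 4 = 0" "e 2 5 = 0" "e 2 6 = 0" "e 2 7
      = 0" "e 3 4 = 0" "e 3 5 = 0" "e 3 7 = 0" "e 4 5 = 0" "e 4 6 = 0" "e 5 6 = 0" "e 5 7 = 0" "e 6 7 = 0"
    using t e14 by linarith+
  have face: "\<forall>u\<in>{i, j, k}. \<forall>v\<in>{i, j, k}. e u v = 0"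
    if f: "{i, j, k} \<in> klein8_faces" and z: "e i j = 0" "e j k = 0" "e i k = 0" for i j k
  proof -
    have "e i i + e i i = e i i" "e j j + e j j = e j j" "e k k + e k k = e k k"
      "e i j + e j i = e i i" "e i k + e k i = e i i" "e j k + e k j = e j j"
      by (rule eq[OF f]; simp)+
    then show ?thesis using z by simp
  qed
  have "\<forall>u\<in>f. \<forall>v\<in>f. e u v = 0" if "f \<in> klein8_faces" for f
    using that[unfolded klein8_faces_def]
    by (elim insertE emptyE; hypsubst; intro face mem; intro e0 e)
  then show ?thesis
    unfolding simplicial_coboundary_def klein8_simplex_iff
  proof (intro exI[of _ "c 0"] allI impI)
    fix u v assume *: "\<And>f. f \<in> klein8_faces \<Longrightarrow> \<forall>u\<in>f. \<forall>v\<in>f. e u v = 0"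
      and "\<exists>f\<in>klein8_faces. {u, v} \<subseteq> f"
    then have "e u v = 0" by blast
    then show "c u v = c 0 v - c 0 u" unfolding e_def by simp
  qed
qed

section \<open>Distinguishing the Klein bottle from the projective plane\<close>

lemma potential_descends:
  fixes q :: "'a::t2_space \<Rightarrow> 'c::t2_space"
  assumes S: "compact S" and q: "continuous_on S q" "q ` S = Y" and \<phi>: "local_cocycle Y \<phi>"
    and g: "potential_on S (\<lambda>x y. \<phi> (q x) (q y)) g"
    and const: "\<And>x y. x \<in> S \<Longrightarrow> y \<in> S \<Longrightarrow> q x = q y \<Longrightarrow> g x = g y"
  shows "\<exists>G. potential_on Y \<phi> G"
proof -
  define G where "G y = g (SOME x. x \<in> S \<and> q x = y)" for y
  have Gq: "G (q x) = g x" if "x \<in> S" for x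
  proof -
    have "(SOME z. z \<in> S \<and> q z = q x) \<in> S \<and> q (SOME z. z \<in> S \<and> q z = q x) = q x"
      by (rule someI[of _ x]) (use that in simp)
    then show ?thesis unfolding G_def using const that by blast
  qed
  have "potential_on Y \<phi> G"
    unfolding potential_on_def
  proof
    fix p assume p: "p \<in> Y"
    obtain V where V: "open V" "p \<in> V"
        "\<And>x y z. x \<in> Y \<inter> V \<Longrightarrow> y \<in> Y \<inter> V \<Longrightarrow> z \<in> Y \<inter> V \<Longrightarrow> \<phi> x y + \<phi> y z = \<phi> x z"
      using local_cocycleE[OF \<phi> p] by metis
    \<comment> \<open>Every member contains a point over \<open>p\<close>, so that values of
      \<open>g\<close> on it can be compared with the value over \<open>p\<close>.\<close>
    define \<U> where "\<U> = {U. open U \<and> (\<forall>x\<in>S \<inter> U. \<forall>y\<in>S \<inter> U. \<phi> (q x) (q y) = g y - g x) \<and> (\<exists>k\<in>S \<inter> U. q k = p)}"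
    have fibre: "k \<in> \<Union>\<U>" if k: "k \<in> S" "q k = p" for k
    proof -
      obtain U where "open U" "k \<in> U" "\<And>x y. x \<in> S \<inter> U \<Longrightarrow> y \<in> S \<inter> U \<Longrightarrow> \<phi> (q x) (q y) = g y - g x"
        using potential_onE[OF g k(1)] by metis
      then have "U \<in> \<U>" unfolding \<U>_def using k by blast
      then show ?thesis using \<open>k \<in> U\<close> by blast
    qed
    have "open (\<Union>\<U>)" unfolding \<U>_def by (intro open_Union) blast
    then have "compact (q ` (S - \<Union>\<U>))"
      using S q(1) by (intro compact_continuous_image compact_diff) (auto intro: continuous_on_subset)
    \<comment> \<open>By compactness the image of the remainder is closed. It misses
      \<open>p\<close>, so all preimages of points near \<open>p\<close> lie in members of
      \<open>\<U>\<close>.\<close>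
    then have "open (V - q ` (S - \<Union>\<U>))" using V(1) compact_imp_closed open_Diff by blast
    moreover have "p \<in> V - q ` (S - \<Union>\<U>)" using V(2) fibre by blast
    moreover have "\<phi> x y = G y - G x" if x: "x \<in> Y \<inter> (V - q ` (S - \<Union>\<U>))" and y: "y \<in> Y \<inter> (V - q ` (S - \<Union>\<U>))" for x y
    proof -
      have *: "\<phi> z p = G p - G z \<and> \<phi> p z = G z - G p" if z: "z \<in> Y \<inter> (V - q ` (S - \<Union>\<U>))" for z
      proof -
        obtain s where s: "s \<in> S" "z = q s" using z q(2) by blast
        then have "s \<in> \<Union>\<U>" using z by blast
        then obtain U where U: "U \<in> \<U>" "s \<in> U" by blast
        then obtain k where k: "k \<in> S \<inter> U" "q k = p" unfolding \<U>_def by blast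
        have sU: "s \<in> S \<inter> U" using s(1) U(2) by blast
        have "\<forall>x\<in>S \<inter> U. \<forall>y\<in>S \<inter> U. \<phi> (q x) (q y) = g y - g x" using U(1) unfolding \<U>_def by simp
        then have "\<phi> (q s) (q k) = g k - g s" "\<phi> (q k) (q s) = g s - g k" using k(1) sU by simp_all
        moreover have "G p = g k" "G z = g s" using Gq[of k] Gq[of s] k s by auto
        ultimately show ?thesis using k(2) s(2) by simp
      qed
      have "\<phi> x p + \<phi> p y = \<phi> x y" using V(2,3) x y p by blast
      then show ?thesis using *[OF x] *[OF y] by simp
    qed
    ultimately show "\<exists>U. open U \<and> p \<in> U \<and> (\<forall>x\<in>Y \<inter> U. \<forall>y\<in>Y \<inter> U. \<phi> x y = G y - G x)"
      by (intro exI[of _ "V - q ` (S - \<Union>\<U>)"] conjI ballI)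
  qed
  then show ?thesis by blast
qed

text \<open>Pulled back to the square, an integral cocycle on the projective plane has a potential, and
  the two side pairings together force it to agree on identified points, so that it descends.\<close>

theorem klein_bottle_not_projective_plane: "\<not> klein_bottle homeomorphic_space projective_plane"
proof
  assume "klein_bottle homeomorphic_space projective_plane"
  then have "projective_plane homeomorphic_space realization klein8"
    using klein8_triangulation unfolding triangulation_of_def
    by (meson homeomorphic_space_sym homeomorphic_space_trans)
  then obtain F F' where F: "homeomorphic_maps projective_plane (top_of_set (geom klein8)) F F'"
    unfolding realization_geom homeomorphic_space_def by blast
  let ?X = "top_of_set unit_square"
  define \<pi> where "\<pi> p = {q. equivclp projective_glue p q}" for p
  have PP: "projective_plane = quotient_topology ?X \<pi>"
    unfolding projective_plane_def glued_square_def \<pi>_def ..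
  define q where "q = F \<circ> \<pi>"
  have "quotient_map ?X projective_plane \<pi>" unfolding PP by (rule quotient_map_quotient_topology)
  then have "continuous_map ?X (top_of_set (geom klein8)) q"
    unfolding q_def using F
    by (intro continuous_map_compose[OF quotient_imp_continuous_map]) (auto simp: homeomorphic_maps_def)
  then have cq: "continuous_on unit_square q" by simp
  have "homeomorphic_map projective_plane (top_of_set (geom klein8)) F"
    using F homeomorphic_maps_map by blast
  then have "F ` topspace projective_plane = geom klein8" and injF: "inj_on F (topspace projective_plane)"
    using homeomorphic_imp_surjective_map homeomorphic_imp_injective_map by fastforce+
  moreover have top: "topspace projective_plane = \<pi> ` unit_square"
    unfolding PP topspace_quotient_topology by simp
  ultimately have im: "q ` unit_square = geom klein8" unfolding q_def image_comp[symmetric] by simp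
  have q_glue: "q u = q v" if "projective_glue u v" for u v
  proof -
    have "\<pi> u = \<pi> v" unfolding \<pi>_def equivclp_class_eq using that by blast
    then show ?thesis unfolding q_def by simp
  qed
  have q_inj: "equivclp projective_glue u v" if "q u = q v" "u \<in> unit_square" "v \<in> unit_square" for u v
  proof -
    have "\<pi> u = \<pi> v" using injF that unfolding q_def top inj_on_def by auto
    then show ?thesis unfolding \<pi>_def equivclp_class_eq .
  qed
  let ?\<phi> = "\<lambda>x y. klein8_cocycle (main_vertex x) (main_vertex y)"
  have loc: "local_cocycle (geom klein8) ?\<phi>"
    by (rule simplicial_cocycle_local_cocycle[OF klein8_complex klein8_cocycle])
  have locS: "local_cocycle unit_square (\<lambda>x y. ?\<phi> (q x) (q y))"
    by (rule local_cocycle_pullback[OF loc cq]) (use im in simp)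
  have "\<exists>g. potential_on unit_square (\<lambda>x y. ?\<phi> (q x) (q y)) g"
  proof (rule potential_exists_contractible[where H = "\<lambda>t z. t *\<^sub>R z" and p = "(0, 0)"])
    show "continuous_on ({0..1} \<times> unit_square) (\<lambda>(t, x). t *\<^sub>R x)"
      unfolding case_prod_beta by (intro continuous_intros)
    show "t *\<^sub>R x \<in> unit_square" if "t \<in> {0..1}" "x \<in> unit_square" for t x
      using that by (cases x) (auto simp: unit_square_iff mult_le_one)
  qed (use compact_unit_square locS in \<open>auto simp: zero_prod_def\<close>)
  then obtain g where g: "potential_on unit_square (\<lambda>x y. ?\<phi> (q x) (q y)) g" by blast
  \<comment> \<open>Along identified sides the pulled-back cocycle is the same function of the
    parameters, so \<open>g\<close> restricts on both sides to a potential of one cocycle on the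
    interval.\<close>
  have pair: "g (\<alpha> t) - g (\<alpha> s) = g (\<beta> t) - g (\<beta> s)"
    if "continuous_on {0..1} \<alpha>" "continuous_on {0..1} \<beta>" "\<alpha> ` {0..1} \<subseteq> unit_square" "\<beta> ` {0..1} \<subseteq> unit_square"
      "\<And>t. t \<in> {0..1} \<Longrightarrow> q (\<alpha> t) = q (\<beta> t)" "s \<in> {0..1}" "t \<in> {0..1}" for \<alpha> \<beta> and s t :: real
  proof -
    have 1: "potential_on {0..1} (\<lambda>x y. ?\<phi> (q (\<alpha> x)) (q (\<alpha> y))) (\<lambda>x. g (\<alpha> x))"
      by (rule potential_on_pullback[OF g that(1,3)])
    have 2: "potential_on {0..1} (\<lambda>x y. ?\<phi> (q (\<beta> x)) (q (\<beta> y))) (\<lambda>x. g (\<beta> x))"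
      by (rule potential_on_pullback[OF g that(2,4)])
    have "potential_on {0..1} (\<lambda>x y. ?\<phi> (q (\<alpha> x)) (q (\<alpha> y))) (\<lambda>x. g (\<beta> x))"
      using 2 that(5) unfolding potential_on_def by simp
    from potential_on_unique[OF _ 1 this that(6,7)] show ?thesis by simp
  qed
  have hor: "g (t, 0) - g (s, 0) = g (1 - t, 1) - g (1 - s, 1)" if "s \<in> {0..1}" "t \<in> {0..1}" for s t
    by (rule pair[of "\<lambda>t. (t, 0)" "\<lambda>t. (1 - t, 1)"])
       (use that q_glue in \<open>auto intro!: continuous_intros simp: unit_square_iff projective_glue_def\<close>)
  have ver: "g (0, t) - g (0, s) = g (1, 1 - t) - g (1, 1 - s)" if "s \<in> {0..1}" "t \<in> {0..1}" for s t
    by (rule pair[of "\<lambda>t. (0, t)" "\<lambda>t. (1, 1 - t)"])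
       (use that q_glue in \<open>auto intro!: continuous_intros simp: unit_square_iff projective_glue_def\<close>)
  \<comment> \<open>The two instances add up to \<open>2 * g (0, 0) = 2 * g (1, 1)\<close>, and
    integers can be halved. This is the point at which coefficients modulo 2 would fail.\<close>
  have corner: "g (0, 0) = g (1, 1)" using hor[of 0 1] ver[of 0 1] by simp
  have g_glue: "g u = g v" if "projective_glue u v" for u v
    using that corner hor[of 0] ver[of 0] unfolding projective_glue_def by fastforce
  have "\<exists>G. potential_on (geom klein8) ?\<phi> G"
    by (rule potential_descends[where \<phi> = ?\<phi> and q = q, OF compact_unit_square cq im loc g])
       (use q_inj equivclp_invariant[of projective_glue _ _ g] g_glue in blast)
  then have "simplicial_coboundary klein8 klein8_cocycle"
    using coboundary_if_potential[OF klein8_complex klein8_cocycle] by blast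
  then show False using klein8_cocycle_nontrivial by blast
qed

section \<open>Eight vertices are necessary\<close>

lemma klein_triangulation_surface:
  fixes T :: "nat abstract_complex"
  assumes "triangulation_of T klein_bottle" shows "surface_complex T"
proof -
  have T: "finite_abstract_complex T" and hom: "realization T homeomorphic_space klein_bottle"
    using assms unfolding triangulation_of_def by auto
  have M: "two_manifold (realization T)"
    using homeomorphic_two_manifold[OF hom] klein_bottle_closed_surface
    unfolding closed_connected_two_manifold_def by blast
  have C: "connected_space (realization T)"
    using homeomorphic_connected_space[OF hom] klein_bottle_closed_surface
    unfolding closed_connected_two_manifold_def by blast
  show ?thesis
  proof
    show "finite_abstract_complex T" by (rule T)
    have "topspace (realization T) \<noteq> {}"
      using homeomorphic_empty_space[OF hom] klein_bottle_closed_surface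
      unfolding closed_connected_two_manifold_def by (simp add: null_topspace_iff_trivial)
    then show "verts T \<noteq> {}" unfolding realization_geom geom_def by auto
    show "\<exists>f\<in>faces T. s \<subseteq> f" if "s \<in> simplices T" "s \<noteq> {}" for s
      by (rule surface_simplex_in_face[OF T M that]) blast
    show "\<exists>w1 w2. w1 \<noteq> w2 \<and> (\<forall>w. {u, v, w} \<in> faces T \<longleftrightarrow> w = w1 \<or> w = w2)"
      if "{u, v} \<in> simplices T" "u \<noteq> v" for u v
      using surface_edge_two_faces[OF T M that] by metis
  qed (use surface_link_connected[OF T M] connected_complex[OF T C] in blast)+
qed

theorem klein_bottle_vertices:
  fixes T :: "nat abstract_complex"
  assumes T: "triangulation_of T klein_bottle" shows "8 \<le> card (verts T)"
proof -
  interpret surface_complex T by (rule klein_triangulation_surface[OF T])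
  have "klein_bottle homeomorphic_space realization T"
    using T unfolding triangulation_of_def homeomorphic_space_sym[of "realization T"] by blast
  then have hom: "realization klein8 homeomorphic_space realization T"
    using klein8_triangulation homeomorphic_space_trans unfolding triangulation_of_def by blast
  obtain R :: "(nat \<Rightarrow> nat \<Rightarrow> bit) \<Rightarrow> (nat \<Rightarrow> nat \<Rightarrow> bit) \<Rightarrow> bool" where "cohomology_embedding klein8 T R"
    using cocycle_transport[OF klein8_complex complex hom] by blast
  note R = this[unfolded cohomology_embedding_def, THEN conjunct1, rule_format]
    this[unfolded cohomology_embedding_def, THEN conjunct2, THEN conjunct1, rule_format]
    this[unfolded cohomology_embedding_def, THEN conjunct2, THEN conjunct2, THEN conjunct1, rule_format]
    this[unfolded cohomology_embedding_def, THEN conjunct2, THEN conjunct2, THEN conjunct2, rule_format]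
  \<comment> \<open>\<open>?c2\<close> reduces the generator of the integral classes. The class of
    \<open>?c1\<close> is no such reduction: it is neither zero nor that of
    \<open>?c2\<close>.\<close>
  let ?c1 = klein8_bit_cocycle and ?c2 = "\<lambda>u v. of_int (klein8_cocycle u v) :: bit"
  have c2: "simplicial_cocycle klein8 ?c2"
    using klein8_cocycle unfolding simplicial_cocycle_def by (metis of_int_add)
  obtain d1 d2 where d: "R ?c1 d1" "R ?c2 d2" using R(1)[OF klein8_bit_cocycle] R(1)[OF c2] by blast
  have d12: "R (\<lambda>u v. ?c1 u v + ?c2 u v) (\<lambda>u v. d1 u v + d2 u v)"
    using R(3)[OF d, of 1 1] by (simp only: mult_1)
  have zero: "?c1 0 v = 0" "?c2 0 v = 0" "?c1 0 v + ?c2 0 v = 0" for v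
    unfolding klein8_cocycle_def klein8_bit_cocycle_def Let_def by simp_all
  have val: "?c1 1 5 = 1" "?c2 1 4 = 1" "?c1 1 4 = 0"
    unfolding klein8_cocycle_def klein8_bit_cocycle_def Let_def by simp_all
  have n1: "\<not> simplicial_coboundary klein8 ?c1"
    using klein8_coboundary_zero[of ?c1, OF _ zero(1) klein8_edges(2)] val(1) by force
  have n2: "\<not> simplicial_coboundary klein8 ?c2"
    using klein8_coboundary_zero[of ?c2, OF _ zero(2) klein8_edges(1)] val(2) by force
  have n3: "\<not> simplicial_coboundary klein8 (\<lambda>u v. ?c1 u v + ?c2 u v)"
  proof
    assume "simplicial_coboundary klein8 (\<lambda>u v. ?c1 u v + ?c2 u v)"
    then have "?c1 1 4 + ?c2 1 4 = 0" by (rule klein8_coboundary_zero) (rule zero(3), rule klein8_edges(1))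
    then show False unfolding val by simp
  qed
  have coc: "simplicial_cocycle T d1" "simplicial_cocycle T d2" using R(2) d by blast+
  have non: "\<not> simplicial_coboundary T d1" "\<not> simplicial_coboundary T d2"
      "\<not> simplicial_coboundary T (\<lambda>u v. d1 u v + d2 u v)"
    using R(4)[OF d(1)] R(4)[OF d(2)] R(4)[OF d12] n1 n2 n3 by blast+
  note bound = vertex_bound[OF coc non]
  have "card (verts T) \<noteq> 7"
  proof
    assume 7: "card (verts T) = 7"
    obtain c1 c2 :: "nat \<Rightarrow> nat \<Rightarrow> int" where c: "simplicial_cocycle T c1" "simplicial_cocycle T c2"
      "\<And>m n. simplicial_coboundary T (\<lambda>u v. m * c1 u v + n * c2 u v) \<Longrightarrow> m = 0 \<and> n = 0"
      using seven_vertices_cocycles[OF 7 bound(2)[OF 7]] by blast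
    \<comment> \<open>The comparison now runs in the opposite direction: two independent integral
      classes of \<open>T\<close> would embed into the cohomology of \<open>klein8\<close>, which
      has rank one.\<close>
    obtain Q :: "(nat \<Rightarrow> nat \<Rightarrow> int) \<Rightarrow> (nat \<Rightarrow> nat \<Rightarrow> int) \<Rightarrow> bool" where "cohomology_embedding T klein8 Q"
      using cocycle_transport[OF complex klein8_complex] hom homeomorphic_space_sym by blast
    note Q = this[unfolded cohomology_embedding_def, THEN conjunct1, rule_format]
      this[unfolded cohomology_embedding_def, THEN conjunct2, THEN conjunct1, rule_format]
      this[unfolded cohomology_embedding_def, THEN conjunct2, THEN conjunct2, THEN conjunct1, rule_format]
      this[unfolded cohomology_embedding_def, THEN conjunct2, THEN conjunct2, THEN conjunct2, rule_format]
    obtain e1 e2 where e: "Q c1 e1" "Q c2 e2" using Q(1)[OF c(1)] Q(1)[OF c(2)] by blast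
    \<comment> \<open>The period around 0, 1, 4 from \<open>klein8_coboundary_if\<close>.\<close>
    let ?l = "\<lambda>e :: nat \<Rightarrow> nat \<Rightarrow> int. e 1 4 - e 0 4 + e 0 1"
    have comb: "m = 0 \<and> n = 0" if "m * ?l e1 + n * ?l e2 = 0" for m n
    proof -
      let ?e = "\<lambda>u v. m * e1 u v + n * e2 u v"
      have q: "Q (\<lambda>u v. m * c1 u v + n * c2 u v) ?e" by (rule Q(3)[OF e])
      have "?l ?e = 0" using that by (simp add: algebra_simps)
      then have "simplicial_coboundary klein8 ?e"
        using klein8_coboundary_if Q(2)[OF q] by blast
      then have "simplicial_coboundary T (\<lambda>u v. m * c1 u v + n * c2 u v)" by (rule Q(4)[OF q])
      then show ?thesis by (rule c(3))
    qed
    \<comment> \<open>Any two integers are linearly dependent in this way. Independence makes the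
      coefficients vanish, and then \<open>m = 1\<close>, \<open>n = 0\<close> is a forbidden
      relation.\<close>
    have "- ?l e2 * ?l e1 + ?l e1 * ?l e2 = 0" by (simp add: algebra_simps)
    from comb[OF this] have "?l e1 = 0" ..
    then show False using comb[of 1 0] by simp
  qed
  then show ?thesis using bound(1) by linarith
qed

section \<open>Cyclic colorations of \<open>klein8\<close>\<close>

lemma klein8_faces_card: "card (faces klein8) = 16"
  unfolding klein8_faces klein8_faces_def by (simp add: set_eq_subset)

text \<open>The position in the list is the colour. Apart from \<open>{0, 2, 5}\<close> there are 15
  faces, an odd number, so besides seven disjoint pairs one more face stays single.\<close>

definition klein8_pairing :: "nat set list list" where
  "klein8_pairing = [[{0, 2, 5}], [{0, 1, 2}], [{0, 1, 3}, {2, 5, 6}], [{0, 3, 4}, {2, 6, 7}], [{0, 4, 6}, {1, 3, 5}],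
     [{0, 5, 7}, {2, 3, 4}], [{0, 6, 7}, {1, 4, 5}], [{1, 2, 4}, {3, 5, 7}], [{2, 3, 7}, {4, 5, 6}]]"

lemma klein8_coloration:
  "\<exists>c :: nat set \<Rightarrow> nat. cyclic_coloration klein8 c \<and> c ` faces klein8 \<subseteq> {..<9}"
proof -
  let ?P = "\<lambda>f k. k < 9 \<and> f \<in> set (klein8_pairing ! k)"
  have "\<exists>k. ?P f k" if "f \<in> klein8_faces" for f
  proof -
    have "f \<in> \<Union>(set ` set klein8_pairing)"
      using that unfolding klein8_faces_def klein8_pairing_def
      by (elim insertE emptyE) (simp_all only: list.set image_insert image_empty Union_insert Union_empty Un_iff
          insert_iff simp_thms)
    then obtain l where l: "l \<in> set klein8_pairing" "f \<in> set l" by blast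
    then obtain k where "k < length klein8_pairing" "klein8_pairing ! k = l" using in_set_conv_nth by metis
    moreover have "length klein8_pairing = 9" unfolding klein8_pairing_def by simp
    ultimately show ?thesis using l(2) by (intro exI[of _ k]) simp
  qed
  then obtain c where c: "\<And>f. f \<in> klein8_faces \<Longrightarrow> ?P f (c f)" by metis
  have disj: "f = g \<or> f \<inter> g = {}" if "k < 9" "f \<in> set (klein8_pairing ! k)" "g \<in> set (klein8_pairing ! k)" for f g k
  proof -
    have "k \<in> {0, 1, 2, 3, 4, 5, 6, 7, 8}" using that(1) by auto
    then show ?thesis using that(2,3) unfolding klein8_pairing_def
      by (elim insertE emptyE; hypsubst; simp; elim disjE; simp)
  qed
  have "cyclic_coloration klein8 c"
    unfolding cyclic_coloration_def inj_on_def klein8_faces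
  proof (intro ballI impI)
    fix v f g assume "f \<in> {f \<in> klein8_faces. v \<in> f}" "g \<in> {f \<in> klein8_faces. v \<in> f}" and eq: "c f = c g"
    then have fg: "f \<in> klein8_faces" "g \<in> klein8_faces" "v \<in> f" "v \<in> g" by simp_all
    then show "f = g" using disj[of "c f" f g] c[OF fg(1)] c[OF fg(2)] eq by auto
  qed
  moreover have "c ` faces klein8 \<subseteq> {..<9}" unfolding klein8_faces using c by auto
  ultimately show ?thesis by blast
qed

text \<open>The face 025 meets every face, so its colour is used once; three pairwise disjoint faces do not
  fit into 8 vertices, so every other colour is used at most twice.\<close>

lemma klein8_coloration_bound:
  fixes c :: "nat set \<Rightarrow> nat"
  assumes c: "cyclic_coloration klein8 c" "c ` faces klein8 \<subseteq> {..<k}" shows "9 \<le> k"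
proof (rule ccontr)
  assume k: "\<not> 9 \<le> k"
  let ?F = "faces klein8" and ?f = "{0, 2, 5} :: nat set"
  have fin: "finite ?F" using klein8_faces_card card.infinite by fastforce
  have f: "?f \<in> ?F" by (simp only: klein8_faces klein8_faces_def insert_iff simp_thms)
  have meet: "g \<inter> ?f \<noteq> {}" if "g \<in> ?F" for g
    using that unfolding klein8_faces klein8_faces_def by (elim insertE emptyE) simp_all
  have sub: "g \<subseteq> verts klein8" if "g \<in> ?F" for g using that klein8_faces_subset unfolding klein8_faces by blast
  have disj: "g \<inter> h = {}" if "g \<in> ?F" "h \<in> ?F" "c g = c h" "g \<noteq> h" for g h
  proof (rule equals0I)
    fix v assume v: "v \<in> g \<inter> h"
    then have "inj_on c {f \<in> ?F. v \<in> f}" using c(1) sub that(1) unfolding cyclic_coloration_def by blast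
    then show False using that v unfolding inj_on_def by blast
  qed
  have two: "card {g \<in> ?F - {?f}. c g = j} \<le> 2" for j
  proof (rule ccontr)
    assume "\<not> ?thesis"
    then have "3 \<le> card {g \<in> ?F - {?f}. c g = j}" by simp
    then obtain C where C: "C \<subseteq> {g \<in> ?F - {?f}. c g = j}" "card C = 3" by (meson obtain_subset_with_card_n)
    then obtain g1 g2 g3 where g: "C = {g1, g2, g3}" "g1 \<noteq> g2" "g1 \<noteq> g3" "g2 \<noteq> g3" by (auto simp: card_3_iff)
    have F: "g1 \<in> ?F" "g2 \<in> ?F" "g3 \<in> ?F" "c g1 = c g2" "c g1 = c g3" "c g2 = c g3" using C(1) g(1) by auto
    have "card g1 = 3" "card g2 = 3" "card g3 = 3" using F unfolding faces_def by auto
    moreover have "finite g1" "finite g2" "finite g3" using calculation card.infinite by fastforce+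
    moreover have "g1 \<inter> g2 = {}" "(g1 \<union> g2) \<inter> g3 = {}" using disj F g by blast+
    ultimately have "card (g1 \<union> g2 \<union> g3) = 9" by (simp add: card_Un_disjoint)
    moreover have "card (g1 \<union> g2 \<union> g3) \<le> card (verts klein8)"
      using sub F by (intro card_mono) (auto simp: klein8_verts)
    ultimately show False using klein8_card_verts by simp
  qed
  let ?J = "{..<k} - {c ?f}"
  have "?F - {?f} = (\<Union>j\<in>?J. {g \<in> ?F - {?f}. c g = j})"
  proof (intro equalityI subsetI)
    fix g assume g: "g \<in> ?F - {?f}"
    then have "c g \<noteq> c ?f" using disj[of g ?f] f meet by blast
    then show "g \<in> (\<Union>j\<in>?J. {g \<in> ?F - {?f}. c g = j})" using g c(2) by blast
  qed blast
  then have "card (?F - {?f}) \<le> (\<Sum>j\<in>?J. card {g \<in> ?F - {?f}. c g = j})"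
    using card_UN_le[of ?J "\<lambda>j. {g \<in> ?F - {?f}. c g = j}"] by (metis finite_Diff finite_lessThan)
  also have "\<dots> \<le> (\<Sum>j\<in>?J. 2)" by (intro sum_mono two)
  also have "\<dots> = 2 * card ?J" by simp
  finally have "15 \<le> 2 * card ?J" using f fin klein8_faces_card by simp
  moreover have "card ?J = k - 1" using c(2) f by (subst card_Diff_singleton) auto
  ultimately show False using k by linarith
qed

lemma klein8_chromatic_number: "cyclic_chromatic_number klein8 = 9"
  unfolding cyclic_chromatic_number_def
  using klein8_coloration klein8_coloration_bound by (intro Least_equality) blast+

lemma V_min_klein_bottle: "V_min klein_bottle = 8"
  unfolding V_min_def
  using klein8_triangulation klein8_card_verts klein_bottle_vertices by (intro Least_equality) blast+

theorem theorem2: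
  shows "(\<exists>T :: nat abstract_complex.
            vertex_minimal_triangulation T klein_bottle \<and>
            card (verts T) = 8 \<and> cyclic_chromatic_number T = 9) \<and>
         \<not> chen_lawrencenko_conjecture_1"
proof
  show "\<exists>T :: nat abstract_complex. vertex_minimal_triangulation T klein_bottle \<and>
      card (verts T) = 8 \<and> cyclic_chromatic_number T = 9"
    using klein8_triangulation klein8_card_verts klein8_chromatic_number V_min_klein_bottle
    unfolding vertex_minimal_triangulation_def by (intro exI[of _ klein8]) simp
  show "\<not> chen_lawrencenko_conjecture_1"
    using klein_bottle_closed_surface klein_bottle_not_projective_plane klein8_triangulation
      klein8_card_verts klein8_chromatic_number V_min_klein_bottle
    unfolding chen_lawrencenko_conjecture_1_def by (metis numeral_eq_iff semiring_norm(84,88,89))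
qed

end
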